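(* Let $2\leq m\leq n$ be integers and let $\psi$ be an approximating function. Let $f(r):=r^{(m-1)(n+1)}$ and $g(r):=r^{-(n-m+1)(m-1)}f(r)$, and assume that $f$ and $g$ are dimension functions, that $r^{-(m-1)(n+1)}f(r)$ is monotonic and that $r^{-(m-1)n}f(r)$ is increasing. Then \[ \mu(W_0(m,n;\psi))= \begin{cases} 0 & \text{if } \sum_{r=1}^{\infty}\psi(r)^{m-1}<\infty,\\ 1 & \text{if } \sum_{r=1}^{\infty}\psi(r)^{m-1}=\infty, \end{cases} \] where $\mu$ is the normalised measure on $\Gamma$.
   Context: An approximating function is a decreasing function $\psi:\mathbb{R}^+\to\mathbb{R}^+$ with $\psi(r)\to 0$ as $r\to\infty$. A dimension function is an increasing continuous function $f:\mathbb{R}^+\to\mathbb{R}^+$ with $f(r)\to0$ as $r\to0$. $\mathbb{I}^{mn}:=[-\tfrac12,\tfrac12]^{mn}$, and its points are regarded as $m\times n$ matrices $X$. For a vector, $|\cdot|$ denotes the supremum norm; for $\mathbf{q}\in\mathbb{Z}^m$ (a row vector), $\mathbf{q}X\in\mathbb{R}^n$ is the vector-matrix product. Define \[ W_0(m,n;\psi):=\{X\in\mathbb{I}^{mn}: |\mathbf{q}X|<\psi(|\mathbf{q}|)\text{ for infinitely many }\mathbf{q}\in\mathbb{Z}^m\setminus\{\mathbf{0}\}\}. \] $\Gamma$ denotes the set of $X\in\mathbb{I}^{mn}$ of rank at most $m-1$; it has dimension $(m-1)(n+1)$ and, for $m\le n$, contains $W_0(m,n;\psi)$. The normalised measure $\mu$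 on $\Gamma$ is $(m-1)(n+1)$-dimensional Hausdorff measure restricted to $\Gamma$, scaled so that $\mu(\Gamma)=1$. *)

theory Defs
  imports "HOL-Analysis.Analysis"
begin

definition approximating_function :: "(real \<Rightarrow> real) \<Rightarrow> bool" where
  "approximating_function \<psi> \<longleftrightarrow>
     (\<forall>r>0. \<psi> r > 0) \<and> antimono_on {0<..} \<psi> \<and> (\<psi> \<longlongrightarrow> 0) at_top"

definition dimension_function :: "(real \<Rightarrow> real) \<Rightarrow> bool" where
  "dimension_function f \<longleftrightarrow>
     (\<forall>r>0. f r > 0) \<and> mono_on {0<..} f \<and> continuous_on {0<..} f \<and> (f \<longlongrightarrow> 0) (at_right 0)"

definition monotonic_on :: "real set \<Rightarrow> (real \<Rightarrow> real) \<Rightarrow> bool" where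
  "monotonic_on S h \<longleftrightarrow> mono_on S h \<or> antimono_on S h"

definition real_vec :: "int ^ 'm \<Rightarrow> real ^ 'm" where
  "real_vec q = (\<chi> i. real_of_int (q $ i))"

text \<open>The matrices in \<open>real ^ 'n ^ 'm\<close> have \<open>CARD('m)\<close> rows and \<open>CARD('n)\<close> columns.\<close>

definition unit_cube :: "(real ^ 'n ^ 'm) set" where
  "unit_cube = {X. \<forall>i j. X $ i $ j \<in> {-1/2..1/2}}"

definition W0 :: "(real \<Rightarrow> real) \<Rightarrow> (real ^ 'n ^ 'm) set" where
  "W0 \<psi> = {X \<in> unit_cube.
     infinite {q :: int ^ 'm. q \<noteq> 0 \<and> infnorm (real_vec q v* X) < \<psi> (infnorm (real_vec q))}}"

definition \<Gamma> :: "(real ^ 'n ^ 'm) set" where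
  "\<Gamma> = {X \<in> unit_cube. rank X \<le> CARD('m) - 1}"

text \<open>
  Integer-dimensional Hausdorff (outer) measure, with respect to the metric of the ambient type.
  Boundedness is required because the library's \<open>diameter\<close> is unspecified on unbounded sets.
  Empty members of a cover contribute 0, and a nonempty set of diameter 0 contributes
  \<open>0 ^ s\<close>, so that the case \<open>s = 0\<close> is counting measure.
\<close>

definition hausdorff_pre :: "nat \<Rightarrow> real \<Rightarrow> 'a::metric_space set \<Rightarrow> ennreal" where
  "hausdorff_pre s \<delta> A =
     (INF U \<in> {U :: nat \<Rightarrow> 'a set. A \<subseteq> (\<Union>i. U i) \<and> (\<forall>i. bounded (U i) \<and> diameter (U i) \<le> \<delta>)}.
        \<Sum>i. if U i = {} then 0 else ennreal (diameter (U i) ^ s))"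

definition hausdorff_measure :: "nat \<Rightarrow> 'a::metric_space set \<Rightarrow> ennreal" where
  "hausdorff_measure s A = (SUP \<delta> \<in> {0<..}. hausdorff_pre s \<delta> A)"

definition \<mu> :: "(real ^ 'n ^ 'm) set \<Rightarrow> ennreal" where
  "\<mu> A = (let d = (CARD('m) - 1) * (CARD('n) + 1) in
     hausdorff_measure d (A \<inter> \<Gamma>) / hausdorff_measure d (\<Gamma> :: (real ^ 'n ^ 'm) set))"

end

theory Submission
  imports Defs "HOL-Analysis.Kronecker_Approximation_Theorem"
begin

text \<open>
  A matrix \<open>X\<close> of rank below \<open>m\<close> has a left kernel vector \<open>w \<noteq> 0\<close>, and for a typical \<open>X \<in> \<Gamma>\<close> the kernel is
  the line through \<open>w\<close>.  Then \<open>|q X|\<close> is comparable with the distance of \<open>q\<close> from that line, so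
  \<open>|q X| < \<psi>(|q|)\<close> says that \<open>q\<close> is close to the line.  Scale \<open>w\<close> such that its
  coordinate of largest modulus, \<open>w i\<close>, is \<open>1\<close>, and call the other \<open>k = m - 1\<close> coordinates \<open>v\<close>.  Closeness then
  means \<open>|q i * v j - q j| < C * \<psi>(|q i|)\<close> for all \<open>j\<close>: simultaneous approximation of the point
  \<open>v \<in> [-1, 1]^k\<close> by rationals with common denominator \<open>q i\<close>.  Khintchine's theorem in dimension \<open>k\<close>
  decides this for almost all \<open>v\<close> by the convergence of \<open>\<Sum> \<psi>(r)^k\<close>.

  To transfer this to Hausdorff measure, \<open>\<Gamma>\<close> is covered by \<open>m\<close> charts.  The chart with index \<open>i\<close>
  takes \<open>(Y, v)\<close> to the matrix whose \<open>i\<close>-th row is \<open>- (\<Sum>j. v j * Y j)\<close> and whose other rows are those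
  of \<open>Y\<close>.  Its parameters range over a bounded subset of a Euclidean space of dimension
  \<open>k * n + k = (m - 1) * (n + 1)\<close>, and on that subset it is Lipschitz (\<open>dist_chart_le\<close>).  Lipschitz images
  of Lebesgue null sets have Hausdorff measure 0 in the dimension of the parameter space, and near a
  well-conditioned \<open>Y\<close> the chart shrinks distances by at most a constant factor, so
  that \<open>0 < H(\<Gamma>) < \<infinity>\<close>.  For a convergent series it remains to see that \<open>W0 \<inter> \<Gamma>\<close> comes from a null set of
  parameters; the exceptional \<open>Y\<close> with dependent rows form a null set (\<open>negligible_dependent_rows\<close>).  For
  a divergent series \<open>\<Gamma> - W0\<close> comes from a null set, and \<open>H(\<Gamma>) \<le> H(W0 \<inter> \<Gamma>) + H(\<Gamma> - W0)\<close> because the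
  outer measure \<open>H\<close> is subadditive.

  The convergence half of Khintchine's theorem is the Borel-Cantelli lemma.  For the divergence half
  (\<open>khintchine_divergence\<close>) the denominators are cut into geometric blocks.  By Dirichlet's
  theorem, in a given cube and for a late block, the rationals with denominator in the block contain a
  subset that is \<open>\<delta>\<close>-separated and has about as many points as the volume allows (\<open>ex_separated_rationals\<close>).
  Balls around these points are disjoint within a block, and separation makes the balls of
  different blocks almost independent (\<open>overlap_bound\<close>).  The
  inequality of Chung and Erdos then gives the limsup set a fixed proportion of every cube, and a
  set with this property has full measure (\<open>negligible_Compl_of_uniform_density\<close>).
\<close>

section \<open>Hausdorff measure and Lebesgue measure\<close>

lemma emeasure_lborel_cube:
  fixes c :: "'a::euclidean_space"
  assumes "0 \<le> s"
  shows "emeasure lborel (cbox c (c + s *\<^sub>R One)) = ennreal (s ^ DIM('a))"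
    and "emeasure lborel (box c (c + s *\<^sub>R One)) = ennreal (s ^ DIM('a))"
  using assms by (simp_all add: emeasure_lborel_cbox_eq emeasure_lborel_box_eq inner_add_left)

lemma cube_coordinate_diff_le:
  fixes x y c :: "'a::euclidean_space"
  assumes "x \<in> cbox c (c + s *\<^sub>R One)" "y \<in> cbox c (c + s *\<^sub>R One)" "b \<in> Basis"
  shows "\<bar>(x - y) \<bullet> b\<bar> \<le> s"
proof -
  have "c \<bullet> b \<le> x \<bullet> b" "x \<bullet> b \<le> c \<bullet> b + s" "c \<bullet> b \<le> y \<bullet> b" "y \<bullet> b \<le> c \<bullet> b + s"
    using assms by (simp_all add: mem_box inner_add_left)
  then show ?thesis by (simp add: inner_diff_left abs_le_iff)
qed

text \<open>
  The common tool for comparing covers with volume.  The dyadic cubes of \<open>covering_lemma\<close> do not overlap, so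
  their total volume is at most that of any open set that contains them.  Cubes of side
  \<open>0\<close> fill up the sequence when only finitely many are needed.
\<close>

lemma cube_cover:
  fixes S U :: "'a::euclidean_space set"
  assumes "bounded S" "open U" "S \<subseteq> U" "0 < \<delta>"
  obtains s :: "nat \<Rightarrow> real" and c :: "nat \<Rightarrow> 'a" where
    "\<And>i. 0 \<le> s i" "\<And>i. s i \<le> \<delta>"
    "S \<subseteq> (\<Union>i. cbox (c i) (c i + s i *\<^sub>R One))"
    "(\<Sum>i. ennreal (s i ^ DIM('a))) \<le> emeasure lborel U"
proof -
  obtain R where R: "R > 0" "\<And>x. x \<in> S \<Longrightarrow> norm x \<le> R"
    using assms(1) bounded_pos by blast
  have sub: "S \<subseteq> cbox ((-R) *\<^sub>R One) (R *\<^sub>R One)"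
  proof
    fix x assume "x \<in> S"
    then have "\<bar>x \<bullet> b\<bar> \<le> R" if "b \<in> Basis" for b
      using R(2)[of x] Basis_le_norm[OF that, of x] by linarith
    then show "x \<in> cbox ((-R) *\<^sub>R One) (R *\<^sub>R One)"
      by (force simp: mem_box abs_le_iff)
  qed
  have ne: "box ((-R) *\<^sub>R One) (R *\<^sub>R One :: 'a) \<noteq> {}"
    using R(1) by (auto simp: box_ne_empty)
  \<comment> \<open>The gauge keeps a cube inside \<open>U\<close> and below the prescribed size.\<close>
  define g where "g = (\<lambda>x. if x \<in> U then U \<inter> ball x (\<delta>/2) else ball x (\<delta>/2))"
  have g: "gauge g"
    using assms by (auto simp: gauge_def g_def)
  obtain D where D: "countable D"
    "\<And>K. K \<in> D \<Longrightarrow> interior K \<noteq> {} \<and> (\<exists>c d. K = cbox c d)"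
    "pairwise (\<lambda>A B. interior A \<inter> interior B = {}) D"
    "\<And>K. K \<in> D \<Longrightarrow> \<exists>x \<in> S \<inter> K. K \<subseteq> g x"
    "\<And>u v. cbox u v \<in> D \<Longrightarrow>
       \<exists>n. \<forall>i \<in> Basis. v \<bullet> i - u \<bullet> i = ((R *\<^sub>R One) \<bullet> i - ((-R) *\<^sub>R One :: 'a) \<bullet> i) / 2^n"
    "S \<subseteq> \<Union>D"
    using covering_lemma[OF sub ne g] by metis
  have cube: "\<exists>c s. 0 < s \<and> s \<le> \<delta> \<and> K = cbox c (c + s *\<^sub>R One) \<and> K \<subseteq> U" if K: "K \<in> D" for K
  proof -
    obtain u v where uv: "K = cbox u v" using D(2)[OF K] by blast
    obtain n where n: "\<forall>i \<in> Basis. v \<bullet> i - u \<bullet> i = ((R *\<^sub>R One) \<bullet> i - ((-R) *\<^sub>R One :: 'a) \<bullet> i) / 2^n"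
      using D(5) K uv by blast
    define s where "s = 2 * R / 2^n"
    have s: "s > 0" using R(1) by (simp add: s_def)
    have v: "v = u + s *\<^sub>R One"
    proof (rule euclidean_eqI)
      fix b :: 'a assume "b \<in> Basis"
      then show "v \<bullet> b = (u + s *\<^sub>R One) \<bullet> b"
        using bspec[OF n \<open>b \<in> Basis\<close>] by (simp add: s_def inner_add_left)
    qed
    obtain x where x: "x \<in> S" "x \<in> K" "K \<subseteq> g x" using D(4)[OF K] by blast
    have KU: "K \<subseteq> U" "K \<subseteq> ball x (\<delta>/2)"
      using x assms(3) by (auto simp: g_def split: if_splits)
    have "u \<in> K" "v \<in> K" using s uv v by (auto simp: mem_box inner_add_left)
    then have "dist u v < \<delta>"
      using KU(2) by (metis dist_triangle_half_r mem_ball subsetD)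
    moreover have "s \<le> dist u v"
    proof -
      obtain b :: 'a where b: "b \<in> Basis" using nonempty_Basis by blast
      have "s = \<bar>(u - v) \<bullet> b\<bar>" using s b by (simp add: v inner_diff_left inner_add_left)
      also have "\<dots> \<le> norm (u - v)" using b by (rule Basis_le_norm)
      finally show ?thesis by (simp add: dist_norm)
    qed
    ultimately show ?thesis using s v uv KU by (intro exI[of _ u] exI[of _ s]) auto
  qed
  \<comment> \<open>Enumerate the countable family, with \<open>{}\<close> at the unused indices.\<close>
  define f where "f = (\<lambda>i. if i \<in> to_nat_on D ` D then from_nat_into D i else {})"
  have fD: "f i = {} \<or> f i \<in> D" for i
    using D(1) by (auto simp: f_def)
  have fU: "(\<Union>i. f i) = \<Union>D"
  proof
    show "(\<Union>i. f i) \<subseteq> \<Union>D" using fD by blast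
    show "\<Union>D \<subseteq> (\<Union>i. f i)"
    proof
      fix x assume "x \<in> \<Union>D"
      then obtain K where "x \<in> K" "K \<in> D" by blast
      then show "x \<in> (\<Union>i. f i)"
        using D(1) by (intro UN_I[of "to_nat_on D K"]) (auto simp: f_def)
    qed
  qed
  have finj: "i = j" if "f i = f j" "f i \<noteq> {}" for i j
    using that D(1) by (auto simp: f_def split: if_splits)
  have "\<forall>i. \<exists>c s. 0 \<le> s \<and> s \<le> \<delta> \<and> f i \<subseteq> cbox c (c + s *\<^sub>R One) \<and>
      (s > 0 \<longrightarrow> f i = cbox c (c + s *\<^sub>R One) \<and> f i \<in> D \<and> f i \<subseteq> U)"
  proof
    fix i
    show "\<exists>c s. 0 \<le> s \<and> s \<le> \<delta> \<and> f i \<subseteq> cbox c (c + s *\<^sub>R One) \<and>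
      (s > 0 \<longrightarrow> f i = cbox c (c + s *\<^sub>R One) \<and> f i \<in> D \<and> f i \<subseteq> U)"
    proof (cases "f i \<in> D")
      case True
      then show ?thesis using cube[OF True] by (metis less_imp_le order_refl)
    next
      case False
      then have "f i = {}" using fD by blast
      then show ?thesis using assms(4) by (intro exI[of _ 0] exI[of _ "0::real"]) auto
    qed
  qed
  then obtain c s where cs: "\<And>i. 0 \<le> s i" "\<And>i. s i \<le> \<delta>" 
      "\<And>i. f i \<subseteq> cbox (c i) (c i + s i *\<^sub>R One)"
      "\<And>i. s i > 0 \<Longrightarrow> f i = cbox (c i) (c i + s i *\<^sub>R One) \<and> f i \<in> D \<and> f i \<subseteq> U"
    by metis
  define B where "B = (\<lambda>i. box (c i) (c i + s i *\<^sub>R One))"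
  have B0: "B i = {}" if "\<not> s i > 0" for i
    using that cs(1)[of i] by (auto simp: B_def)
  have Bint: "B i = interior (f i)" if "s i > 0" for i
    using cs(4)[OF that] by (simp add: B_def)
  have disj: "disjoint_family B"
    unfolding disjoint_family_on_def
  proof (intro ballI impI)
    fix i j :: nat assume "i \<noteq> j"
    show "B i \<inter> B j = {}"
    proof (cases "s i > 0 \<and> s j > 0")
      case True
      then have "f i \<noteq> {}" using D(2) cs(4) by force
      then have "f i \<noteq> f j" using finj \<open>i \<noteq> j\<close> by blast
      then have "interior (f i) \<inter> interior (f j) = {}"
        using True cs(4) D(3) by (meson pairwiseD)
      then show ?thesis using True Bint by blast
    qed (use B0 in auto)
  qed
  have "(\<Sum>i. ennreal (s i ^ DIM('a))) = (\<Sum>i. emeasure lborel (B i))"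
    using cs(1) by (simp add: B_def emeasure_lborel_cube)
  also have "\<dots> = emeasure lborel (\<Union>i. B i)"
    by (rule suminf_emeasure) (use disj in \<open>auto simp: B_def\<close>)
  also have "\<dots> \<le> emeasure lborel U"
  proof (rule emeasure_mono)
    show "\<Union>(range B) \<subseteq> U"
    proof (intro UN_least)
      fix i show "B i \<subseteq> U"
        by (cases "s i > 0") (use B0 Bint cs(4) interior_subset in blast)+
    qed
  qed (use assms(2) in auto)
  finally have "(\<Sum>i. ennreal (s i ^ DIM('a))) \<le> emeasure lborel U" .
  moreover have "S \<subseteq> (\<Union>i. cbox (c i) (c i + s i *\<^sub>R One))"
    using D(6) fU cs(3) by blast
  ultimately show thesis using that cs(1,2) by blast
qed

lemma hausdorff_pre_le:
  assumes "A \<subseteq> (\<Union>i. U i)" "\<And>i. bounded (U i)" "\<And>i. diameter (U i) \<le> \<delta>"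
  shows "hausdorff_pre d \<delta> A \<le> (\<Sum>i. if U i = {} then 0 else ennreal (diameter (U i) ^ d))"
  unfolding hausdorff_pre_def by (rule INF_lower) (use assms in auto)

lemma hausdorff_measure_mono:
  assumes "A \<subseteq> B" shows "hausdorff_measure d A \<le> hausdorff_measure d B"
  unfolding hausdorff_measure_def hausdorff_pre_def
  by (intro SUP_mono' INF_superset_mono) (use assms in auto)

text \<open>
  Interleave a cover of \<open>A\<close> and a cover of \<open>B\<close>.
\<close>

lemma hausdorff_pre_Un:
  "hausdorff_pre d \<delta> (A \<union> B) \<le> hausdorff_pre d \<delta> A + hausdorff_pre d \<delta> B"
proof -
  let ?C = "\<lambda>A. {U :: nat \<Rightarrow> 'a set. A \<subseteq> (\<Union>i. U i) \<and> (\<forall>i. bounded (U i) \<and> diameter (U i) \<le> \<delta>)}"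
  let ?w = "\<lambda>U. if U = {} then 0 else ennreal (diameter U ^ d)"
  have step: "hausdorff_pre d \<delta> (A \<union> B) \<le> (\<Sum>i. ?w (U i)) + (\<Sum>i. ?w (V i))"
    if U: "U \<in> ?C A" and V: "V \<in> ?C B" for U V
  proof -
    define W where "W = (\<lambda>i. if even i then U (i div 2) else V (i div 2))"
    have "A \<union> B \<subseteq> (\<Union>i. W i)"
    proof
      fix x assume "x \<in> A \<union> B"
      then consider i where "x \<in> U i" | i where "x \<in> V i" using U V by blast
      then show "x \<in> (\<Union>i. W i)"
      proof cases
        case 1 then show ?thesis by (intro UN_I[of "2*i"]) (auto simp: W_def)
      next
        case 2 then show ?thesis by (intro UN_I[of "2*i+1"]) (auto simp: W_def)
      qed
    qed
    then have "hausdorff_pre d \<delta> (A \<union> B) \<le> (\<Sum>i. ?w (W i))"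
      by (rule hausdorff_pre_le) (use U V in \<open>auto simp: W_def\<close>)
    also have "\<dots> \<le> (\<Sum>i. ?w (U i)) + (\<Sum>i. ?w (V i))"
      unfolding suminf_eq_SUP[of "\<lambda>i. ?w (W i)"]
    proof (rule SUP_least)
      fix n
      have split: "(\<Sum>i<2*n. ?w (W i)) = (\<Sum>i<n. ?w (U i)) + (\<Sum>i<n. ?w (V i))" for n
        by (induction n) (auto simp: W_def algebra_simps)
      have "(\<Sum>i<n. ?w (W i)) \<le> (\<Sum>i<2*n. ?w (W i))"
        by (intro sum_mono2) auto
      also have "\<dots> \<le> (\<Sum>i. ?w (U i)) + (\<Sum>i. ?w (V i))"
        unfolding split by (intro add_mono sum_le_suminf summableI) auto
      finally show "(\<Sum>i<n. ?w (W i)) \<le> (\<Sum>i. ?w (U i)) + (\<Sum>i. ?w (V i))" .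
    qed
    finally show ?thesis .
  qed
  show ?thesis
  proof (rule ennreal_le_epsilon)
    fix e :: real assume fin: "hausdorff_pre d \<delta> A + hausdorff_pre d \<delta> B < top" and e: "0 < e"
    have near: "\<exists>U\<in>?C X. (\<Sum>i. ?w (U i)) < hausdorff_pre d \<delta> X + ennreal (e/2)"
      if "hausdorff_pre d \<delta> X < top" for X
    proof -
      have "hausdorff_pre d \<delta> X < hausdorff_pre d \<delta> X + ennreal (e/2)"
        using that e by (simp add: ennreal_add_left_cancel_less)
      then show ?thesis
        by (subst (asm) hausdorff_pre_def) (simp only: INF_less_iff)
    qed
    obtain U V where UV: "U \<in> ?C A" "(\<Sum>i. ?w (U i)) < hausdorff_pre d \<delta> A + ennreal (e/2)"
      "V \<in> ?C B" "(\<Sum>i. ?w (V i)) < hausdorff_pre d \<delta> B + ennreal (e/2)"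
      using near[of A] near[of B] fin by (auto simp: less_top)
    have "hausdorff_pre d \<delta> (A \<union> B) \<le> (\<Sum>i. ?w (U i)) + (\<Sum>i. ?w (V i))"
      using step UV by blast
    also have "\<dots> \<le> (hausdorff_pre d \<delta> A + ennreal (e/2)) + (hausdorff_pre d \<delta> B + ennreal (e/2))"
      using UV by (intro add_mono) auto
    also have "\<dots> = hausdorff_pre d \<delta> A + hausdorff_pre d \<delta> B + ennreal e"
      using e by (simp add: algebra_simps flip: ennreal_plus)
    finally show "hausdorff_pre d \<delta> (A \<union> B) \<le> hausdorff_pre d \<delta> A + hausdorff_pre d \<delta> B + ennreal e" .
  qed
qed

lemma hausdorff_measure_Un:
  "hausdorff_measure d (A \<union> B) \<le> hausdorff_measure d A + hausdorff_measure d B"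
  unfolding hausdorff_measure_def
  by (intro SUP_least order_trans[OF hausdorff_pre_Un] add_mono SUP_upper) auto


text \<open>
  A cube of side \<open>s\<close> in dimension \<open>d\<close> has diameter at most \<open>d * s\<close>, so its image has diameter at most
  \<open>L * d * s\<close>: a cover of \<open>S\<close> by small cubes inside \<open>U\<close> becomes a cover of the image whose
  \<open>d\<close>-dimensional cost is a multiple of the total volume of the cubes.
\<close>

lemma hausdorff_measure_lipschitz_image_le:
  fixes f :: "'a::euclidean_space \<Rightarrow> 'b::metric_space"
  assumes "bounded S" "open U" "S \<subseteq> U" "0 \<le> L"
    and lip: "\<And>x y. x \<in> S \<Longrightarrow> y \<in> S \<Longrightarrow> dist (f x) (f y) \<le> L * dist x y"
  shows "hausdorff_measure DIM('a) (f ` S) \<le> ennreal ((L * DIM('a)) ^ DIM('a)) * emeasure lborel U"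
  unfolding hausdorff_measure_def
proof (rule SUP_least)
  fix \<delta> :: real assume "\<delta> \<in> {0<..}"
  then have \<delta>: "0 < \<delta>" by simp
  let ?d = "DIM('a)"
  define \<epsilon> where "\<epsilon> = \<delta> / (L * ?d + 1)"
  have pos: "0 < L * ?d + 1" using assms(4) by (simp add: add_nonneg_pos)
  have \<epsilon>: "0 < \<epsilon>" "L * ?d * \<epsilon> \<le> \<delta>"
  proof -
    show "0 < \<epsilon>" using \<delta> pos by (simp add: \<epsilon>_def)
    have "L * ?d * \<epsilon> \<le> (L * ?d + 1) * \<epsilon>" using \<open>0 < \<epsilon>\<close> by (intro mult_right_mono) auto
    also have "\<dots> = \<delta>" using pos by (simp add: \<epsilon>_def)
    finally show "L * ?d * \<epsilon> \<le> \<delta>" .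
  qed
  obtain s and c :: "nat \<Rightarrow> 'a" where cs: "\<And>i. 0 \<le> s i" "\<And>i. s i \<le> \<epsilon>"
    "S \<subseteq> (\<Union>i. cbox (c i) (c i + s i *\<^sub>R One))"
    "(\<Sum>i. ennreal (s i ^ ?d)) \<le> emeasure lborel U"
    by (rule cube_cover[OF assms(1-3) \<epsilon>(1)]) (rule that)
  define V where "V = (\<lambda>i. f ` (S \<inter> cbox (c i) (c i + s i *\<^sub>R One)))"
  have dV: "dist u v \<le> L * ?d * s i" if uv: "u \<in> V i" "v \<in> V i" for i u v
  proof -
    obtain x y where xy: "u = f x" "v = f y" "x \<in> S" "y \<in> S"
      "x \<in> cbox (c i) (c i + s i *\<^sub>R One)" "y \<in> cbox (c i) (c i + s i *\<^sub>R One)"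
      using uv unfolding V_def by blast
    have "dist x y \<le> (\<Sum>b\<in>Basis. \<bar>(x - y) \<bullet> b\<bar>)"
      unfolding dist_norm by (rule norm_le_l1)
    also have "\<dots> \<le> (\<Sum>b\<in>(Basis::'a set). s i)"
      using xy(5,6) by (intro sum_mono cube_coordinate_diff_le)
    finally have "dist x y \<le> ?d * s i" by simp
    then have "L * dist x y \<le> L * (?d * s i)" using assms(4) by (rule mult_left_mono)
    then show ?thesis using lip[OF xy(3,4)] xy(1,2) by (simp add: mult.assoc)
  qed
  have nn: "0 \<le> L * ?d * s i" for i using cs(1) assms(4) by simp
  have bdd: "bounded (V i)" for i
  proof (cases "V i = {}")
    case False
    then obtain u where "u \<in> V i" by blast
    then show ?thesis unfolding bounded_def using dV by blast
  qed simp
  have diam: "diameter (V i) \<le> L * ?d * s i" for i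
    unfolding diameter_def using dV nn by (auto intro!: cSUP_least)
  have le: "L * ?d * s i \<le> \<delta>" for i
  proof -
    have "L * ?d * s i \<le> L * ?d * \<epsilon>" using cs(2) assms(4) by (intro mult_left_mono) auto
    then show ?thesis using \<epsilon>(2) by linarith
  qed
  have "hausdorff_pre ?d \<delta> (f ` S) \<le> (\<Sum>i. if V i = {} then 0 else ennreal (diameter (V i) ^ ?d))"
  proof (rule hausdorff_pre_le)
    show "f ` S \<subseteq> (\<Union>i. V i)" using cs(3) unfolding V_def by blast
  qed (use bdd order_trans[OF diam le] in auto)
  also have "\<dots> \<le> (\<Sum>i. ennreal ((L * ?d) ^ ?d) * ennreal (s i ^ ?d))"
  proof (intro suminf_le summableI)
    fix i
    have "diameter (V i) ^ ?d \<le> (L * ?d * s i) ^ ?d"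
      by (intro power_mono diam diameter_ge_0 bdd)
    then have "ennreal (diameter (V i) ^ ?d) \<le> ennreal ((L * ?d) ^ ?d) * ennreal (s i ^ ?d)"
      using assms(4) cs(1) by (simp add: power_mult_distrib ennreal_leI flip: ennreal_mult)
    then show "(if V i = {} then 0 else ennreal (diameter (V i) ^ ?d))
        \<le> ennreal ((L * ?d) ^ ?d) * ennreal (s i ^ ?d)" by simp
  qed
  also have "\<dots> = ennreal ((L * ?d) ^ ?d) * (\<Sum>i. ennreal (s i ^ ?d))"
    by (rule ennreal_suminf_cmult)
  also have "\<dots> \<le> ennreal ((L * ?d) ^ ?d) * emeasure lborel U"
    by (rule mult_left_mono[OF cs(4)]) simp
  finally show "hausdorff_pre ?d \<delta> (f ` S) \<le> ennreal ((L * ?d) ^ ?d) * emeasure lborel U" .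
qed

lemma hausdorff_measure_lipschitz_image_finite:
  fixes f :: "'a::euclidean_space \<Rightarrow> 'b::metric_space"
  assumes "bounded S" "0 \<le> L"
    and "\<And>x y. x \<in> S \<Longrightarrow> y \<in> S \<Longrightarrow> dist (f x) (f y) \<le> L * dist x y"
  shows "hausdorff_measure DIM('a) (f ` S) < top"
proof -
  obtain a where "S \<subseteq> ball 0 a"
    using assms(1) bounded_subset_ballD by blast
  then have "hausdorff_measure DIM('a) (f ` S)
      \<le> ennreal ((L * DIM('a)) ^ DIM('a)) * emeasure lborel (ball (0::'a) a)"
    using assms by (intro hausdorff_measure_lipschitz_image_le) auto
  also have "\<dots> < top"
    using emeasure_lborel_ball_finite[of "0::'a" a] by (simp add: ennreal_mult_less_top)
  finally show ?thesis .
qed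

lemma hausdorff_measure_lipschitz_image_negligible:
  fixes f :: "'a::euclidean_space \<Rightarrow> 'b::metric_space"
  assumes "bounded S" "negligible S" "0 \<le> L"
    and "\<And>x y. x \<in> S \<Longrightarrow> y \<in> S \<Longrightarrow> dist (f x) (f y) \<le> L * dist x y"
  shows "hausdorff_measure DIM('a) (f ` S) = 0"
proof -
  let ?C = "ennreal ((L * DIM('a)) ^ DIM('a))"
  have "hausdorff_measure DIM('a) (f ` S) \<le> ennreal e" if "0 < e" for e
  proof -
    define \<eta> where "\<eta> = e / ((L * DIM('a)) ^ DIM('a) + 1)"
    have pos: "(L * DIM('a)) ^ DIM('a) + 1 > 0" using assms(3) by (simp add: add_nonneg_pos)
    have \<eta>: "\<eta> > 0" using that pos by (simp add: \<eta>_def)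
    have S: "S \<in> null_sets lebesgue" using assms(2) negligible_iff_null_sets by blast
    then have "S \<in> sets lebesgue" by blast
    then obtain T where T: "open T" "S \<subseteq> T" "emeasure lebesgue (T - S) < ennreal \<eta>"
      by (rule sets_lebesgue_outer_open[OF _ \<eta>])
    have "emeasure lborel T = emeasure lebesgue T" using T(1) by simp
    also have "\<dots> = emeasure lebesgue (T - S)"
      using S T(1) by (intro emeasure_Diff_null_set[symmetric]) auto
    finally have "emeasure lborel T \<le> ennreal \<eta>" using T(3) by simp
    moreover have "hausdorff_measure DIM('a) (f ` S) \<le> ?C * emeasure lborel T"
      using assms T by (intro hausdorff_measure_lipschitz_image_le) auto
    ultimately have "hausdorff_measure DIM('a) (f ` S) \<le> ?C * ennreal \<eta>"
      by (meson mult_left_mono order_trans zero_le)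
    also have "\<dots> = ennreal ((L * DIM('a)) ^ DIM('a) * \<eta>)"
      using assms(3) \<eta> by (simp add: ennreal_mult)
    also have "(L * DIM('a)) ^ DIM('a) * \<eta> \<le> ((L * DIM('a)) ^ DIM('a) + 1) * \<eta>"
      using \<eta> by (intro mult_right_mono) auto
    also have "\<dots> = e" using pos by (simp add: \<eta>_def)
    finally show ?thesis by (simp add: ennreal_leI)
  qed
  then have "hausdorff_measure DIM('a) (f ` S) \<le> 0"
    by (intro ennreal_le_epsilon[of 0]) simp_all
  then show ?thesis by simp
qed

text \<open>
  The counterpart for maps that do not shrink distances much: pull a cover of the image back to \<open>S\<close>,
  and enclose each piece in a cube of twice its diameter.
\<close>

lemma emeasure_le_hausdorff_measure:
  fixes f :: "'a::euclidean_space \<Rightarrow> 'b::metric_space"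
  assumes "S \<in> sets borel" "0 < L"
    and exp: "\<And>x y. x \<in> S \<Longrightarrow> y \<in> S \<Longrightarrow> dist x y \<le> L * dist (f x) (f y)"
  shows "emeasure lborel S \<le> ennreal ((2 * L) ^ DIM('a)) * hausdorff_measure DIM('a) (f ` S)"
proof -
  let ?d = "DIM('a)"
  let ?C = "ennreal ((2 * L) ^ ?d)"
  have "emeasure lborel S \<le> ?C * (\<Sum>i. if U i = {} then 0 else ennreal (diameter (U i) ^ ?d))"
    if U: "f ` S \<subseteq> (\<Union>i. U i)" "\<And>i. bounded (U i)" for U :: "nat \<Rightarrow> 'b set"
  proof -
    define P where "P = (\<lambda>i. S \<inter> f -` U i)"
    define D where "D = (\<lambda>i. diameter (U i))"
    have D0: "0 \<le> D i" for i using U(2) by (simp add: D_def diameter_ge_0)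
    have "\<exists>B. B \<in> sets borel \<and> P i \<subseteq> B \<and>
        emeasure lborel B \<le> ?C * (if U i = {} then 0 else ennreal (D i ^ ?d))" for i
    proof (cases "P i = {}")
      case True then show ?thesis by (intro exI[of _ "{}"]) auto
    next
      case False
      then obtain x where x: "x \<in> P i" by blast
      let ?c = "x - (L * D i) *\<^sub>R One"
      have "P i \<subseteq> cbox ?c (?c + (2 * L * D i) *\<^sub>R One)"
      proof
        fix y assume y: "y \<in> P i"
        have "dist x y \<le> L * dist (f x) (f y)" using x y by (intro exp) (auto simp: P_def)
        also have "\<dots> \<le> L * D i"
          unfolding D_def using x y U(2) assms(2)
          by (intro mult_left_mono diameter_bounded_bound) (auto simp: P_def)
        finally have "\<bar>(x - y) \<bullet> b\<bar> \<le> L * D i" if "b \<in> Basis" for b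
          using Basis_le_norm[OF that, of "x - y"] by (simp add: dist_norm)
        then show "y \<in> cbox ?c (?c + (2 * L * D i) *\<^sub>R One)"
          by (auto simp: mem_box abs_le_iff algebra_simps)
      qed
      moreover have "emeasure lborel (cbox ?c (?c + (2 * L * D i) *\<^sub>R One)) = ?C * ennreal (D i ^ ?d)"
        using assms(2) D0[of i]
        by (subst emeasure_lborel_cube) (simp_all add: power_mult_distrib ennreal_mult)
      moreover have "U i \<noteq> {}" using x by (auto simp: P_def)
      ultimately show ?thesis by (intro exI[of _ "cbox ?c (?c + (2 * L * D i) *\<^sub>R One)"]) auto
    qed
    then obtain B where B: "\<And>i. B i \<in> sets borel" "\<And>i. P i \<subseteq> B i"
      "\<And>i. emeasure lborel (B i) \<le> ?C * (if U i = {} then 0 else ennreal (D i ^ ?d))"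
      by metis
    have "emeasure lborel S \<le> emeasure lborel (\<Union>i. B i)"
    proof (rule emeasure_mono)
      show "S \<subseteq> (\<Union>i. B i)" using U(1) B(2) unfolding P_def by blast
      show "(\<Union>i. B i) \<in> sets lborel" using B(1) by auto
    qed
    also have "\<dots> \<le> (\<Sum>i. emeasure lborel (B i))"
      using B(1) by (intro emeasure_subadditive_countably) auto
    also have "\<dots> \<le> (\<Sum>i. ?C * (if U i = {} then 0 else ennreal (D i ^ ?d)))"
      using B(3) by (intro suminf_le summableI) auto
    also have "\<dots> = ?C * (\<Sum>i. if U i = {} then 0 else ennreal (D i ^ ?d))"
      by (rule ennreal_suminf_cmult)
    finally show ?thesis unfolding D_def .
  qed
  note cover = this
  have "emeasure lborel S \<le> ?C * hausdorff_pre ?d 1 (f ` S)"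
  proof -
    have C: "?C \<noteq> 0" "?C \<noteq> top" using assms(2) by auto
    have "emeasure lborel S / ?C \<le> hausdorff_pre ?d 1 (f ` S)"
      unfolding hausdorff_pre_def
    proof (rule INF_greatest)
      fix U :: "nat \<Rightarrow> 'b set"
      assume "U \<in> {U. f ` S \<subseteq> (\<Union>i. U i) \<and> (\<forall>i. bounded (U i) \<and> diameter (U i) \<le> 1)}"
      then show "emeasure lborel S / ?C \<le> (\<Sum>i. if U i = {} then 0 else ennreal (diameter (U i) ^ ?d))"
        using C by (intro divide_le_posI_ennreal cover) (auto simp: zero_less_iff_neq_zero)
    qed
    then have "emeasure lborel S / ?C * ?C \<le> hausdorff_pre ?d 1 (f ` S) * ?C"
      by (rule mult_right_mono) simp
    moreover have "emeasure lborel S / ?C * ?C = emeasure lborel S"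
      unfolding ennreal_divide_times ennreal_divide_self[OF C(1) C(2)[unfolded less_top]] by simp
    ultimately show ?thesis by (simp only: mult.commute)
  qed
  also have "\<dots> \<le> ?C * hausdorff_measure ?d (f ` S)"
    unfolding hausdorff_measure_def by (intro mult_left_mono SUP_upper) auto
  finally show ?thesis .
qed

section \<open>Limsup sets of quasi-independent events\<close>

text \<open>
  With \<open>N\<close> the number of events that occur and \<open>U\<close> their union, the quadratic polynomial
  \<open>t \<mapsto> \<integral>(t * 1\<^sub>U - N)\<^sup>2\<close> is nonnegative, and at \<open>t = \<integral>N / \<mu>(U)\<close> this is the claim: the Cauchy-Schwarz
  inequality for \<open>N = 1\<^sub>U * N\<close>.
\<close>

lemma chung_erdos:
  assumes "finite I" and A: "\<And>i. i \<in> I \<Longrightarrow> A i \<in> fmeasurable M"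
  shows "(\<Sum>i\<in>I. measure M (A i))\<^sup>2
    \<le> measure M (\<Union>i\<in>I. A i) * (\<Sum>i\<in>I. \<Sum>j\<in>I. measure M (A i \<inter> A j))"
proof -
  define U where "U = (\<Union>i\<in>I. A i)"
  define S where "S = (\<Sum>i\<in>I. measure M (A i))"
  define Q where "Q = (\<Sum>i\<in>I. \<Sum>j\<in>I. measure M (A i \<inter> A j))"
  have UM: "U \<in> fmeasurable M"
    unfolding U_def using assms by (intro fmeasurable.finite_UN) auto
  have AM: "A i \<inter> A j \<in> fmeasurable M" if "i \<in> I" "j \<in> I" for i j
    using A that by (intro fmeasurable.Int) auto
  have quad: "0 \<le> t\<^sup>2 * measure M U - 2 * t * S + Q" for t
  proof -
    define f where "f = (\<lambda>x. \<Sum>i\<in>I. indicat_real (A i) x)"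
    have sq: "(t * indicat_real U x - f x)\<^sup>2
        = t\<^sup>2 * indicat_real U x - 2 * t * f x + (\<Sum>i\<in>I. \<Sum>j\<in>I. indicat_real (A i \<inter> A j) x)" for x
    proof -
      have "(f x)\<^sup>2 = (\<Sum>i\<in>I. \<Sum>j\<in>I. indicat_real (A i \<inter> A j) x)"
        unfolding f_def power2_eq_square sum_product by (simp add: indicator_inter_arith)
      moreover have "indicat_real U x * f x = f x"
        unfolding f_def sum_distrib_left by (intro sum.cong) (auto simp: U_def indicator_def)
      moreover have "(indicat_real U x)\<^sup>2 = indicat_real U x"
        by (simp add: indicator_def)
      moreover have "(t * indicat_real U x - f x)\<^sup>2
          = t\<^sup>2 * (indicat_real U x)\<^sup>2 - 2 * t * (indicat_real U x * f x) + (f x)\<^sup>2"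
        by (simp add: power2_eq_square algebra_simps)
      ultimately show ?thesis by (simp only:)
    qed
    have "0 \<le> (\<integral>x. t\<^sup>2 * indicat_real U x - 2 * t * f x
        + (\<Sum>i\<in>I. \<Sum>j\<in>I. indicat_real (A i \<inter> A j) x) \<partial>M)"
      unfolding sq[symmetric] by (rule Bochner_Integration.integral_nonneg) simp
    also have "\<dots> = t\<^sup>2 * measure M U - 2 * t * S + Q"
    proof -
      have int: "integrable M (indicat_real X)" if "X \<in> fmeasurable M" for X
        using that by (simp add: fmeasurable_def less_top)
      have m: "(\<integral>x. indicat_real X x \<partial>M) = measure M X" if "X \<in> fmeasurable M" for X
        using that sets.sets_into_space[of X M] by (simp add: fmeasurable_def Int_absorb2)
      have fint: "integrable M f" unfolding f_def by (intro Bochner_Integration.integrable_sum int A)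
      have "(\<integral>x. f x \<partial>M) = S"
        unfolding f_def S_def using A by (subst Bochner_Integration.integral_sum) (auto intro!: int sum.cong m)
      moreover
      have inner: "(\<integral>x. (\<Sum>j\<in>I. indicat_real (A i \<inter> A j) x) \<partial>M)
          = (\<Sum>j\<in>I. measure M (A i \<inter> A j))" if "i \<in> I" for i
        using AM[OF that] by (subst Bochner_Integration.integral_sum) (auto intro!: int sum.cong m)
      have "(\<integral>x. (\<Sum>i\<in>I. \<Sum>j\<in>I. indicat_real (A i \<inter> A j) x) \<partial>M) = Q"
        unfolding Q_def using AM
        by (subst Bochner_Integration.integral_sum)
          (auto intro!: Bochner_Integration.integrable_sum int sum.cong inner)
      moreover have "integrable M (\<lambda>x. \<Sum>i\<in>I. \<Sum>j\<in>I. indicat_real (A i \<inter> A j) x)"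
        by (intro Bochner_Integration.integrable_sum int AM)
      ultimately show ?thesis using fint int[OF UM] m[OF UM] by simp
    qed
    finally show ?thesis .
  qed
  show ?thesis
  proof (cases "measure M U = 0")
    case True
    have "measure M (A i) \<le> measure M U" if "i \<in> I" for i
      using A UM that by (intro measure_mono_fmeasurable) (auto simp: U_def)
    then have "measure M (A i) = 0" if "i \<in> I" for i
      using True that by (metis measure_nonneg order_antisym)
    then show ?thesis using True by (simp add: U_def)
  next
    case False
    then have pos: "measure M U > 0" by (simp add: zero_less_measure_iff)
    have "0 \<le> (S / measure M U)\<^sup>2 * measure M U - 2 * (S / measure M U) * S + Q"
      by (rule quad)
    also have "\<dots> = Q - S\<^sup>2 / measure M U"
      using pos by (simp add: field_simps power2_eq_square)
    finally have "S\<^sup>2 / measure M U \<le> Q" by simp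
    then show ?thesis using pos by (simp add: S_def Q_def U_def field_simps)
  qed
qed

lemma measure_limsup_ge:
  assumes A: "\<And>t::nat. A t \<in> sets M" and B: "B \<in> fmeasurable M"
    and sub: "\<And>t. T0 \<le> t \<Longrightarrow> A t \<subseteq> B"
    and tail: "\<And>T. T0 \<le> T \<Longrightarrow> v \<le> measure M (\<Union>t\<in>{T..}. A t)"
  shows "v \<le> measure M (\<Inter>T. \<Union>t\<in>{T..}. A t)"
proof -
  define D where "D = (\<lambda>T. \<Union>t\<in>{T0+T..}. A t)"
  have DM: "D T \<in> sets M" for T unfolding D_def using A by blast
  have DB: "D T \<subseteq> B" for T unfolding D_def by (rule UN_least, rule sub) simp
  have DF: "emeasure M (D T) \<noteq> \<infinity>" for T
    using fmeasurableI2[OF B DB DM, of T] by (auto simp: fmeasurable_def)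
  moreover have "decseq D" unfolding D_def decseq_def by fastforce
  ultimately have "(\<lambda>T. measure M (D T)) \<longlonglongrightarrow> measure M (\<Inter>T. D T)"
    using DM by (intro Lim_measure_decseq) auto
  then have "v \<le> measure M (\<Inter>T. D T)"
    by (rule LIMSEQ_le_const) (use tail in \<open>auto simp: D_def\<close>)
  also have "(\<Inter>T. D T) = (\<Inter>T. \<Union>t\<in>{T..}. A t)"
  proof -
    have "(\<Union>t\<in>{T..}. A t) \<supseteq> D T" for T unfolding D_def by fastforce
    then show ?thesis unfolding D_def by fastforce
  qed
  finally show ?thesis .
qed

text \<open>
  Here \<open>a t\<close> is the proportion of a ground set of volume \<open>V\<close> that the event \<open>A t\<close> takes up.  The extra
  overlap \<open>(1/2) ^ (t - s) * a t\<close> is harmless: summed over all pairs it contributes a multiple of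
  \<open>S = \<Sum> a t\<close>, which is absorbed by \<open>S\<^sup>2\<close> as soon as \<open>S \<ge> 1\<close>.  Divergence makes such \<open>S\<close> available
  arbitrarily far out.
\<close>

lemma measure_limsup_ge_of_quasi_independent:
  fixes A :: "nat \<Rightarrow> 'a set" and a :: "nat \<Rightarrow> real"
  assumes A: "\<And>t. A t \<in> sets M" and B: "B \<in> fmeasurable M"
    and sub: "\<And>t. T0 \<le> t \<Longrightarrow> A t \<subseteq> B"
    and pos: "0 < c" "0 < K" "0 < V" "\<And>t. 0 \<le> a t" and div: "\<not> summable a"
    and lower: "\<And>t. T0 \<le> t \<Longrightarrow> c * V * a t \<le> measure M (A t)"
    and upper: "\<And>s t. T0 \<le> s \<Longrightarrow> s \<le> t \<Longrightarrow>
      measure M (A s \<inter> A t) \<le> K * V * (a s * a t + (1/2) ^ (t - s) * a t)"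
  shows "c\<^sup>2 * V / (5 * K) \<le> measure M (\<Inter>T. \<Union>t\<in>{T..}. A t)"
proof (rule measure_limsup_ge[OF A B sub])
  fix T assume T: "T0 \<le> T"
  \<comment> \<open>Otherwise the tails, and so the series, would be bounded.\<close>
  have "\<exists>N\<ge>T. 1 \<le> (\<Sum>t=T..<N. a t)"
  proof (rule ccontr)
    assume "\<not> ?thesis"
    then have *: "(\<Sum>t=T..<N. a t) < 1" if "N \<ge> T" for N using that by force
    have "summable a"
    proof (rule summableI_nonneg_bounded[where x = "(\<Sum>t<T. a t) + 1"])
      fix n
      have "(\<Sum>t<n. a t) \<le> (\<Sum>t<max n T. a t)" using pos(4) by (intro sum_mono2) auto
      also have "\<dots> = (\<Sum>t<T. a t) + (\<Sum>t=T..<max n T. a t)"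
        using sum.atLeastLessThan_concat[of 0 T "max n T" a] by (simp add: lessThan_atLeast0)
      finally show "(\<Sum>t<n. a t) \<le> (\<Sum>t<T. a t) + 1" using *[of "max n T"] by simp
    qed (use pos in auto)
    then show False using div by blast
  qed
  then obtain N where N: "N \<ge> T" "1 \<le> (\<Sum>t=T..<N. a t)" by blast
  define I where "I = {T..<N}"
  define S where "S = (\<Sum>t\<in>I. a t)"
  have S1: "1 \<le> S" using N by (simp add: S_def I_def)
  have AF: "A t \<in> fmeasurable M" if "t \<in> I" for t
    using fmeasurableI2[OF B sub A] that T by (auto simp: I_def)
  define U where "U = (\<Union>t\<in>I. A t)"
  have geom: "(\<Sum>s=T..t. (1/2::real) ^ (t - s)) \<le> 2" for t
  proof -
    have "(\<Sum>s=T..t. (1/2::real) ^ (t - s)) \<le> (\<Sum>s\<le>t. (1/2) ^ (t - s))"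
      by (intro sum_mono2) auto
    also have "\<dots> = (\<Sum>s\<le>t. (1/2) ^ s)"
      by (rule sum.reindex_bij_witness[of _ "\<lambda>s. t - s" "\<lambda>s. t - s"]) auto
    also have "\<dots> = 2 - (1/2) ^ t" by (induction t) auto
    also have "\<dots> \<le> 2" by simp
    finally show ?thesis .
  qed
  \<comment> \<open>The extra overlap, put on the side \<open>s \<le> t\<close>, so that a pair in either
    order is bounded by \<open>h s t + h t s\<close>.\<close>
  define h where "h = (\<lambda>s t. if s \<le> t then (1/2::real) ^ (t - s) * a t else 0)"
  have hsum: "(\<Sum>t\<in>I. \<Sum>s\<in>I. h s t) \<le> 2 * S"
  proof -
    have "(\<Sum>s\<in>I. h s t) \<le> 2 * a t" if "t \<in> I" for t
    proof -
      have "(\<Sum>s\<in>I. h s t) = (\<Sum>s=T..t. (1/2) ^ (t - s) * a t)"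
        using that by (intro sum.mono_neutral_cong_right) (auto simp: I_def h_def)
      also have "\<dots> = (\<Sum>s=T..t. (1/2) ^ (t - s)) * a t" by (simp add: sum_distrib_right)
      also have "\<dots> \<le> 2 * a t" using geom pos(4) by (intro mult_right_mono) auto
      finally show ?thesis .
    qed
    then have "(\<Sum>t\<in>I. \<Sum>s\<in>I. h s t) \<le> (\<Sum>t\<in>I. 2 * a t)" by (rule sum_mono)
    then show ?thesis by (simp add: S_def sum_distrib_left)
  qed
  have pair: "measure M (A s \<inter> A t) \<le> K * V * (a s * a t + h s t + h t s)"
    if "s \<in> I" "t \<in> I" for s t
  proof -
    have h0: "0 \<le> h s t" for s t using pos(4) by (simp add: h_def)
    have *: "measure M (A s \<inter> A t) \<le> K * V * (a s * a t + h s t)"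
      if "s \<le> t" "T0 \<le> s" for s t using upper[of s t] that by (simp add: h_def)
    have T0: "T0 \<le> s" "T0 \<le> t" using that T by (auto simp: I_def)
    have KV: "0 \<le> K * V" using pos by simp
    show ?thesis
    proof (cases "s \<le> t")
      case True
      have "K * V * (a s * a t + h s t) \<le> K * V * (a s * a t + h s t + h t s)"
        using h0 by (intro mult_left_mono KV) auto
      then show ?thesis using *[of s t] True T0 by linarith
    next
      case False
      have "K * V * (a t * a s + h t s) \<le> K * V * (a s * a t + h s t + h t s)"
        using h0 by (intro mult_left_mono KV) (auto simp: mult.commute)
      then show ?thesis using *[of t s] False T0 by (simp add: Int_commute)
    qed
  qed
  define Q where "Q = (\<Sum>s\<in>I. \<Sum>t\<in>I. measure M (A s \<inter> A t))"
  have "Q \<le> (\<Sum>s\<in>I. \<Sum>t\<in>I. K * V * (a s * a t + h s t + h t s))"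
    unfolding Q_def by (intro sum_mono pair)
  also have "\<dots> = K * V * (S * S + (\<Sum>s\<in>I. \<Sum>t\<in>I. h s t) + (\<Sum>s\<in>I. \<Sum>t\<in>I. h t s))"
    by (simp add: S_def sum_product sum.distrib flip: sum_distrib_left)
  also have "(\<Sum>s\<in>I. \<Sum>t\<in>I. h s t) = (\<Sum>t\<in>I. \<Sum>s\<in>I. h s t)" by (rule sum.swap)
  also have "K * V * (S * S + (\<Sum>t\<in>I. \<Sum>s\<in>I. h s t) + (\<Sum>s\<in>I. \<Sum>t\<in>I. h t s)) \<le> K * V * (5 * S\<^sup>2)"
  proof (intro mult_left_mono)
    have "S \<le> S\<^sup>2" using S1 by (simp add: power2_eq_square)
    then show "S * S + (\<Sum>t\<in>I. \<Sum>s\<in>I. h s t) + (\<Sum>s\<in>I. \<Sum>t\<in>I. h t s) \<le> 5 * S\<^sup>2"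
      using hsum by (simp add: power2_eq_square)
  qed (use pos in auto)
  finally have Q: "Q \<le> 5 * K * V * S\<^sup>2" by simp
  have "c * V * S \<le> (\<Sum>t\<in>I. measure M (A t))"
    unfolding S_def sum_distrib_left using T by (intro sum_mono lower) (auto simp: I_def)
  then have "(c * V * S)\<^sup>2 \<le> (\<Sum>t\<in>I. measure M (A t))\<^sup>2"
    using pos S1 by (intro power_mono) auto
  also have "\<dots> \<le> measure M U * Q"
    unfolding U_def Q_def by (rule chung_erdos) (auto simp: I_def AF[unfolded I_def])
  also have "\<dots> \<le> measure M U * (5 * K * V * S\<^sup>2)"
    by (rule mult_left_mono[OF Q]) simp
  finally have "c\<^sup>2 * V * (V * S\<^sup>2) \<le> measure M U * (5 * K) * (V * S\<^sup>2)"
    by (simp add: power2_eq_square algebra_simps)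
  then have "c\<^sup>2 * V \<le> measure M U * (5 * K)"
    using pos S1 by (subst (asm) mult_le_cancel_right) auto
  then have "c\<^sup>2 * V / (5 * K) \<le> measure M U" using pos by (simp add: field_simps)
  also have "\<dots> \<le> measure M (\<Union>t\<in>{T..}. A t)"
  proof (rule measure_mono_fmeasurable)
    show "U \<subseteq> (\<Union>t\<in>{T..}. A t)" by (auto simp: U_def I_def)
    show "U \<in> sets M" using A by (auto simp: U_def)
    have "(\<Union>t\<in>{T..}. A t) \<subseteq> B" by (rule UN_least, rule sub) (use T in simp)
    then show "(\<Union>t\<in>{T..}. A t) \<in> fmeasurable M" by (rule fmeasurableI2[OF B]) (use A in blast)
  qed
  finally show "c\<^sup>2 * V / (5 * K) \<le> measure M (\<Union>t\<in>{T..}. A t)" .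
qed

text \<open>
  A weak form of the Lebesgue density theorem, by a covering argument: if \<open>F\<close> is the
  part of the complement in a box, cover \<open>F\<close> efficiently by cubes.  In each cube the complement takes up at most the
  proportion \<open>1 - c\<close>, so that \<open>|F| \<le> (1 - c) * (|F| + e)\<close> for all \<open>e > 0\<close>.
\<close>

lemma negligible_Compl_of_uniform_density:
  fixes E :: "'a::euclidean_space set"
  assumes E: "E \<in> sets borel" and c: "0 < c"
    and dens: "\<And>z s. 0 < s \<Longrightarrow> c * s ^ DIM('a) \<le> measure lborel (E \<inter> cbox z (z + s *\<^sub>R One))"
  shows "negligible (- E)"
proof -
  have c1: "c \<le> 1"
  proof -
    have "c \<le> measure lborel (E \<inter> cbox (0::'a) (0 + 1 *\<^sub>R One))" using dens[of 1 0] by simp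
    also have "\<dots> \<le> measure lborel (cbox (0::'a) (0 + 1 *\<^sub>R One))"
      using E by (intro measure_mono_fmeasurable) (auto simp: fmeasurable_def emeasure_lborel_cbox_eq)
    also have "\<dots> = 1" by (simp add: measure_def emeasure_lborel_cbox_eq)
    finally show ?thesis .
  qed
  have cube: "emeasure lborel (- E \<inter> cbox z (z + s *\<^sub>R One)) \<le> ennreal (1 - c) * ennreal (s ^ DIM('a))"
    if s: "0 \<le> s" for z s
  proof -
    let ?C = "cbox z (z + s *\<^sub>R One)"
    have fin: "emeasure lborel (E \<inter> ?C) \<noteq> top"
      using emeasure_mono[of "E \<inter> ?C" ?C lborel] s by (auto simp: emeasure_lborel_cube top_unique)
    have "c * s ^ DIM('a) \<le> measure lborel (E \<inter> ?C)"
      using dens[of s z] s by (cases "s = 0") (auto simp: zero_power[OF DIM_positive])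
    then have 1: "ennreal (c * s ^ DIM('a)) \<le> emeasure lborel (E \<inter> ?C)"
      using fin by (simp add: emeasure_eq_ennreal_measure ennreal_leI)
    have "emeasure lborel (- E \<inter> ?C) = emeasure lborel (?C - E \<inter> ?C)" by (rule arg_cong[of _ _ "emeasure lborel"]) blast
    also have "\<dots> = emeasure lborel ?C - emeasure lborel (E \<inter> ?C)"
      using E fin by (intro emeasure_Diff) auto
    also have "\<dots> \<le> ennreal (s ^ DIM('a)) - ennreal (c * s ^ DIM('a))"
      using s 1 by (simp add: emeasure_lborel_cube ennreal_minus_mono)
    also have "\<dots> = ennreal ((1 - c) * s ^ DIM('a))"
      using s c by (simp add: ennreal_minus algebra_simps)
    also have "\<dots> = ennreal (1 - c) * ennreal (s ^ DIM('a))"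
      using s c1 by (intro ennreal_mult) auto
    finally show ?thesis .
  qed
  have bounded_part: "negligible (- E \<inter> cbox p q)" for p q
  proof -
    define F where "F = - E \<inter> cbox p q"
    have F: "F \<in> sets borel" "bounded F" using E by (auto simp: F_def intro: bounded_Int)
    have "emeasure lborel F \<le> emeasure lborel (cbox p q)" by (intro emeasure_mono) (auto simp: F_def)
    then have fin: "emeasure lborel F \<noteq> top"
      using emeasure_lborel_cbox_finite[of p q] by (auto simp: top_unique)
    define x where "x = measure lborel F"
    have Fx: "emeasure lborel F = ennreal x" using fin by (simp add: x_def emeasure_eq_ennreal_measure)
    have x0: "0 \<le> x" by (simp add: x_def)
    have "x \<le> (1 - c) * (x + e)" if e: "0 < e" for e
    proof -
      obtain U where U: "open U" "F \<subseteq> U" "emeasure lborel (U - F) < ennreal e"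
        by (rule outer_regular_lborel[OF F(1) e])
      have "emeasure lborel U = emeasure lborel (F \<union> (U - F))" using U(2) by (simp add: Un_absorb1)
      also have "\<dots> \<le> emeasure lborel F + emeasure lborel (U - F)"
        using U F by (intro emeasure_subadditive) auto
      also have "\<dots> \<le> ennreal (x + e)" using U(3) Fx x0 e by (simp add: ennreal_plus add_left_mono)
      finally have Ux: "emeasure lborel U \<le> ennreal (x + e)" .
      obtain s and z :: "nat \<Rightarrow> 'a" where sz: "\<And>i. 0 \<le> s i" "\<And>i. s i \<le> 1"
        "F \<subseteq> (\<Union>i. cbox (z i) (z i + s i *\<^sub>R One))"
        "(\<Sum>i. ennreal (s i ^ DIM('a))) \<le> emeasure lborel U"
        by (rule cube_cover[OF F(2) U(1,2) zero_less_one]) (rule that)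
      have "emeasure lborel F \<le> emeasure lborel (\<Union>i. - E \<inter> cbox (z i) (z i + s i *\<^sub>R One))"
        using sz(3) E by (intro emeasure_mono) (auto simp: F_def)
      also have "\<dots> \<le> (\<Sum>i. emeasure lborel (- E \<inter> cbox (z i) (z i + s i *\<^sub>R One)))"
        using E by (intro emeasure_subadditive_countably) auto
      also have "\<dots> \<le> (\<Sum>i. ennreal (1 - c) * ennreal (s i ^ DIM('a)))"
        using sz(1) by (intro suminf_le summableI cube)
      also have "\<dots> = ennreal (1 - c) * (\<Sum>i. ennreal (s i ^ DIM('a)))"
        by (rule ennreal_suminf_cmult)
      also have "\<dots> \<le> ennreal (1 - c) * ennreal (x + e)"
        using sz(4) Ux by (intro mult_left_mono) auto
      also have "\<dots> = ennreal ((1 - c) * (x + e))" using x0 e c1 by (simp add: ennreal_mult)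
      finally show ?thesis using x0 e c1 by (simp add: Fx)
    qed
    note approx = this
    have "x \<le> (1 - c) * x + e" if e: "0 < e" for e
    proof -
      have "x \<le> (1 - c) * (x + e)" by (rule approx[OF e])
      also have "\<dots> = (1 - c) * x + (1 - c) * e" by (simp add: algebra_simps)
      also have "(1 - c) * e \<le> 1 * e" using c e by (intro mult_right_mono) auto
      finally show ?thesis by simp
    qed
    then have "x \<le> (1 - c) * x" by (rule field_le_epsilon)
    then have "x = 0" using x0 c by (simp add: algebra_simps mult_le_0_iff)
    then have "F \<in> null_sets lborel" using F(1) Fx by (intro null_setsI) auto
    then have "F \<in> null_sets lebesgue" by (rule null_sets_completionI)
    then show ?thesis unfolding F_def negligible_iff_null_sets .
  qed
  show ?thesis
  proof (rule iffD2[OF negligible_on_intervals], intro allI)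
    show "negligible (- E \<inter> cbox p q)" for p q by (rule bounded_part)
  qed
qed

section \<open>Rational points in cubes\<close>

text \<open>
  Closed balls of the supremum norm, which is the norm of simultaneous approximation and turns balls into
  cubes.
\<close>

definition sup_cball :: "real ^ 'k \<Rightarrow> real \<Rightarrow> (real ^ 'k) set" where
  "sup_cball x r = {y. \<forall>i. \<bar>y $ i - x $ i\<bar> \<le> r}"

lemma One_component: "(One :: real ^ 'k) $ i = 1"
  by (simp add: cart_eq_inner_axis axis_in_Basis_iff)

lemma sup_cball_eq_cbox: "sup_cball x r = cbox (\<chi> i. x $ i - r) (\<chi> i. x $ i + r)"
  by (auto simp: sup_cball_def mem_box_cart abs_le_iff algebra_simps)

lemma sup_cball_center: "0 \<le> r \<Longrightarrow> x \<in> sup_cball x r"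
  by (simp add: sup_cball_def)

lemma cube_eq_sup_cball:
  fixes z :: "real ^ 'k"
  shows "cbox z (z + s *\<^sub>R One) = sup_cball (z + (s / 2) *\<^sub>R One) (s / 2)"
proof -
  have shift: "z + t *\<^sub>R One = (\<chi> i. z $ i + t)" for t
    by (simp only: vec_eq_iff vector_add_component vector_scaleR_component One_component vec_lambda_beta) simp
  show ?thesis unfolding sup_cball_eq_cbox shift by (simp add: add.commute)
qed

lemma sup_cball_borel [measurable, simp]: "sup_cball x r \<in> sets borel"
  by (simp add: sup_cball_eq_cbox)

lemma sup_cball_fmeasurable [simp]: "sup_cball x r \<in> fmeasurable lborel"
  by (simp add: sup_cball_eq_cbox fmeasurable_def emeasure_lborel_cbox_eq)

lemma measure_sup_cball:
  assumes "0 \<le> r" shows "measure lborel (sup_cball x r :: (real ^ 'k) set) = (2 * r) ^ CARD('k)"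
proof -
  have "x \<in> cbox (\<chi> i. x $ i - r) (\<chi> i. x $ i + r)"
    using assms by (simp add: mem_box_cart)
  then have "cbox (\<chi> i. x $ i - r) (\<chi> i. x $ i + r) \<noteq> {}" by blast
  then show ?thesis by (simp add: sup_cball_eq_cbox content_cbox_cart)
qed

lemma sup_cball_meet_subset:
  assumes "y \<in> sup_cball x r" "y \<in> sup_cball x' r'" "r + r' + r' \<le> R"
  shows "sup_cball x' r' \<subseteq> sup_cball x R"
proof
  fix w assume "w \<in> sup_cball x' r'"
  then have "\<bar>w $ i - x' $ i\<bar> \<le> r' \<and> \<bar>y $ i - x' $ i\<bar> \<le> r' \<and> \<bar>y $ i - x $ i\<bar> \<le> r" for i
    using assms(1,2) by (simp add: sup_cball_def)
  note close = this
  have "\<bar>w $ i - x $ i\<bar> \<le> R" for i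
    using close[of i] assms(3) by linarith
  then show "w \<in> sup_cball x R" by (simp add: sup_cball_def)
qed

text \<open>
  Comparison of volumes.
\<close>

lemma card_disjoint_sup_cballs_le:
  fixes G :: "(real ^ 'k) set"
  assumes "finite G" and disj: "disjoint_family_on (\<lambda>x. sup_cball x \<delta>) G" and "0 < \<delta>" "0 \<le> r"
    and sub: "\<And>x. x \<in> G \<Longrightarrow> sup_cball x \<delta> \<subseteq> sup_cball y r"
  shows "real (card G) \<le> (r / \<delta>) ^ CARD('k)"
proof -
  have "card G * (2 * \<delta>) ^ CARD('k) = (\<Sum>x\<in>G. measure lborel (sup_cball x \<delta>))"
    using assms(3) by (simp add: measure_sup_cball)
  also have "\<dots> = measure lborel (\<Union>x\<in>G. sup_cball x \<delta>)"
    using assms(1) disj by (intro measure_UNION'[symmetric]) 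
      (auto simp: disjoint_family_on_def pairwise_def disjnt_def)
  also have "\<dots> \<le> measure lborel (sup_cball y r)"
    using sub assms(1) by (intro measure_mono_fmeasurable) auto
  also have "\<dots> = (2 * r) ^ CARD('k)" using assms(4) by (rule measure_sup_cball)
  finally show ?thesis using assms(3) by (simp add: power_divide power_mult_distrib field_simps)
qed

lemma finite_card_int_vectors_in_box:
  fixes a :: "'k::finite \<Rightarrow> real"
  assumes "0 \<le> w"
  shows "finite {p :: int ^ 'k. \<forall>i. a i \<le> p $ i \<and> p $ i \<le> a i + w}" (is "finite ?P")
    and "real (card {p :: int ^ 'k. \<forall>i. a i \<le> p $ i \<and> p $ i \<le> a i + w}) \<le> (w + 1) ^ CARD('k)"
proof -
  define S where "S = (\<lambda>i. {\<lceil>a i\<rceil>..\<lfloor>a i + w\<rfloor>})"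
  have P: "?P = vec_lambda ` (PiE UNIV S)"
  proof (intro set_eqI iffI)
    fix p assume "p \<in> ?P"
    then show "p \<in> vec_lambda ` (PiE UNIV S)"
      by (intro image_eqI[of _ _ "vec_nth p"]) (auto simp: S_def ceiling_le_iff le_floor_iff)
  qed (auto simp: S_def ceiling_le_iff le_floor_iff PiE_def Pi_def)
  have fin: "finite (PiE UNIV S)" by (intro finite_PiE) (auto simp: S_def)
  then show "finite ?P" unfolding P by (rule finite_imageI)
  have "card ?P \<le> card (PiE UNIV S)" unfolding P by (rule card_image_le[OF fin])
  also have "\<dots> = (\<Prod>i\<in>UNIV. card (S i))" by (simp add: card_PiE)
  finally have "real (card ?P) \<le> (\<Prod>i\<in>UNIV. real (card (S i)))"
    by (simp flip: of_nat_prod)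
  also have "\<dots> \<le> (\<Prod>i\<in>(UNIV::'k set). w + 1)"
  proof (intro prod_mono conjI)
    fix i
    have "real (card (S i)) = max 0 (real_of_int (\<lfloor>a i + w\<rfloor> - \<lceil>a i\<rceil> + 1))"
      by (simp add: S_def)
    also have "\<dots> \<le> w + 1" using assms by (auto simp: max_def) linarith
    finally show "real (card (S i)) \<le> w + 1" .
  qed simp
  finally show "real (card ?P) \<le> (w + 1) ^ CARD('k)" by simp
qed

text \<open>
  Used for the relation that two balls meet: a maximal family of disjoint balls, as in the
  covering lemma of Vitali.
\<close>

lemma maximal_independent_subset:
  assumes "finite R" and refl: "\<And>x. rel x x" and sym: "\<And>x y. rel x y \<Longrightarrow> rel y x"
  shows "\<exists>G\<subseteq>R. (\<forall>x\<in>G. \<forall>y\<in>G. x \<noteq> y \<longrightarrow> \<not> rel x y) \<and> (\<forall>x\<in>R. \<exists>y\<in>G. rel x y)"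
  using assms(1)
proof induction
  case empty
  then show ?case by blast
next
  case (insert x R)
  then obtain G where G: "G \<subseteq> R" "\<forall>x\<in>G. \<forall>y\<in>G. x \<noteq> y \<longrightarrow> \<not> rel x y" "\<forall>x\<in>R. \<exists>y\<in>G. rel x y"
    by blast
  show ?case
  proof (cases "\<exists>y\<in>G. rel x y")
    case True
    then show ?thesis using G by (intro exI[of _ G]) auto
  next
    case False
    then have "\<not> rel y x" if "y \<in> G" for y using sym that by blast
    then show ?thesis using G False refl by (intro exI[of _ "insert x G"]) auto
  qed
qed

definition ratvec :: "nat \<Rightarrow> int ^ 'k \<Rightarrow> real ^ 'k" where
  "ratvec q p = (\<chi> i. of_int (p $ i) / of_nat q)"

text \<open>
  Dirichlet's theorem on simultaneous approximation, as a covering of the whole space by balls around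
  rational points.
\<close>

lemma dirichlet_vec:
  fixes x :: "real ^ 'k"
  assumes "0 < N"
  obtains q p where "0 < q" "q \<le> N ^ CARD('k)" "x \<in> sup_cball (ratvec q p) (1 / (real q * real N))"
proof -
  obtain e :: "nat \<Rightarrow> 'k" where e: "bij_betw e {..<CARD('k)} UNIV"
    using ex_bij_betw_nat_finite[of "UNIV :: 'k set"] by (auto simp: lessThan_atLeast0)
  obtain q p where qp: "0 < q" "q \<le> int (N ^ CARD('k))"
    "\<And>i. i < CARD('k) \<Longrightarrow> \<bar>of_int q * x $ e i - of_int (p i)\<bar> < 1 / N"
    using Dirichlet_approx_simult[OF assms, where n = "CARD('k)" and \<theta> = "\<lambda>i. x $ e i"] by metis
  define f where "f = inv_into {..<CARD('k)} e"
  have f: "f j < CARD('k)" "e (f j) = j" for j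
    using bij_betw_inv_into_right[OF e, of j] bij_betwE[OF bij_betw_inv_into[OF e]]
    by (auto simp: f_def)
  define n where "n = nat q"
  have n: "0 < n" "real n = of_int q" "n \<le> N ^ CARD('k)"
    using qp by (auto simp: n_def nat_le_iff)
  have "\<bar>x $ j - of_int (p (f j)) / n\<bar> \<le> 1 / (real n * real N)" for j
  proof -
    have "\<bar>n * x $ j - of_int (p (f j))\<bar> < 1 / N" using qp(3)[OF f(1)[of j]] by (simp add: f n)
    then have "\<bar>n * x $ j - of_int (p (f j))\<bar> / n \<le> 1 / N / n" by (intro divide_right_mono) auto
    also have "\<bar>n * x $ j - of_int (p (f j))\<bar> / n = \<bar>x $ j - of_int (p (f j)) / n\<bar>"
      using n(1) by (simp add: abs_if field_simps)
    finally show ?thesis by (simp add: mult.commute)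
  qed
  then show thesis
    using n by (intro that[of n "\<chi> j. p (f j)"]) (auto simp: sup_cball_def ratvec_def)
qed

text \<open>
  The numerators \<open>p\<close> have to lie in a cube of side \<open>2 * q * (r + \<epsilon>)\<close>.
\<close>

lemma near_rationals:
  fixes z :: "real ^ 'k"
  assumes "0 < q" "0 \<le> r" "0 \<le> \<epsilon>"
  defines "P \<equiv> {p. sup_cball (ratvec q p) \<epsilon> \<inter> sup_cball z r \<noteq> {}}"
  shows "finite P" and "real (card P) \<le> (2 * real q * (r + \<epsilon>) + 1) ^ CARD('k)"
proof -
  let ?w = "2 * real q * (r + \<epsilon>)" and ?a = "\<lambda>i. real q * (z $ i - r - \<epsilon>)"
  let ?B = "{p :: int ^ 'k. \<forall>i. ?a i \<le> p $ i \<and> p $ i \<le> ?a i + ?w}"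
  have sub: "P \<subseteq> ?B"
  proof
    fix p assume "p \<in> P"
    then obtain y where y: "\<And>i. \<bar>y $ i - of_int (p $ i) / q\<bar> \<le> \<epsilon>" "\<And>i. \<bar>y $ i - z $ i\<bar> \<le> r"
      by (auto simp: P_def sup_cball_def ratvec_def)
    have "?a i \<le> p $ i \<and> p $ i \<le> ?a i + ?w" for i
    proof -
      have "z $ i - r - \<epsilon> \<le> of_int (p $ i) / q" "of_int (p $ i) / q \<le> z $ i + r + \<epsilon>"
        using y(1)[of i] y(2)[of i] by linarith+
      then show ?thesis using assms(1) by (simp add: field_simps)
    qed
    then show "p \<in> ?B" by simp
  qed
  have w: "0 \<le> ?w" using assms by simp
  note B = finite_card_int_vectors_in_box[OF w, of ?a]
  show "finite P" using finite_subset[OF sub B(1)] .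
  have "real (card P) \<le> real (card ?B)" using card_mono[OF B(1) sub] by simp
  then show "real (card P) \<le> (?w + 1) ^ CARD('k)" using B(2) by linarith
qed


text \<open>
  The volume of the points that owe Dirichlet's approximation to a small denominator \<open>q \<le> L\<close>.
\<close>

lemma measure_near_low_denominators:
  fixes z :: "real ^ 'k"
  assumes "0 < r" "0 < N"
  shows "measure lborel (sup_cball z r \<inter> (\<Union>q\<in>{1..L}. \<Union>p. sup_cball (ratvec q p) (1 / (real q * real N))))
    \<le> (\<Sum>q=1..L. (2 * (2 * r + 3 / real q) / real N) ^ CARD('k))"
proof -
  define \<epsilon> where "\<epsilon> = (\<lambda>q. 1 / (real q * real N))"
  define P where "P = (\<lambda>q. {p. sup_cball (ratvec q p) (\<epsilon> q) \<inter> sup_cball z r \<noteq> {}})"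
  have fin: "finite (P q)" and card: "real (card (P q)) \<le> (2 * real q * (r + \<epsilon> q) + 1) ^ CARD('k)"
    if "0 < q" for q
    using near_rationals[OF that, of r "\<epsilon> q" z] assms by (simp_all add: P_def \<epsilon>_def)
  have "measure lborel (sup_cball z r \<inter> (\<Union>q\<in>{1..L}. \<Union>p. sup_cball (ratvec q p) (\<epsilon> q)))
      \<le> measure lborel (\<Union>q\<in>{1..L}. \<Union>p\<in>P q. sup_cball (ratvec q p) (\<epsilon> q))"
  proof (rule measure_mono_fmeasurable)
    show "sup_cball z r \<inter> (\<Union>q\<in>{1..L}. \<Union>p. sup_cball (ratvec q p) (\<epsilon> q)) \<in> sets lborel" by auto
    show "(\<Union>q\<in>{1..L}. \<Union>p\<in>P q. sup_cball (ratvec q p) (\<epsilon> q)) \<in> fmeasurable lborel"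
      using fin by (intro fmeasurable.finite_UN) auto
  qed (auto simp: P_def)
  also have "\<dots> \<le> (\<Sum>q=1..L. measure lborel (\<Union>p\<in>P q. sup_cball (ratvec q p) (\<epsilon> q)))"
    using fin by (intro measure_UNION_le) auto
  also have "\<dots> \<le> (\<Sum>q=1..L. (2 * (2 * r + 3 / real q) / real N) ^ CARD('k))"
  proof (rule sum_mono)
    fix q assume "q \<in> {1..L}"
    then have q: "1 \<le> real q" "0 < q" by auto
    have N: "1 \<le> real N" using assms(2) by simp
    have \<epsilon>0: "0 \<le> \<epsilon> q" by (simp add: \<epsilon>_def)
    have "measure lborel (\<Union>p\<in>P q. sup_cball (ratvec q p) (\<epsilon> q))
        \<le> (\<Sum>p\<in>P q. measure lborel (sup_cball (ratvec q p) (\<epsilon> q)))"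
      using fin[OF q(2)] by (intro measure_UNION_le) auto
    also have "\<dots> = real (card (P q)) * (2 * \<epsilon> q) ^ CARD('k)"
      by (simp add: measure_sup_cball \<epsilon>0)
    also have "\<dots> \<le> (2 * real q * (r + \<epsilon> q) + 1) ^ CARD('k) * (2 * \<epsilon> q) ^ CARD('k)"
      using card[OF q(2)] \<epsilon>0 by (intro mult_right_mono) auto
    also have "\<dots> = ((2 * real q * (r + \<epsilon> q) + 1) * (2 * \<epsilon> q)) ^ CARD('k)"
      by (simp only: power_mult_distrib)
    also have "\<dots> \<le> (2 * (2 * r + 3 / real q) / real N) ^ CARD('k)"
    proof (rule power_mono)
      have "2 * real q * \<epsilon> q \<le> 2" using q N by (simp add: \<epsilon>_def field_simps)
      then have "2 * real q * (r + \<epsilon> q) + 1 \<le> 2 * real q * r + 3" by (simp add: distrib_left)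
      then have "(2 * real q * (r + \<epsilon> q) + 1) * (2 * \<epsilon> q) \<le> (2 * real q * r + 3) * (2 * \<epsilon> q)"
        using \<epsilon>0 by (intro mult_right_mono) auto
      also have "\<dots> = 2 * (2 * r + 3 / real q) / real N" using q N by (simp add: \<epsilon>_def field_simps)
      finally show "(2 * real q * (r + \<epsilon> q) + 1) * (2 * \<epsilon> q) \<le> 2 * (2 * r + 3 / real q) / real N" .
    qed (use \<epsilon>0 q assms in auto)
    finally show "measure lborel (\<Union>p\<in>P q. sup_cball (ratvec q p) (\<epsilon> q))
        \<le> (2 * (2 * r + 3 / real q) / real N) ^ CARD('k)" .
  qed
  finally show ?thesis unfolding \<epsilon>_def .
qed

text \<open>
  For \<open>N = 32 ^ Suc t\<close> and \<open>L = 32 ^ (k * t)\<close> the denominators up to \<open>L\<close> are a fraction \<open>32 ^ - k\<close> of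
  those up to \<open>N ^ k\<close>, and they serve at most half of the cube of radius \<open>r\<close>.
  From \<open>q \<ge> 3 / (2 * r)\<close> on, a summand is at most \<open>(8 * r / N) ^ k\<close>, and \<open>32\<close> is large enough for the sum of
  these to stay below \<open>(2 * r) ^ k / 4\<close>.  The finitely many earlier summands tend to \<open>0\<close> as \<open>t\<close> grows.
\<close>

lemma low_denominator_sum_le:
  fixes r :: real
  assumes r: "0 < r" and k: "0 < k"
  shows "eventually (\<lambda>t. (\<Sum>q=1..32 ^ (k * t). (2 * (2 * r + 3 / real q) / 32 ^ Suc t) ^ k) \<le> (2 * r) ^ k / 2) sequentially"
proof -
  \<comment> \<open>From this index on the term \<open>3 / q\<close> is at most \<open>2 * r\<close>.\<close>
  obtain q0 :: nat where q0: "3 / (2 * r) < real q0" using reals_Archimedean2 by blast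
  define C where "C = real q0 * (2 * (2 * r + 3)) ^ k"
  have C0: "0 \<le> C" using r by (simp add: C_def)
  have "(\<lambda>t. C * (1/32) ^ t) \<longlonglongrightarrow> C * 0"
    by (intro tendsto_mult tendsto_const LIMSEQ_realpow_zero) auto
  then have "eventually (\<lambda>t. C * (1/32) ^ t < (2 * r) ^ k / 4) sequentially"
    by (rule order_tendstoD) (use r in auto)
  then show ?thesis
  proof eventually_elim
    case (elim t)
    have summand: "(2 * (2 * r + 3 / real q) / 32 ^ Suc t) ^ k
        \<le> (8 * r / 32 ^ Suc t) ^ k + (if q < q0 then (2 * (2 * r + 3) / 32 ^ Suc t) ^ k else 0)"
      if "1 \<le> q" for q
    proof (cases "q < q0")
      case True
      have "3 / real q \<le> 3" using that by (simp add: field_simps)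
      then have "(2 * (2 * r + 3 / real q) / 32 ^ Suc t) ^ k \<le> (2 * (2 * r + 3) / 32 ^ Suc t) ^ k"
        using r by (intro power_mono divide_right_mono) auto
      moreover have "0 \<le> (8 * r / 32 ^ Suc t) ^ k" using r by simp
      ultimately show ?thesis using True by simp
    next
      case False
      then have "3 / (2 * r) < real q" using q0 by linarith
      then have "3 / real q \<le> 2 * r" using r that by (simp add: field_simps)
      then have "(2 * (2 * r + 3 / real q) / 32 ^ Suc t) ^ k \<le> (8 * r / 32 ^ Suc t) ^ k"
        using r by (intro power_mono divide_right_mono) auto
      then show ?thesis using False by simp
    qed
    have "(\<Sum>q=1..32 ^ (k * t). (2 * (2 * r + 3 / real q) / 32 ^ Suc t) ^ k)
        \<le> (\<Sum>q=1..32 ^ (k * t). (8 * r / 32 ^ Suc t) ^ k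
              + (if q < q0 then (2 * (2 * r + 3) / 32 ^ Suc t) ^ k else 0))"
      by (intro sum_mono summand) auto
    also have "\<dots> = 32 ^ (k * t) * (8 * r / 32 ^ Suc t) ^ k
        + (\<Sum>q\<in>{1..32 ^ (k * t)} \<inter> {q. q < q0}. (2 * (2 * r + 3) / 32 ^ Suc t) ^ k)"
      by (simp add: sum.distrib sum.If_cases)
    also have "32 ^ (k * t) * (8 * r / 32 ^ Suc t) ^ k = (2 * r) ^ k * (1/8) ^ k"
    proof -
      have "32 ^ (k * t) * (8 * r / 32 ^ Suc t) ^ k = (32 ^ t * (8 * r / 32 ^ Suc t)) ^ k"
        by (simp only: mult.commute[of k t] power_mult power_mult_distrib)
      also have "32 ^ t * (8 * r / 32 ^ Suc t) = 2 * r * (1/8)" by simp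
      finally show ?thesis by (simp only: power_mult_distrib)
    qed
    also have "(2 * r) ^ k * (1/8) ^ k \<le> (2 * r) ^ k * (1/4)"
    proof (rule mult_left_mono)
      have "(1/8 :: real) ^ k \<le> (1/8) ^ 1" using k by (intro power_decreasing) auto
      then show "(1/8 :: real) ^ k \<le> 1/4" by simp
    qed (use r in auto)
    also have "(\<Sum>q\<in>{1..32 ^ (k * t)} \<inter> {q. q < q0}. (2 * (2 * r + 3) / 32 ^ Suc t) ^ k)
        \<le> (\<Sum>q<q0. (2 * (2 * r + 3) / 32 ^ Suc t) ^ k)"
      using r by (intro sum_mono2) auto
    also have "\<dots> = C * (1 / 32 ^ Suc t) ^ k" by (simp add: C_def power_divide)
    also have "\<dots> \<le> C * (1/32) ^ t"
    proof (rule mult_left_mono[OF _ C0])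
      have "(1 / 32 ^ Suc t :: real) ^ k \<le> (1 / 32 ^ Suc t) ^ 1" 
        using k one_le_power[of "32::real" "Suc t"]
        by (intro power_decreasing) (auto simp: divide_le_eq simp del: power_Suc)
      also have "\<dots> \<le> (1/32) ^ t" by (simp add: power_divide field_simps)
      finally show "(1 / 32 ^ Suc t :: real) ^ k \<le> (1/32) ^ t" .
    qed
    finally show ?case using elim by simp
  qed
qed


text \<open>
  At least half of the cube lies within \<open>\<delta>\<close> of a rational point with denominator in the block
  \<open>(32 ^ (k * t), 32 ^ (k * Suc t)]\<close>, since Dirichlet's theorem serves it with a denominator that is not low.
  Among these rational points take a maximal set whose \<open>\<delta>\<close>-balls are disjoint.  The
  \<open>3 * \<delta>\<close>-balls around it still cover half of the cube, which forces it to be large.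
\<close>

lemma ex_separated_rationals:
  fixes z :: "real ^ 'k"
  assumes r: "0 < r" and \<delta>: "\<delta> = 1 / (32 ^ Suc t * 32 ^ (CARD('k) * t))"
    and low: "(\<Sum>q=1..32 ^ (CARD('k) * t). (2 * (2 * r + 3 / real q) / 32 ^ Suc t) ^ CARD('k))
      \<le> (2 * r) ^ CARD('k) / 2"
  shows "\<exists>G. finite G \<and> disjoint_family_on (\<lambda>x. sup_cball x \<delta>) G \<and>
    (\<forall>x\<in>G. \<exists>q p. 32 ^ (CARD('k) * t) < q \<and> q \<le> 32 ^ (CARD('k) * Suc t) \<and> x = ratvec q p) \<and>
    (\<forall>x\<in>G. sup_cball x \<delta> \<inter> sup_cball z r \<noteq> {}) \<and>
    (2 * r) ^ CARD('k) / 2 \<le> real (card G) * (6 * \<delta>) ^ CARD('k)"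
proof -
  define L Q N :: nat where "L = 32 ^ (CARD('k) * t)" and "Q = 32 ^ (CARD('k) * Suc t)" and "N = 32 ^ Suc t"
  have \<delta>LN: "\<delta> = 1 / (real L * real N)" by (simp add: \<delta> L_def N_def mult.commute)
  have NQ: "N ^ CARD('k) = Q" unfolding N_def Q_def by (simp only: mult.commute[of "CARD('k)"] power_mult)
  have N0: "0 < N" and L0: "0 < L" by (simp_all add: N_def L_def)
  have \<delta>0: "0 < \<delta>" using N0 L0 by (simp add: \<delta>LN)
  define P where "P = (\<lambda>q. {p. sup_cball (ratvec q p) \<delta> \<inter> sup_cball z r \<noteq> {}})"
  define R where "R = (\<Union>q\<in>{L<..Q}. ratvec q ` P q)"
  have finR: "finite R"
    unfolding R_def P_def using r \<delta>0 L0 by (intro finite_UN_I finite_imageI near_rationals(1)) auto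
  define meet where "meet = (\<lambda>x y :: real ^ 'k. sup_cball x \<delta> \<inter> sup_cball y \<delta> \<noteq> {})"
  have "meet x x" for x using \<delta>0 sup_cball_center[of \<delta> x] by (auto simp: meet_def)
  moreover have "meet y x" if "meet x y" for x y using that by (auto simp: meet_def)
  ultimately obtain G where G: "G \<subseteq> R" "\<forall>x\<in>G. \<forall>y\<in>G. x \<noteq> y \<longrightarrow> \<not> meet x y" "\<forall>x\<in>R. \<exists>y\<in>G. meet x y"
    using maximal_independent_subset[OF finR, of meet] by blast
  have finG: "finite G" using G(1) finR finite_subset by blast
  define bad where "bad = sup_cball z r \<inter> (\<Union>q\<in>{1..L}. \<Union>p. sup_cball (ratvec q p) (1 / (real q * real N)))"
  have cover: "sup_cball z r \<subseteq> bad \<union> (\<Union>g\<in>G. sup_cball g (3 * \<delta>))"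
  proof
    fix y assume y: "y \<in> sup_cball z r"
    obtain q p where qp: "0 < q" "q \<le> N ^ CARD('k)" "y \<in> sup_cball (ratvec q p) (1 / (real q * real N))"
      by (rule dirichlet_vec[OF N0])
    show "y \<in> bad \<union> (\<Union>g\<in>G. sup_cball g (3 * \<delta>))"
    proof (cases "q \<le> L")
      case True
      then show ?thesis using qp y by (auto simp: bad_def)
    next
      case False
      then have "1 / (real q * real N) \<le> \<delta>"
        unfolding \<delta>LN using N0 L0 by (intro divide_left_mono mult_right_mono) auto
      then have y\<delta>: "y \<in> sup_cball (ratvec q p) \<delta>"
        using qp(3) unfolding sup_cball_def by (blast intro: order_trans)
      then have "p \<in> P q" using y by (auto simp: P_def)
      moreover have "q \<in> {L<..Q}" using False qp(2) by (simp add: NQ)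
      ultimately have "ratvec q p \<in> R" unfolding R_def by blast
      then obtain g where g: "g \<in> G" "meet (ratvec q p) g" using G(3) by blast
      then obtain w where "w \<in> sup_cball g \<delta>" "w \<in> sup_cball (ratvec q p) \<delta>" by (auto simp: meet_def)
      then have "sup_cball (ratvec q p) \<delta> \<subseteq> sup_cball g (3 * \<delta>)"
        by (rule sup_cball_meet_subset) simp
      then show ?thesis using y\<delta> g(1) by blast
    qed
  qed
  have "(2 * r) ^ CARD('k) = measure lborel (sup_cball z r)" using r by (simp add: measure_sup_cball)
  also have "\<dots> \<le> measure lborel (bad \<union> (\<Union>g\<in>G. sup_cball g (3 * \<delta>)))"
  proof (rule measure_mono_fmeasurable[OF cover])
    have "bad \<in> fmeasurable lborel"
      by (rule fmeasurableI2[OF sup_cball_fmeasurable[of z r]]) (auto simp: bad_def)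
    then show "bad \<union> (\<Union>g\<in>G. sup_cball g (3 * \<delta>)) \<in> fmeasurable lborel"
      using finG by (intro fmeasurable.Un fmeasurable.finite_UN) auto
  qed simp
  also have "\<dots> \<le> measure lborel bad + measure lborel (\<Union>g\<in>G. sup_cball g (3 * \<delta>))"
  proof (rule measure_Un_le)
    show "bad \<in> sets lborel" by (auto simp: bad_def)
    show "(\<Union>g\<in>G. sup_cball g (3 * \<delta>)) \<in> sets lborel" using finG by auto
  qed
  also have "measure lborel bad \<le> (2 * r) ^ CARD('k) / 2"
    using measure_near_low_denominators[OF r N0, of z L] low
    by (simp add: bad_def N_def L_def)
  also have "measure lborel (\<Union>g\<in>G. sup_cball g (3 * \<delta>)) \<le> (\<Sum>g\<in>G. measure lborel (sup_cball g (3 * \<delta>)))"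
    using finG by (intro measure_UNION_le) auto
  also have "\<dots> = real (card G) * (6 * \<delta>) ^ CARD('k)"
    using \<delta>0 by (simp add: measure_sup_cball)
  finally have "(2 * r) ^ CARD('k) / 2 \<le> real (card G) * (6 * \<delta>) ^ CARD('k)" by simp
  moreover have "disjoint_family_on (\<lambda>x. sup_cball x \<delta>) G"
    using G(2) by (auto simp: disjoint_family_on_def meet_def)
  moreover have "\<forall>x\<in>G. \<exists>q p. L < q \<and> q \<le> Q \<and> x = ratvec q p"
    using G(1) unfolding R_def by fastforce
  moreover have "\<forall>x\<in>G. sup_cball x \<delta> \<inter> sup_cball z r \<noteq> {}"
    using G(1) unfolding R_def P_def by fastforce
  ultimately show ?thesis using finG unfolding L_def Q_def by blast
qed

section \<open>The divergence half of Khintchine's theorem\<close>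

lemma not_summable_min_one:
  fixes x :: "nat \<Rightarrow> real"
  assumes "\<And>n. 0 \<le> x n" "\<not> summable x"
  shows "\<not> summable (\<lambda>n. min 1 (x n))"
proof
  assume sm: "summable (\<lambda>n. min 1 (x n))"
  then have "eventually (\<lambda>n. min 1 (x n) < 1) sequentially"
    by (intro order_tendstoD(2)[OF summable_LIMSEQ_zero]) auto
  then have "eventually (\<lambda>n. norm (x n) \<le> min 1 (x n)) sequentially"
    by eventually_elim (use assms(1) in \<open>auto simp: min_def split: if_splits\<close>)
  then have "summable x" using sm by (rule summable_comparison_test_ev)
  then show False using assms(2) by blast
qed

text \<open>
  Cauchy condensation with base \<open>b\<close>.
\<close>

lemma not_summable_geometric_blocks:
  fixes f :: "nat \<Rightarrow> real" and b :: nat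
  assumes nonneg: "\<And>n. 0 \<le> f n" and anti: "antimono f" and b: "2 \<le> b" and div: "\<not> summable f"
  shows "\<not> summable (\<lambda>t. b ^ Suc t * f (b ^ Suc t))"
proof
  define g where "g = (\<lambda>t. b ^ Suc t * f (b ^ Suc t))"
  assume "summable (\<lambda>t. b ^ Suc t * f (b ^ Suc t))"
  then have sm: "summable g" by (simp add: g_def)
  have g0: "0 \<le> g t" for t using nonneg by (simp add: g_def)
  have blocks: "(\<Sum>n<b ^ Suc T. f n) \<le> (\<Sum>n<b. f n) + b * (\<Sum>t<T. g t)" for T
  proof (induction T)
    case (Suc T)
    let ?Q = "b ^ Suc T"
    have le: "?Q \<le> b * ?Q" using b by simp
    have "(\<Sum>n<b ^ Suc (Suc T). f n) = (\<Sum>n<?Q. f n) + (\<Sum>n=?Q..<b * ?Q. f n)"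
      using sum.atLeastLessThan_concat[of 0 ?Q "b * ?Q" f] le by (simp add: lessThan_atLeast0)
    also have "(\<Sum>n=?Q..<b * ?Q. f n) \<le> (\<Sum>n=?Q..<b * ?Q. f ?Q)"
      using anti by (intro sum_mono) (auto dest: antimonoD)
    also have "\<dots> = real (b * ?Q - ?Q) * f ?Q" by simp
    also have "\<dots> \<le> real (b * ?Q) * f ?Q" using nonneg by (intro mult_right_mono) auto
    also have "\<dots> = b * g T" by (simp add: g_def)
    finally show ?case using Suc.IH by (simp add: distrib_left)
  qed simp
  have "summable f"
  proof (rule summableI_nonneg_bounded[where x = "(\<Sum>n<b. f n) + b * suminf g"])
    fix n
    have "n < 2 ^ n" by simp
    also have "\<dots> \<le> b ^ n" using b by (intro power_mono) auto
    also have "\<dots> \<le> b ^ Suc n" using b by (intro power_increasing) auto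
    finally have "(\<Sum>i<n. f i) \<le> (\<Sum>i<b ^ Suc n. f i)"
      using nonneg by (intro sum_mono2) auto
    also have "\<dots> \<le> (\<Sum>n<b. f n) + b * (\<Sum>t<n. g t)" by (rule blocks)
    also have "\<dots> \<le> (\<Sum>n<b. f n) + b * suminf g"
      using sm g0 by (intro add_left_mono mult_left_mono sum_le_suminf) auto
    finally show "(\<Sum>i<n. f i) \<le> (\<Sum>n<b. f n) + b * suminf g" .
  qed (use nonneg in auto)
  then show False using div by blast
qed

lemma add_power_le:
  fixes x y :: real
  assumes "0 \<le> x" "0 \<le> y"
  shows "(x + y) ^ k \<le> 2 ^ k * (x ^ k + y ^ k)"
proof -
  have "(x + y) ^ k \<le> (2 * max x y) ^ k" using assms by (intro power_mono) auto
  also have "\<dots> = 2 ^ k * max x y ^ k" by (rule power_mult_distrib)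
  also have "\<dots> \<le> 2 ^ k * (x ^ k + y ^ k)"
    using assms by (intro mult_left_mono) (auto simp: max_def)
  finally show ?thesis .
qed

text \<open>
  Shrinking the disjoint balls around the points of \<open>G\<close> from radius \<open>\<delta>\<close> to \<open>\<rho>\<close> gives a set of
  proportion about \<open>(\<rho> / \<delta>) ^ d\<close>.  Any ball of radius \<open>s\<close> meets at most
  \<open>(2 + s / \<delta>) ^ d\<close> of the small balls, because their \<open>\<delta>\<close>-balls are disjoint and fit into a ball
  of radius \<open>s + 2 * \<delta>\<close>.
\<close>

lemma measure_separated_balls:
  fixes G :: "(real ^ 'k) set" and z :: "real ^ 'k"
  defines "d \<equiv> CARD('k)"
  assumes finG: "finite G" and disj: "disjoint_family_on (\<lambda>x. sup_cball x \<delta>) G"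
    and near: "\<forall>x\<in>G. sup_cball x \<delta> \<inter> sup_cball z r \<noteq> {}"
    and many: "(2 * r) ^ d / 2 \<le> real (card G) * (6 * \<delta>) ^ d"
    and \<rho>: "0 \<le> \<rho>" "\<rho> \<le> \<delta>" and \<delta>: "0 < \<delta>" "2 * \<delta> \<le> r"
  defines "A \<equiv> \<Union>x\<in>G. sup_cball x \<rho>"
  shows "real (card G) \<le> (2 * r / \<delta>) ^ d"
    and "A \<subseteq> sup_cball z (2 * r)"
    and "A \<in> sets lborel"
    and "(1/2) * (1/3) ^ d * (2 * r) ^ d * (\<rho> / \<delta>) ^ d \<le> measure lborel A"
    and "measure lborel A \<le> 2 ^ d * (2 * r) ^ d * (\<rho> / \<delta>) ^ d"
    and "\<And>x s. 0 \<le> s \<Longrightarrow> measure lborel (sup_cball x s \<inter> A) \<le> (2 + s / \<delta>) ^ d * (2 * \<rho>) ^ d"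
proof -
  have in_ball: "sup_cball x \<delta> \<subseteq> sup_cball z (2 * r)" if "x \<in> G" for x
  proof -
    obtain w where "w \<in> sup_cball z r" "w \<in> sup_cball x \<delta>" using near \<open>x \<in> G\<close> by blast
    then show ?thesis by (rule sup_cball_meet_subset) (use \<delta> in simp)
  qed
  have \<rho>\<delta>: "sup_cball x \<rho> \<subseteq> sup_cball x \<delta>" for x :: "real ^ 'k"
    using \<rho> unfolding sup_cball_def by (blast intro: order_trans)
  have r0: "0 < r" using \<delta> by simp
  show card: "real (card G) \<le> (2 * r / \<delta>) ^ d"
    unfolding d_def using in_ball \<delta> r0 by (intro card_disjoint_sup_cballs_le[OF finG disj]) auto
  show "A \<subseteq> sup_cball z (2 * r)" using in_ball \<rho>\<delta> unfolding A_def by blast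
  show "A \<in> sets lborel" using finG unfolding A_def by auto
  have mA: "measure lborel A = real (card G) * (2 * \<rho>) ^ d"
  proof -
    have "measure lborel A = (\<Sum>x\<in>G. measure lborel (sup_cball x \<rho>))"
      unfolding A_def
    proof (rule measure_UNION'[OF finG])
      show "pairwise (\<lambda>x y. disjnt (sup_cball x \<rho>) (sup_cball y \<rho>)) G"
        using disj \<rho>\<delta> unfolding disjoint_family_on_def pairwise_def disjnt_def by blast
    qed simp
    then show ?thesis using \<rho> by (simp add: measure_sup_cball d_def)
  qed
  show "(1/2) * (1/3) ^ d * (2 * r) ^ d * (\<rho> / \<delta>) ^ d \<le> measure lborel A"
  proof -
    have "2 * \<rho> / (6 * \<delta>) = (1/3) * (\<rho> / \<delta>)" by simp
    then have "(2 * \<rho>) ^ d / (6 * \<delta>) ^ d = (1/3) ^ d * (\<rho> / \<delta>) ^ d"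
      by (simp only: power_divide[symmetric] power_mult_distrib[symmetric])
    then have "(1/2) * (1/3) ^ d * (2 * r) ^ d * (\<rho> / \<delta>) ^ d
        = ((2 * r) ^ d / 2) * ((2 * \<rho>) ^ d / (6 * \<delta>) ^ d)"
      by simp
    also have "\<dots> \<le> (real (card G) * (6 * \<delta>) ^ d) * ((2 * \<rho>) ^ d / (6 * \<delta>) ^ d)"
      using \<rho> \<delta> by (intro mult_right_mono many) auto
    also have "\<dots> = measure lborel A" using \<delta> by (simp add: mA)
    finally show ?thesis .
  qed
  have "(2 * r / \<delta>) ^ d * (2 * \<rho>) ^ d = 2 ^ d * (2 * r) ^ d * (\<rho> / \<delta>) ^ d"
    by (simp add: power_divide power_mult_distrib)
  then show "measure lborel A \<le> 2 ^ d * (2 * r) ^ d * (\<rho> / \<delta>) ^ d"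
    using mult_right_mono[OF card, of "(2 * \<rho>) ^ d"] \<rho> by (simp add: mA)
  show "measure lborel (sup_cball x s \<inter> A) \<le> (2 + s / \<delta>) ^ d * (2 * \<rho>) ^ d" if s: "0 \<le> s" for x s
  proof -
    define H where "H = {y \<in> G. sup_cball x s \<inter> sup_cball y \<rho> \<noteq> {}}"
    have H: "finite H" "H \<subseteq> G" using finG by (auto simp: H_def)
    have "real (card H) \<le> ((s + 2 * \<delta>) / \<delta>) ^ CARD('k)"
    proof (rule card_disjoint_sup_cballs_le[OF H(1) _ \<delta>(1)])
      show "disjoint_family_on (\<lambda>x. sup_cball x \<delta>) H"
        using disj H(2) by (rule disjoint_family_on_mono[rotated])
      show "sup_cball y \<delta> \<subseteq> sup_cball x (s + 2 * \<delta>)" if "y \<in> H" for y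
      proof -
        obtain w where "w \<in> sup_cball x s" "w \<in> sup_cball y \<delta>"
          using \<open>y \<in> H\<close> \<rho>\<delta> unfolding H_def by blast
        then show ?thesis by (rule sup_cball_meet_subset) simp
      qed
    qed (use s \<delta> in auto)
    then have cardH: "real (card H) \<le> (2 + s / \<delta>) ^ d" using \<delta> by (simp add: add_divide_distrib d_def add.commute)
    have "measure lborel (sup_cball x s \<inter> A) \<le> measure lborel (\<Union>y\<in>H. sup_cball y \<rho>)"
    proof (rule measure_mono_fmeasurable)
      show "sup_cball x s \<inter> A \<subseteq> (\<Union>y\<in>H. sup_cball y \<rho>)" by (auto simp: A_def H_def)
      show "sup_cball x s \<inter> A \<in> sets lborel" using finG unfolding A_def by auto
      show "(\<Union>y\<in>H. sup_cball y \<rho>) \<in> fmeasurable lborel" using H(1) by (intro fmeasurable.finite_UN) auto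
    qed
    also have "\<dots> \<le> (\<Sum>y\<in>H. measure lborel (sup_cball y \<rho>))"
      using H(1) by (intro measure_UNION_le) auto
    also have "\<dots> = real (card H) * (2 * \<rho>) ^ d" using \<rho> by (simp add: measure_sup_cball d_def)
    also have "\<dots> \<le> (2 + s / \<delta>) ^ d * (2 * \<rho>) ^ d" using cardH \<rho> by (intro mult_right_mono) auto
    finally show ?thesis .
  qed
qed


lemma min_one_power:
  fixes x :: real
  assumes "0 \<le> x" shows "min x 1 ^ k = min (x ^ k) 1"
proof (cases "x \<le> 1")
  case True
  then show ?thesis using assms by (simp add: min_absorb1 power_le_one)
next
  case False
  then show ?thesis by (simp add: min_absorb2)
qed

text \<open>
  The left side bounds the overlap of two blocks \<open>s < t\<close>: the number of balls in block \<open>s\<close>,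
  times the number of balls of block \<open>t\<close> that one of them can meet, times their volume.  In
  \<open>(2 + \<rho>s / \<delta>t) ^ k\<close> the second term accounts for independence, and the first for the few balls
  that are met however small \<open>\<rho>s\<close> is; its cost is governed by \<open>\<delta>t / \<delta>s\<close>, which decays
  geometrically in \<open>t - s\<close>.
\<close>

lemma overlap_bound:
  fixes r e :: real
  assumes pos: "0 < \<delta>s" "0 < \<delta>t" "0 \<le> \<rho>s" "0 \<le> \<rho>t" "0 \<le> r"
    and e: "\<delta>t \<le> e * \<delta>s" "e \<le> 1" and k: "0 < k"
  shows "(2 * r / \<delta>s) ^ k * ((2 + \<rho>s / \<delta>t) ^ k * (2 * \<rho>t) ^ k)
    \<le> 8 ^ k * (2 * r) ^ k * ((\<rho>s / \<delta>s) ^ k * (\<rho>t / \<delta>t) ^ k + e * (\<rho>t / \<delta>t) ^ k)"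
proof -
  define V b where "V = (2 * r) ^ k" and "b = (\<rho>t / \<delta>t) ^ k"
  have nonneg: "0 \<le> V" "0 \<le> b" using pos by (simp_all add: V_def b_def)
  have "(2 + \<rho>s / \<delta>t) ^ k \<le> 2 ^ k * (2 ^ k + (\<rho>s / \<delta>t) ^ k)"
    using pos by (intro add_power_le) auto
  then have "(2 * r / \<delta>s) ^ k * ((2 + \<rho>s / \<delta>t) ^ k * (2 * \<rho>t) ^ k)
      \<le> (2 * r / \<delta>s) ^ k * ((2 ^ k * (2 ^ k + (\<rho>s / \<delta>t) ^ k)) * (2 * \<rho>t) ^ k)"
    using pos by (intro mult_left_mono mult_right_mono) auto
  also have "\<dots> = (2 * 2 * 2) ^ k * V * (\<rho>t / \<delta>s) ^ k + (2 * 2) ^ k * V * ((\<rho>t / \<delta>s) ^ k * (\<rho>s / \<delta>t) ^ k)"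
    unfolding V_def power_divide power_mult_distrib by (simp add: algebra_simps)
  also have "(\<rho>t / \<delta>s) ^ k * (\<rho>s / \<delta>t) ^ k = (\<rho>s / \<delta>s) ^ k * b"
    unfolding b_def power_mult_distrib[symmetric] by (simp add: mult.commute)
  also have "(\<rho>t / \<delta>s) ^ k = (\<delta>t / \<delta>s) ^ k * b"
    unfolding b_def power_mult_distrib[symmetric] using pos by simp
  also have "(2 * 2 * 2) ^ k * V * ((\<delta>t / \<delta>s) ^ k * b) \<le> 8 ^ k * V * (e * b)"
  proof -
    have "\<delta>t / \<delta>s \<le> e" using e(1) pos by (simp add: divide_le_eq)
    moreover have "(\<delta>t / \<delta>s) ^ k \<le> (\<delta>t / \<delta>s) ^ 1"
    proof (rule power_decreasing)
      show "\<delta>t / \<delta>s \<le> 1" using \<open>\<delta>t / \<delta>s \<le> e\<close> e(2) by linarith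
    qed (use pos k in auto)
    ultimately have "(\<delta>t / \<delta>s) ^ k \<le> e" by simp
    then show ?thesis using nonneg by (simp add: mult_left_mono mult_right_mono)
  qed
  also have "(2 * 2) ^ k * V * ((\<rho>s / \<delta>s) ^ k * b) \<le> 8 ^ k * V * ((\<rho>s / \<delta>s) ^ k * b)"
    using nonneg pos by (intro mult_right_mono power_mono) auto
  finally show ?thesis unfolding V_def b_def by (simp add: distrib_left add.commute)
qed

text \<open>
  In block \<open>t\<close> the denominators are at most \<open>Q t\<close>, so a point within \<open>h (Q t) / (2 * Q t)\<close> of a rational
  point of the block satisfies the required inequality with \<open>h (Q t) / 2 < h q\<close>.  Cutting the radius off at
  the separation \<open>\<delta> t\<close> keeps the proportions \<open>a t\<close> at most \<open>1\<close>; up to a constant \<open>a t\<close> is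
  \<open>min 1 (Q t * h (Q t) ^ k)\<close>, and these still form a divergent series by condensation.
\<close>

theorem khintchine_divergence:
  fixes h :: "nat \<Rightarrow> real"
  assumes pos: "\<And>n. 0 < h n" and anti: "antimono h" and div: "\<not> summable (\<lambda>n. h n ^ CARD('k))"
  shows "negligible {v :: real ^ 'k. finite {q :: nat. \<exists>p :: int ^ 'k. \<forall>i. \<bar>real q * v $ i - p $ i\<bar> < h q}}"
proof -
  define k where "k = CARD('k)"
  have k: "0 < k" by (simp add: k_def)
  define Q :: "nat \<Rightarrow> nat" where "Q = (\<lambda>t. 32 ^ (k * Suc t))"
  define \<delta> :: "nat \<Rightarrow> real" where "\<delta> = (\<lambda>t. 1 / (32 ^ Suc t * 32 ^ (k * t)))"
  define \<rho> where "\<rho> = (\<lambda>t. min (h (Q t) / (2 * Q t)) (\<delta> t))"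
  define A :: "nat \<Rightarrow> (real ^ 'k) set"
    where "A = (\<lambda>t. \<Union>q\<in>{32 ^ (k * t)<..Q t}. \<Union>p. sup_cball (ratvec q p) (\<rho> t))"
  define E where "E = (\<Inter>T. \<Union>t\<in>{T..}. A t)"
  have \<delta>0: "0 < \<delta> t" for t by (simp add: \<delta>_def)
  have \<rho>0: "0 \<le> \<rho> t" and \<rho>\<delta>: "\<rho> t \<le> \<delta> t" for t
    using pos[of "Q t"] \<delta>0[of t] by (auto simp: \<rho>_def)
  have \<delta>_Suc: "\<delta> (Suc t) \<le> (1/2) * \<delta> t" for t
  proof -
    have "2 * (32 ^ Suc t * 32 ^ (k * t)) \<le> (32 ^ Suc (Suc t) * 32 ^ (k * Suc t) :: real)"
      by (simp add: power_add mult_mono)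
    then show ?thesis by (simp add: \<delta>_def field_simps)
  qed
  have \<delta>_add: "\<delta> (s + n) \<le> (1/2) ^ n * \<delta> s" for s n
  proof (induction n)
    case (Suc n)
    then show ?case using \<delta>_Suc[of "s + n"] by simp
  qed simp
  define a where "a = (\<lambda>t. (\<rho> t / \<delta> t) ^ k)"
  have a0: "0 \<le> a t" for t using \<rho>0[of t] \<delta>0[of t] by (simp add: a_def)
  have adiv: "\<not> summable a"
  proof -
    define C :: real where "C = (1 / (2 * 32 ^ k)) ^ k"
    have C: "0 < C" by (simp add: C_def)
    have a_eq: "a t = min 1 (C * (real (Q t) * h (Q t) ^ k))" for t
    proof -
      have "\<rho> t / \<delta> t = min (h (Q t) / (2 * Q t) / \<delta> t) 1"
        using min_divide_distrib_right[of "\<delta> t" "h (Q t) / (2 * Q t)" "\<delta> t"] \<delta>0[of t]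
        by (simp add: \<rho>_def min.commute)
      also have "h (Q t) / (2 * Q t) / \<delta> t = 1 / (2 * 32 ^ k) * (32 ^ Suc t * h (Q t))"
        by (simp add: Q_def \<delta>_def power_add)
      finally have "a t = (min (1 / (2 * 32 ^ k) * (32 ^ Suc t * h (Q t))) 1) ^ k"
        by (simp add: a_def)
      also have "\<dots> = min ((1 / (2 * 32 ^ k) * (32 ^ Suc t * h (Q t))) ^ k) (1 ^ k)"
        unfolding power_one using pos[of "Q t"] by (intro min_one_power) (simp add: less_imp_le)
      also have "(1 / (2 * 32 ^ k) * (32 ^ Suc t * h (Q t))) ^ k = C * (real (Q t) * h (Q t) ^ k)"
      proof -
        have "(32 ^ Suc t :: real) ^ k = real (Q t)"
          unfolding Q_def by (simp only: mult.commute[of k] power_mult of_nat_power of_nat_numeral)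
        then show ?thesis unfolding C_def power_mult_distrib by simp
      qed
      finally show ?thesis by (simp add: min.commute)
    qed
    have "\<not> summable (\<lambda>t. real (Q t) * h (Q t) ^ k)"
    proof -
      have "\<not> summable (\<lambda>t. real ((32 ^ k) ^ Suc t) * (\<lambda>n. h n ^ k) ((32 ^ k) ^ Suc t))"
      proof (rule not_summable_geometric_blocks)
        show "antimono (\<lambda>n. h n ^ k)"
          using pos by (intro antimonoI power_mono antimonoD[OF anti]) (auto intro: less_imp_le)
        show "(2::nat) \<le> 32 ^ k" using self_le_power[of "32::nat" k] k by linarith
      qed (use pos div in \<open>auto simp: k_def less_imp_le\<close>)
      then show ?thesis unfolding Q_def power_mult .
    qed
    then have "\<not> summable (\<lambda>t. C * (real (Q t) * h (Q t) ^ k))"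
      using C by (simp add: summable_cmult_iff)
    then show ?thesis
      unfolding a_eq[abs_def] using C pos by (intro not_summable_min_one) (auto simp: less_imp_le)
  qed
  have AM: "A t \<in> sets borel" for t unfolding A_def by (auto intro!: sets.countable_UN')
  have EM: "E \<in> sets borel" unfolding E_def using AM by (auto intro!: sets.countable_INT' sets.countable_UN')
  define c :: real where "c = (1/2) * (1/3) ^ k"
  have dens: "c\<^sup>2 / (5 * 8 ^ k) * (1/2) ^ k * s ^ DIM(real ^ 'k) \<le> measure lborel (E \<inter> cbox z (z + s *\<^sub>R One))"
    if s: "0 < s" for z s
  proof -
    \<comment> \<open>The balls have to stay inside the given cube, so the rational points are chosen near the
      concentric cube of half its size.\<close>
    define r z' where "r = s / 4" and "z' = z + (s / 2) *\<^sub>R One"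
    have r: "0 < r" using s by (simp add: r_def)
    have ball: "cbox z (z + s *\<^sub>R One) = sup_cball z' (2 * r)"
      unfolding cube_eq_sup_cball r_def z'_def by simp
    have "\<delta> \<longlonglongrightarrow> 0"
    proof (rule tendsto_sandwich[of "\<lambda>_. 0" \<delta> _ "\<lambda>t. (1/2) ^ t * \<delta> 0"])
      have "(\<lambda>t. (1/2) ^ t * \<delta> 0) \<longlonglongrightarrow> 0 * \<delta> 0"
        by (intro tendsto_mult tendsto_const LIMSEQ_realpow_zero) auto
      then show "(\<lambda>t. (1/2) ^ t * \<delta> 0) \<longlonglongrightarrow> 0" by simp
      show "\<forall>\<^sub>F t in sequentially. 0 \<le> \<delta> t" using \<delta>0 by (simp add: less_imp_le)
      show "\<forall>\<^sub>F t in sequentially. \<delta> t \<le> (1/2) ^ t * \<delta> 0" using \<delta>_add[of 0] by simp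
    qed simp
    then have "eventually (\<lambda>t. \<delta> t < r / 2) sequentially"
      using r by (intro order_tendstoD) auto
    then have "eventually (\<lambda>t. 2 * \<delta> t \<le> r \<and>
        (\<Sum>q=1..32 ^ (k * t). (2 * (2 * r + 3 / real q) / 32 ^ Suc t) ^ k) \<le> (2 * r) ^ k / 2) sequentially"
      using low_denominator_sum_le[OF r k] by eventually_elim simp
    then obtain T0 where T0: "\<And>t. T0 \<le> t \<Longrightarrow> 2 * \<delta> t \<le> r"
      "\<And>t. T0 \<le> t \<Longrightarrow> (\<Sum>q=1..32 ^ (k * t). (2 * (2 * r + 3 / real q) / 32 ^ Suc t) ^ k) \<le> (2 * r) ^ k / 2"
      unfolding eventually_sequentially by blast
    have "\<exists>G. finite G \<and> disjoint_family_on (\<lambda>x. sup_cball x (\<delta> t)) G \<and>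
      (\<forall>x\<in>G. \<exists>q p. 32 ^ (k * t) < q \<and> q \<le> Q t \<and> x = ratvec q p) \<and>
      (\<forall>x\<in>G. sup_cball x (\<delta> t) \<inter> sup_cball z' r \<noteq> {}) \<and>
      (2 * r) ^ k / 2 \<le> real (card G) * (6 * \<delta> t) ^ k" if "T0 \<le> t" for t
      unfolding k_def Q_def
      by (rule ex_separated_rationals[OF r])
        (use T0(2)[OF that] in \<open>simp_all add: \<delta>_def k_def\<close>)
    then have "\<forall>t\<in>{T0..}. \<exists>G. finite G \<and> disjoint_family_on (\<lambda>x. sup_cball x (\<delta> t)) G \<and>
      (\<forall>x\<in>G. \<exists>q p. 32 ^ (k * t) < q \<and> q \<le> Q t \<and> x = ratvec q p) \<and>
      (\<forall>x\<in>G. sup_cball x (\<delta> t) \<inter> sup_cball z' r \<noteq> {}) \<and>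
      (2 * r) ^ k / 2 \<le> real (card G) * (6 * \<delta> t) ^ k" by simp
    then obtain G where G: "\<forall>t\<in>{T0..}. finite (G t) \<and> disjoint_family_on (\<lambda>x. sup_cball x (\<delta> t)) (G t) \<and>
      (\<forall>x\<in>G t. \<exists>q p. 32 ^ (k * t) < q \<and> q \<le> Q t \<and> x = ratvec q p) \<and>
      (\<forall>x\<in>G t. sup_cball x (\<delta> t) \<inter> sup_cball z' r \<noteq> {}) \<and>
      (2 * r) ^ k / 2 \<le> real (card (G t)) * (6 * \<delta> t) ^ k"
      unfolding bchoice_iff by blast
    \<comment> \<open>Separated rational points exist from \<open>T0\<close> on; the earlier events do not
      affect the limsup.\<close>
    define B where "B = (\<lambda>t. if T0 \<le> t then \<Union>x\<in>G t. sup_cball x (\<rho> t) else {})"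
    have facts: "real (card (G t)) \<le> (2 * r / \<delta> t) ^ k" "B t \<subseteq> sup_cball z' (2 * r)" "B t \<in> sets lborel"
      "(1/2) * (1/3) ^ k * (2 * r) ^ k * (\<rho> t / \<delta> t) ^ k \<le> measure lborel (B t)"
      "measure lborel (B t) \<le> 2 ^ k * (2 * r) ^ k * (\<rho> t / \<delta> t) ^ k"
      "\<And>x s. 0 \<le> s \<Longrightarrow> measure lborel (sup_cball x s \<inter> B t) \<le> (2 + s / \<delta> t) ^ k * (2 * \<rho> t) ^ k"
      if t: "T0 \<le> t" for t
    proof -
      have Gt: "finite (G t)" "disjoint_family_on (\<lambda>x. sup_cball x (\<delta> t)) (G t)"
        "\<forall>x\<in>G t. sup_cball x (\<delta> t) \<inter> sup_cball z' r \<noteq> {}"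
        "(2 * r) ^ CARD('k) / 2 \<le> real (card (G t)) * (6 * \<delta> t) ^ CARD('k)"
        using G t unfolding k_def by blast+
      have Bt: "B t = (\<Union>x\<in>G t. sup_cball x (\<rho> t))" using t by (simp add: B_def)
      note sep = measure_separated_balls[OF Gt \<rho>0 \<rho>\<delta> \<delta>0 T0(1)[OF t], folded k_def Bt]
      show "real (card (G t)) \<le> (2 * r / \<delta> t) ^ k" "B t \<subseteq> sup_cball z' (2 * r)" "B t \<in> sets lborel"
        "(1/2) * (1/3) ^ k * (2 * r) ^ k * (\<rho> t / \<delta> t) ^ k \<le> measure lborel (B t)"
        "measure lborel (B t) \<le> 2 ^ k * (2 * r) ^ k * (\<rho> t / \<delta> t) ^ k"
        "\<And>x s. 0 \<le> s \<Longrightarrow> measure lborel (sup_cball x s \<inter> B t) \<le> (2 + s / \<delta> t) ^ k * (2 * \<rho> t) ^ k"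
        by (fact sep)+
    qed
    have "c\<^sup>2 * (2 * r) ^ k / (5 * 8 ^ k) \<le> measure lborel (\<Inter>T. \<Union>t\<in>{T..}. B t)"
    proof (rule measure_limsup_ge_of_quasi_independent[where a = a and ?T0.0 = T0])
      show "B t \<in> sets lborel" for t
        using facts(3)[of t] by (cases "T0 \<le> t") (auto simp: B_def)
      show "sup_cball z' (2 * r) \<in> fmeasurable lborel" by simp
      show "B t \<subseteq> sup_cball z' (2 * r)" if "T0 \<le> t" for t using facts(2) that .
      show "c * (2 * r) ^ k * a t \<le> measure lborel (B t)" if "T0 \<le> t" for t
        using facts(4)[OF that] by (simp add: c_def a_def)
      show "measure lborel (B s \<inter> B t) \<le> 8 ^ k * (2 * r) ^ k * (a s * a t + (1/2) ^ (t - s) * a t)"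
        if st: "T0 \<le> s" "s \<le> t" for s t
      proof (cases "s = t")
        case True
        have "measure lborel (B s \<inter> B t) \<le> 2 ^ k * (2 * r) ^ k * a t"
          using facts(5)[of t] st True by (simp add: a_def)
        also have "\<dots> \<le> 8 ^ k * (2 * r) ^ k * (a s * a t + a t)"
          using a0 r by (intro mult_mono power_mono) auto
        finally show ?thesis using True by simp
      next
        case False
        have Gs: "finite (G s)" using G st(1) by blast
        have T0t: "T0 \<le> t" using st by simp
        have "B s \<inter> B t = (\<Union>x\<in>G s. sup_cball x (\<rho> s) \<inter> B t)" using st(1) by (auto simp: B_def)
        then have "measure lborel (B s \<inter> B t) \<le> (\<Sum>x\<in>G s. measure lborel (sup_cball x (\<rho> s) \<inter> B t))"
          by (simp only:) (use Gs facts(3)[OF T0t] in \<open>intro measure_UNION_le; auto\<close>)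
        also have "\<dots> \<le> (\<Sum>x\<in>G s. (2 + \<rho> s / \<delta> t) ^ k * (2 * \<rho> t) ^ k)"
          by (intro sum_mono facts(6)[OF T0t] \<rho>0)
        also have "\<dots> = real (card (G s)) * ((2 + \<rho> s / \<delta> t) ^ k * (2 * \<rho> t) ^ k)" by simp
        also have "\<dots> \<le> (2 * r / \<delta> s) ^ k * ((2 + \<rho> s / \<delta> t) ^ k * (2 * \<rho> t) ^ k)"
          using facts(1)[OF st(1)] \<rho>0 \<delta>0 by (intro mult_right_mono) (auto simp: less_imp_le)
        also have "\<dots> \<le> 8 ^ k * (2 * r) ^ k * ((\<rho> s / \<delta> s) ^ k * (\<rho> t / \<delta> t) ^ k + (1/2) ^ (t - s) * (\<rho> t / \<delta> t) ^ k)"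
          using \<delta>_add[of s "t - s"] st r k
          by (intro overlap_bound \<delta>0 \<rho>0) (auto intro: power_le_one)
        finally show ?thesis by (simp add: a_def)
      qed
    qed (use a0 adiv r in \<open>auto simp: c_def\<close>)
    also have "\<dots> \<le> measure lborel (E \<inter> sup_cball z' (2 * r))"
    proof (rule measure_mono_fmeasurable)
      have BA: "B t \<subseteq> A t" for t
      proof (cases "T0 \<le> t")
        case True
        then show ?thesis using G unfolding B_def A_def by fastforce
      qed (simp add: B_def)
      have Bz: "B t \<subseteq> sup_cball z' (2 * r)" for t
        using facts(2)[of t] by (cases "T0 \<le> t") (auto simp: B_def)
      have "(\<Inter>T. \<Union>t\<in>{T..}. B t) \<subseteq> E"
        unfolding E_def by (intro INT_anti_mono UN_mono order_refl BA)
      moreover have "(\<Inter>T. \<Union>t\<in>{T..}. B t) \<subseteq> (\<Union>t\<in>{0..}. B t)"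
        by (rule INT_lower) simp
      moreover have "(\<Union>t\<in>{0..}. B t) \<subseteq> sup_cball z' (2 * r)"
        by (intro UN_least Bz)
      ultimately show "(\<Inter>T. \<Union>t\<in>{T..}. B t) \<subseteq> E \<inter> sup_cball z' (2 * r)"
        by blast
      have "B t \<in> sets lborel" for t
        using facts(3)[of t] by (cases "T0 \<le> t") (auto simp: B_def)
      then show "(\<Inter>T. \<Union>t\<in>{T..}. B t) \<in> sets lborel"
        by (auto intro!: sets.countable_INT' sets.countable_UN')
      show "E \<inter> sup_cball z' (2 * r) \<in> fmeasurable lborel"
        using EM by (intro fmeasurable_Int_fmeasurable[of _ _ E, unfolded Int_commute[of _ E]]) auto
    qed
    also have "c\<^sup>2 * (2 * r) ^ k / (5 * 8 ^ k) = c\<^sup>2 / (5 * 8 ^ k) * (1/2) ^ k * s ^ DIM(real ^ 'k)"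
      by (simp add: r_def k_def power_divide)
    finally show ?thesis unfolding ball .
  qed
  have "negligible (- E)"
    by (rule negligible_Compl_of_uniform_density[OF EM _ dens]) (simp add: c_def)
  moreover have "{v :: real ^ 'k. finite {q :: nat. \<exists>p :: int ^ 'k. \<forall>i. \<bar>real q * v $ i - p $ i\<bar> < h q}} \<subseteq> - E"
  proof
    fix v :: "real ^ 'k"
    let ?F = "{q :: nat. \<exists>p :: int ^ 'k. \<forall>i. \<bar>real q * v $ i - p $ i\<bar> < h q}"
    assume "v \<in> {v. finite {q :: nat. \<exists>p :: int ^ 'k. \<forall>i. \<bar>real q * v $ i - p $ i\<bar> < h q}}"
    then obtain m where m: "\<And>q. q \<in> ?F \<Longrightarrow> q \<le> m"
      using finite_nat_set_iff_bounded_le by auto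
    show "v \<in> - E"
    proof (rule ComplI)
      assume "v \<in> E"
      then have "v \<in> (\<Union>t\<in>{m..}. A t)" unfolding E_def by (rule INT_D) simp
      then obtain t where t: "m \<le> t" "v \<in> A t" by auto
      then obtain q p where q: "32 ^ (k * t) < q" "q \<le> Q t"
        and v: "v \<in> sup_cball (ratvec q p) (\<rho> t)" unfolding A_def by auto
      have "t < 2 ^ t" by simp
      also have "\<dots> \<le> (32::nat) ^ t" by (intro power_mono) auto
      also have "\<dots> \<le> 32 ^ (k * t)" using k by (intro power_increasing) auto
      finally have "m < q" using t(1) q(1) by linarith
      moreover have "q \<in> ?F"
      proof -
        have "\<bar>real q * v $ i - p $ i\<bar> < h q" for i
        proof -
          have q0: "0 < q" using q(1) by linarith
          have Q0: "0 < real (Q t)" by (simp add: Q_def)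
          have "\<bar>real q * v $ i - p $ i\<bar> = real q * \<bar>v $ i - p $ i / q\<bar>"
          proof -
            have "real q * v $ i - p $ i = real q * (v $ i - p $ i / q)"
              using q0 by (simp add: right_diff_distrib)
            then show ?thesis by (simp add: abs_mult)
          qed
          also have "\<dots> \<le> real q * \<rho> t"
            using v by (intro mult_left_mono) (auto simp: sup_cball_def ratvec_def)
          also have "\<dots> \<le> real (Q t) * (h (Q t) / (2 * Q t))"
            using q(2) \<rho>0[of t] by (intro mult_mono) (auto simp: \<rho>_def)
          also have "\<dots> = h (Q t) / 2" using Q0 by simp
          also have "\<dots> < h (Q t)" using pos[of "Q t"] by simp
          also have "\<dots> \<le> h q" using anti q(2) by (rule antimonoD)
          finally show ?thesis .
        qed
        then show ?thesis by blast
      qed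
      ultimately show False using m by fastforce
    qed
  qed
  ultimately show ?thesis by (rule negligible_subset)
qed

section \<open>The convergence half of Khintchine's theorem and two kinds of null sets\<close>

text \<open>
  For \<open>v \<in> [-1, 1]^k\<close> and denominator \<open>q\<close> there are about \<open>q ^ k\<close> numerators, each with a ball of volume about
  \<open>(h q / q) ^ k\<close>, so the measures are dominated by \<open>h q ^ k\<close>.
\<close>

theorem khintchine_convergence:
  fixes h :: "nat \<Rightarrow> real"
  assumes h: "\<And>n. 0 \<le> h n" "\<And>n. h n \<le> H" and sm: "summable (\<lambda>n. h n ^ CARD('k))"
  shows "negligible {v :: real ^ 'k. (\<forall>i. \<bar>v $ i\<bar> \<le> 1) \<and>
    infinite {q :: nat. \<exists>p :: int ^ 'k. \<forall>i. \<bar>real q * v $ i - p $ i\<bar> \<le> h q}}"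
proof -
  define A :: "nat \<Rightarrow> (real ^ 'k) set"
    where "A = (\<lambda>q. if q = 0 then {} else sup_cball 0 1 \<inter> (\<Union>p. sup_cball (ratvec q p) (h q / q)))"
  have AM: "A q \<in> sets lborel" for q unfolding A_def by auto
  have H0: "0 \<le> H" using h order_trans by blast
  have mA: "measure lborel (A q) \<le> (4 * H + 6) ^ CARD('k) * h q ^ CARD('k)" for q
  proof (cases "q = 0")
    case True
    then show ?thesis using h H0 by (simp add: A_def)
  next
    case False
    then have q: "0 < q" "1 \<le> real q" by auto
    define P where "P = {p. sup_cball (ratvec q p) (h q / q) \<inter> sup_cball (0 :: real ^ 'k) 1 \<noteq> {}}"
    have nn: "0 \<le> h q / q" using h by simp
    note P = near_rationals[OF q(1) zero_le_one nn, of "0 :: real ^ 'k", folded P_def]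
    have "measure lborel (A q) \<le> measure lborel (\<Union>p\<in>P. sup_cball (ratvec q p) (h q / q))"
    proof (rule measure_mono_fmeasurable)
      show "A q \<subseteq> (\<Union>p\<in>P. sup_cball (ratvec q p) (h q / q))" using q by (auto simp: A_def P_def)
      show "(\<Union>p\<in>P. sup_cball (ratvec q p) (h q / q)) \<in> fmeasurable lborel"
        using P(1) by (intro fmeasurable.finite_UN) auto
    qed (rule AM)
    also have "\<dots> \<le> (\<Sum>p\<in>P. measure lborel (sup_cball (ratvec q p) (h q / q)))"
      using P(1) by (intro measure_UNION_le) auto
    also have "\<dots> = real (card P) * (2 * (h q / q)) ^ CARD('k)"
      using nn by (simp add: measure_sup_cball)
    also have "\<dots> \<le> (2 * real q * (1 + h q / q) + 1) ^ CARD('k) * (2 * (h q / q)) ^ CARD('k)"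
      using P(2) nn by (intro mult_right_mono) auto
    also have "\<dots> = ((2 * real q * (1 + h q / q) + 1) * (2 * (h q / q))) ^ CARD('k)"
      by (simp only: power_mult_distrib)
    also have "\<dots> \<le> ((4 * H + 6) * h q) ^ CARD('k)"
    proof (rule power_mono)
      have "(2 * real q * (1 + h q / q) + 1) / q = 2 + (2 * h q + 1) / q"
        using q by (simp add: field_simps)
      also have "(2 * h q + 1) / q \<le> (2 * h q + 1) / 1"
        using q h by (intro divide_left_mono) auto
      finally have "(2 * real q * (1 + h q / q) + 1) / q \<le> 2 * H + 3" using h(2)[of q] by simp
      then have "(2 * real q * (1 + h q / q) + 1) / q * (2 * h q) \<le> (2 * H + 3) * (2 * h q)"
        using h by (intro mult_right_mono) auto
      moreover have "(2 * real q * (1 + h q / q) + 1) * (2 * (h q / q))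
          = (2 * real q * (1 + h q / q) + 1) / q * (2 * h q)" by simp
      moreover have "(2 * H + 3) * (2 * h q) = (4 * H + 6) * h q" by (simp add: algebra_simps)
      ultimately show "(2 * real q * (1 + h q / q) + 1) * (2 * (h q / q)) \<le> (4 * H + 6) * h q"
        by linarith
      show "0 \<le> (2 * real q * (1 + h q / q) + 1) * (2 * (h q / q))"
        using nn by (intro mult_nonneg_nonneg add_nonneg_nonneg) simp_all
    qed
    finally show ?thesis by (simp only: power_mult_distrib)
  qed
  have fin: "emeasure lborel (A q) < \<infinity>" for q
  proof -
    have "emeasure lborel (A q) \<le> emeasure lborel (sup_cball (0 :: real ^ 'k) 1)"
      by (rule emeasure_mono) (auto simp: A_def)
    also have "\<dots> < \<infinity>" using sup_cball_fmeasurable[of "0 :: real ^ 'k" 1] by (simp add: fmeasurable_def)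
    finally show ?thesis .
  qed
  have "summable (\<lambda>q. measure lborel (A q))"
    by (rule summable_comparison_test'[OF summable_mult[OF sm, of "(4 * H + 6) ^ CARD('k)"], of 0])
      (use mA in simp)
  then have "limsup A \<in> null_sets lborel" using AM fin by (intro borel_cantelli_limsup1)
  then have "negligible (limsup A)"
    unfolding negligible_iff_null_sets by (rule null_sets_completionI)
  then show ?thesis
  proof (rule negligible_subset)
    show "{v :: real ^ 'k. (\<forall>i. \<bar>v $ i\<bar> \<le> 1) \<and>
        infinite {q :: nat. \<exists>p :: int ^ 'k. \<forall>i. \<bar>real q * v $ i - p $ i\<bar> \<le> h q}} \<subseteq> limsup A"
    proof clarify
      fix v :: "real ^ 'k"
      assume v: "\<forall>i. \<bar>v $ i\<bar> \<le> 1"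
        and inf: "infinite {q :: nat. \<exists>p :: int ^ 'k. \<forall>i. \<bar>real q * v $ i - p $ i\<bar> \<le> h q}"
      have "\<exists>q\<ge>n. v \<in> A q" for n
      proof -
        obtain q where q: "n < q" "q \<in> {q :: nat. \<exists>p :: int ^ 'k. \<forall>i. \<bar>real q * v $ i - p $ i\<bar> \<le> h q}"
          using inf unfolding infinite_nat_iff_unbounded by blast
        then obtain p :: "int ^ 'k" where p: "\<And>i. \<bar>real q * v $ i - p $ i\<bar> \<le> h q" by blast
        have "\<bar>v $ i - p $ i / q\<bar> \<le> h q / q" for i
        proof -
          have "\<bar>v $ i - p $ i / q\<bar> = \<bar>real q * v $ i - p $ i\<bar> / q"
            using q(1) by (simp add: abs_if field_simps)
          also have "\<dots> \<le> h q / q" using p[of i] by (intro divide_right_mono) auto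
          finally show ?thesis .
        qed
        then have "v \<in> A q" using v q(1) by (auto simp: A_def sup_cball_def ratvec_def)
        then show ?thesis using q(1) by (meson less_imp_le)
      qed
      then show "v \<in> limsup A" by (auto simp: limsup_INF_SUP)
    qed
  qed
qed

lemma negligible_cylinder:
  fixes X :: "'a::euclidean_space set"
  assumes "negligible X"
  shows "negligible (X \<times> (UNIV :: 'b::euclidean_space set))" and "negligible ((UNIV :: 'b set) \<times> X)"
proof -
  obtain N where N: "N \<in> null_sets lborel" "X \<subseteq> N"
    using assms unfolding negligible_iff_null_sets null_sets_completion_iff2 by blast
  have "N \<times> UNIV \<in> null_sets (lborel \<Otimes>\<^sub>M (lborel :: 'b measure))"
    using N(1) by (auto simp: null_sets_def lborel.emeasure_pair_measure_Times)
  then have "N \<times> UNIV \<in> null_sets (lebesgue :: ('a \<times> 'b) measure)"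
    unfolding lborel_prod by (rule null_sets_completionI)
  then have "negligible (N \<times> (UNIV :: 'b set))" unfolding negligible_iff_null_sets .
  then show "negligible (X \<times> (UNIV :: 'b set))"
    by (rule negligible_subset) (use N(2) in auto)
  have "UNIV \<times> N \<in> null_sets ((lborel :: 'b measure) \<Otimes>\<^sub>M lborel)"
    using N(1) by (auto simp: null_sets_def lborel.emeasure_pair_measure_Times)
  then have "UNIV \<times> N \<in> null_sets (lebesgue :: ('b \<times> 'a) measure)"
    unfolding lborel_prod by (rule null_sets_completionI)
  then have "negligible ((UNIV :: 'b set) \<times> N)" unfolding negligible_iff_null_sets .
  then show "negligible ((UNIV :: 'b set) \<times> X)"
    by (rule negligible_subset) (use N(2) in auto)
qed

text \<open>
  If a nontrivial combination of the rows vanishes, then some row \<open>j\<close> is a combination of the others, with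
  \<open>k - 1 < n\<close> coefficients.  Store these coefficients in the row \<open>j\<close> itself, the coefficient of row \<open>l\<close> in
  column \<open>\<tau> l\<close>; the column \<open>\<tau> j\<close> remains \<open>0\<close>.  So the matrices in question are images of a
  hyperplane under a polynomial map of the space of matrices to itself.
\<close>

lemma negligible_dependent_rows:
  assumes "CARD('k) \<le> CARD('n)"
  shows "negligible {Y :: real ^ 'n ^ 'k. \<exists>u. u \<noteq> 0 \<and> u v* Y = 0}"
proof -
  obtain \<tau> :: "'k \<Rightarrow> 'n" where \<tau>: "inj \<tau>"
    using assms inj_on_iff_card_le[of "UNIV :: 'k set" "UNIV :: 'n set"] by auto
  define row_at :: "'k \<Rightarrow> 'k \<Rightarrow> real ^ 'n ^ 'k \<Rightarrow> real ^ 'n ^ 'k"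
    where "row_at = (\<lambda>j l Z. \<chi> i. if i = j then Z $ l else 0)"
  define other_rows :: "'k \<Rightarrow> real ^ 'n ^ 'k \<Rightarrow> real ^ 'n ^ 'k"
    where "other_rows = (\<lambda>j Z. \<chi> i. if i = j then 0 else Z $ i)"
  define F where "F = (\<lambda>j Z. other_rows j Z + (\<Sum>l\<in>UNIV. Z $ j $ \<tau> l *\<^sub>R row_at j l Z))"
  define S where "S = (\<lambda>j. {Z :: real ^ 'n ^ 'k. Z $ j $ \<tau> j = 0})"
  have S: "negligible (S j)" for j
  proof -
    have "S j = {Z. axis j (axis (\<tau> j) 1) \<bullet> Z = 0}"
      by (auto simp: S_def inner_axis inner_axis' inner_commute)
    moreover have "axis j (axis (\<tau> j) (1::real)) \<noteq> 0" by (simp add: axis_eq_0_iff)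
    ultimately show ?thesis using negligible_hyperplane by metis
  qed
  have "F j differentiable_on S j" for j
  proof -
    have lin: "linear (row_at j l)" "linear (other_rows j)" "linear (\<lambda>Z :: real ^ 'n ^ 'k. Z $ j $ \<tau> l)" for l
      by (auto simp: linear_iff row_at_def other_rows_def vec_eq_iff)
    have "(\<lambda>Z. Z $ j $ \<tau> l *\<^sub>R row_at j l Z) differentiable (at x)" for l x
      using has_derivative_scaleR[OF linear_imp_has_derivative[OF lin(3)] linear_imp_has_derivative[OF lin(1)]]
      unfolding differentiable_def by blast
    then have "(\<lambda>Z. \<Sum>l\<in>UNIV. Z $ j $ \<tau> l *\<^sub>R row_at j l Z) differentiable (at x)" for x
      by (intro differentiable_sum) auto
    then show ?thesis unfolding F_def
      by (intro differentiable_on_add linear_imp_differentiable_on lin(2)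
          differentiable_at_imp_differentiable_on)
  qed
  then have "negligible (\<Union>j. F j ` S j)"
    by (intro negligible_Union finite_imageI finite)
      (auto intro!: negligible_differentiable_image_negligible S)
  then show ?thesis
  proof (rule negligible_subset, clarify)
    fix Y :: "real ^ 'n ^ 'k" and u :: "real ^ 'k"
    assume u: "u \<noteq> 0" "u v* Y = 0"
    then obtain j where j: "u $ j \<noteq> 0" by (auto simp: vec_eq_iff)
    define Z :: "real ^ 'n ^ 'k" where
      "Z = (\<chi> i. if i = j then (\<chi> c. if c \<in> range \<tau> \<and> inv \<tau> c \<noteq> j then - u $ inv \<tau> c / u $ j else 0) else Y $ i)"
    have Zj: "Z $ j $ \<tau> l = (if l = j then 0 else - u $ l / u $ j)" for l
      using \<tau> by (simp add: Z_def)
    have Zi: "Z $ i = Y $ i" if "i \<noteq> j" for i using that by (simp add: Z_def)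
    have "F j Z = Y"
    proof (subst vec_eq_iff, intro allI)
      fix i
      show "F j Z $ i = Y $ i"
      proof (cases "i = j")
        case False
        then show ?thesis by (simp add: F_def other_rows_def row_at_def Zi)
      next
        case True
        have "F j Z $ j = (\<Sum>l\<in>UNIV. Z $ j $ \<tau> l *\<^sub>R Z $ l)"
          by (simp add: F_def other_rows_def row_at_def)
        also have "\<dots> = (\<Sum>l\<in>UNIV - {j}. (- u $ l / u $ j) *\<^sub>R Y $ l)"
          using Zi by (intro sum.mono_neutral_cong_right) (auto simp: Zj)
        also have "\<dots> = Y $ j"
        proof (subst vec_eq_iff, intro allI)
          fix c
          have "0 = (\<Sum>l\<in>UNIV. Y $ l $ c * u $ l)"
            using arg_cong[OF u(2), of "\<lambda>x. x $ c"] by (simp add: vector_matrix_mult_def mult.commute)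
          also have "\<dots> = Y $ j $ c * u $ j + (\<Sum>l\<in>UNIV - {j}. Y $ l $ c * u $ l)"
            by (rule sum.remove) auto
          finally have "Y $ j $ c * u $ j = - (\<Sum>l\<in>UNIV - {j}. Y $ l $ c * u $ l)" by simp
          then have "Y $ j $ c = - (\<Sum>l\<in>UNIV - {j}. Y $ l $ c * u $ l) / u $ j"
            using j by (simp add: field_simps)
          also have "\<dots> = (\<Sum>l\<in>UNIV - {j}. - u $ l / u $ j * Y $ l $ c)"
            by (simp add: sum_divide_distrib sum_negf mult.commute)
          finally show "(\<Sum>l\<in>UNIV - {j}. (- u $ l / u $ j) *\<^sub>R Y $ l) $ c = Y $ j $ c" by simp
        qed
        finally show ?thesis using True by simp
      qed
    qed
    moreover have "Z \<in> S j" by (simp add: S_def Zj)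
    ultimately show "Y \<in> (\<Union>j. F j ` S j)" by blast
  qed
qed

section \<open>Charts for the matrices of deficient rank\<close>

lemma hausdorff_measure_UN_le:
  assumes "finite I"
  shows "hausdorff_measure d (\<Union>i\<in>I. A i) \<le> (\<Sum>i\<in>I. hausdorff_measure d (A i))"
  using assms
proof induction
  case empty
  have "hausdorff_pre d \<delta> {} \<le> 0" if "0 < \<delta>" for \<delta>
    using hausdorff_pre_le[of "{}" "\<lambda>_. {}" \<delta> d] that by simp
  then have "hausdorff_measure d {} \<le> 0"
    unfolding hausdorff_measure_def by (intro SUP_least) simp
  then show ?case by simp
next
  case (insert i I)
  have "hausdorff_measure d (\<Union>i\<in>insert i I. A i) \<le> hausdorff_measure d (A i) + hausdorff_measure d (\<Union>i\<in>I. A i)"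
    by (simp add: hausdorff_measure_Un)
  also have "\<dots> \<le> hausdorff_measure d (A i) + (\<Sum>i\<in>I. hausdorff_measure d (A i))"
    using insert.IH by (rule add_left_mono)
  finally show ?case using insert.hyps by simp
qed

text \<open>
  The sign makes the vector with coordinate \<open>1\<close> at \<open>i\<close> and \<open>v j\<close> at \<open>\<sigma> j\<close> a left kernel vector,
  where \<open>P = (Y, v)\<close>.
\<close>

definition chart :: "'m \<Rightarrow> ('k \<Rightarrow> 'm) \<Rightarrow> (real ^ 'n ^ 'k) \<times> (real ^ 'k) \<Rightarrow> real ^ 'n ^ 'm" where
  "chart i \<sigma> P = (\<chi> r. if r = i then - (\<Sum>j\<in>UNIV. snd P $ j *\<^sub>R fst P $ j) else fst P $ inv \<sigma> r)"

definition chart_dom :: "((real ^ 'n ^ 'k) \<times> (real ^ 'k)) set" where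
  "chart_dom = {(Y, v). (\<forall>j c. \<bar>Y $ j $ c\<bar> \<le> 1/2) \<and> (\<forall>j. \<bar>v $ j\<bar> \<le> 1)}"

definition other_rows_enum :: "'m \<Rightarrow> ('k \<Rightarrow> 'm) \<Rightarrow> bool" where
  "other_rows_enum i \<sigma> \<longleftrightarrow> inj \<sigma> \<and> range \<sigma> = UNIV - {i}"

lemma ex_other_rows_enum:
  assumes "CARD('k::finite) + 1 = CARD('m::finite)"
  shows "\<exists>\<sigma> :: 'k \<Rightarrow> 'm. other_rows_enum i \<sigma>"
proof -
  have "card (UNIV - {i} :: 'm set) = CARD('k)" using assms by (simp add: card_Diff_singleton)
  then obtain \<sigma> :: "'k \<Rightarrow> 'm" where "bij_betw \<sigma> UNIV (UNIV - {i})"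
    using finite_same_card_bij[of "UNIV :: 'k set" "UNIV - {i}"] by auto
  then show ?thesis by (auto simp: other_rows_enum_def bij_betw_def)
qed

lemma sum_other_rows:
  fixes f :: "'m::finite \<Rightarrow> 'b::comm_monoid_add" and \<sigma> :: "'k::finite \<Rightarrow> 'm"
  assumes "other_rows_enum i \<sigma>"
  shows "(\<Sum>r\<in>UNIV. f r) = f i + (\<Sum>j\<in>UNIV. f (\<sigma> j))"
proof -
  have "(\<Sum>r\<in>UNIV. f r) = f i + (\<Sum>r\<in>UNIV - {i}. f r)" by (rule sum.remove) auto
  also have "(\<Sum>r\<in>UNIV - {i}. f r) = (\<Sum>j\<in>UNIV. f (\<sigma> j))"
    using assms by (metis (no_types, lifting) other_rows_enum_def sum.reindex_cong)
  finally show ?thesis .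
qed

lemma chart_row:
  assumes "other_rows_enum i \<sigma>"
  shows "chart i \<sigma> P $ i = - (\<Sum>j\<in>UNIV. snd P $ j *\<^sub>R fst P $ j)"
    and "chart i \<sigma> P $ \<sigma> j = fst P $ j"
  using assms by (auto simp: chart_def other_rows_enum_def)

text \<open>
  The identity that turns \<open>q X\<close> into the errors \<open>q (\<sigma> j) - q i * v j\<close> of simultaneous approximation.
\<close>

lemma vector_mult_chart:
  assumes "other_rows_enum i \<sigma>"
  shows "w v* chart i \<sigma> (Y, v) = (\<chi> j. w $ \<sigma> j - w $ i * v $ j) v* Y"
proof (subst vec_eq_iff, intro allI)
  fix c
  have "(w v* chart i \<sigma> (Y, v)) $ c = (\<Sum>r\<in>UNIV. chart i \<sigma> (Y, v) $ r $ c * w $ r)"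
    by (simp add: vector_matrix_mult_def mult.commute)
  also have "\<dots> = - (\<Sum>j\<in>UNIV. v $ j * Y $ j $ c) * w $ i + (\<Sum>j\<in>UNIV. Y $ j $ c * w $ \<sigma> j)"
    by (simp add: sum_other_rows[OF assms] chart_row[OF assms])
  also have "\<dots> = (\<Sum>j\<in>UNIV. Y $ j $ c * (w $ \<sigma> j - w $ i * v $ j))"
    by (simp add: sum_distrib_left sum_distrib_right right_diff_distrib sum_subtractf mult_ac)
  finally show "(w v* chart i \<sigma> (Y, v)) $ c = ((\<chi> j. w $ \<sigma> j - w $ i * v $ j) v* Y) $ c"
    by (simp add: vector_matrix_mult_def mult.commute)
qed

lemma rank_deficient_iff_left_kernel:
  fixes X :: "real ^ 'n ^ 'm"
  shows "rank X \<le> CARD('m) - 1 \<longleftrightarrow> (\<exists>w. w \<noteq> 0 \<and> w v* X = 0)"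
proof -
  have "rank X \<le> CARD('m)"
    using rank_bound[of X] by simp
  then have "rank X \<le> CARD('m) - 1 \<longleftrightarrow> rank X \<noteq> CARD('m)"
    using zero_less_card_finite[where 'a = 'm] by linarith
  also have "\<dots> \<longleftrightarrow> \<not> inj ((*v) (transpose X))"
    by (metis full_rank_injective rank_transpose)
  also have "\<dots> \<longleftrightarrow> (\<exists>w. w \<noteq> 0 \<and> w v* X = 0)"
    using linear_injective_0[OF matrix_vector_mul_linear[of "transpose X"]]
    by (metis transpose_matrix_vector)
  finally show ?thesis .
qed

text \<open>
  Divide a left kernel vector by its coordinate of largest modulus, which gets the index \<open>i\<close>.
\<close>

lemma \<Gamma>_covered_by_charts:
  fixes \<sigma> :: "'m::finite \<Rightarrow> 'k::finite \<Rightarrow> 'm"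
  assumes \<sigma>: "\<And>i. other_rows_enum i (\<sigma> i)"
  shows "(\<Gamma> :: (real ^ 'n ^ 'm) set) \<subseteq> (\<Union>i. chart i (\<sigma> i) ` chart_dom)"
proof
  fix X :: "real ^ 'n ^ 'm" assume X: "X \<in> \<Gamma>"
  then obtain w where w: "w \<noteq> 0" "w v* X = 0"
    using rank_deficient_iff_left_kernel[of X] by (auto simp: \<Gamma>_def)
  have "Max (range (\<lambda>r. \<bar>w $ r\<bar>)) \<in> range (\<lambda>r. \<bar>w $ r\<bar>)" by (intro Max_in) auto
  then obtain i where "Max (range (\<lambda>r. \<bar>w $ r\<bar>)) = \<bar>w $ i\<bar>" by blast
  then have max: "\<bar>w $ r\<bar> \<le> \<bar>w $ i\<bar>" for r
    using Max_ge[of "range (\<lambda>r. \<bar>w $ r\<bar>)" "\<bar>w $ r\<bar>"] by auto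
  have wi: "w $ i \<noteq> 0"
  proof
    assume "w $ i = 0"
    then have "w $ r = 0" for r using max[of r] by simp
    then show False using w(1) by (simp add: vec_eq_iff)
  qed
  define v :: "real ^ 'k" where "v = (\<chi> j. w $ \<sigma> i j / w $ i)"
  define Y :: "real ^ 'n ^ 'k" where "Y = (\<chi> j. X $ \<sigma> i j)"
  have "X = chart i (\<sigma> i) (Y, v)"
  proof (subst vec_eq_iff, intro allI)
    fix r
    show "X $ r = chart i (\<sigma> i) (Y, v) $ r"
    proof (cases "r = i")
      case False
      then obtain j where "r = \<sigma> i j" using \<sigma>[of i] unfolding other_rows_enum_def by blast
      then show ?thesis by (simp add: chart_row[OF \<sigma>] Y_def)
    next
      case True
      have "X $ i $ c = chart i (\<sigma> i) (Y, v) $ i $ c" for c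
      proof -
        have "0 = (\<Sum>r\<in>UNIV. X $ r $ c * w $ r)"
          using arg_cong[OF w(2), of "\<lambda>x. x $ c"] by (simp add: vector_matrix_mult_def mult.commute)
        also have "\<dots> = X $ i $ c * w $ i + (\<Sum>j\<in>UNIV. X $ \<sigma> i j $ c * w $ \<sigma> i j)"
          by (rule sum_other_rows[OF \<sigma>])
        finally have "X $ i $ c * w $ i = - (\<Sum>j\<in>UNIV. X $ \<sigma> i j $ c * w $ \<sigma> i j)" by simp
        then have "X $ i $ c = - (\<Sum>j\<in>UNIV. X $ \<sigma> i j $ c * w $ \<sigma> i j) / w $ i"
          using wi by (simp add: field_simps)
        then show ?thesis
          by (simp add: chart_row[OF \<sigma>] v_def Y_def sum_divide_distrib mult.commute)
      qed
      then show ?thesis using True by (simp add: vec_eq_iff)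
    qed
  qed
  moreover have "(Y, v) \<in> chart_dom"
  proof -
    have "\<bar>Y $ j $ c\<bar> \<le> 1/2" for j c
    proof -
      have "X $ \<sigma> i j $ c \<in> {-1/2..1/2}" using X by (simp add: \<Gamma>_def unit_cube_def)
      then show ?thesis by (auto simp: Y_def abs_if)
    qed
    moreover have "\<bar>v $ j\<bar> \<le> 1" for j
      using max[of "\<sigma> i j"] wi by (simp add: v_def)
    ultimately show ?thesis by (simp add: chart_dom_def)
  qed
  ultimately show "X \<in> (\<Union>i. chart i (\<sigma> i) ` chart_dom)" by blast
qed

lemma norm_vec_le_sum: "norm x \<le> (\<Sum>i\<in>UNIV. norm (x $ i))"
  unfolding norm_vec_def by (rule L2_set_le_sum) simp

lemma dist_chart_le:
  fixes P P' :: "(real ^ 'n ^ 'k) \<times> (real ^ 'k)" and i :: "'m::finite"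
  assumes \<sigma>: "other_rows_enum i \<sigma>" and P: "P \<in> chart_dom" "P' \<in> chart_dom"
  shows "dist (chart i \<sigma> P) (chart i \<sigma> P') \<le> (CARD('k) * (CARD('n) + 2)) * dist P P'"
proof -
  define D where "D = dist P P'"
  obtain Y v Y' v' where eq: "P = (Y, v)" "P' = (Y', v')" by fastforce
  have DY: "norm (Y $ j - Y' $ j) \<le> D" for j
    using Finite_Cartesian_Product.norm_nth_le[where x = "Y - Y'" and i = j] dist_fst_le[of P P'] by (simp add: eq D_def dist_norm)
  have Dv: "\<bar>v $ j - v' $ j\<bar> \<le> D" for j
    using component_le_norm_cart[of "v - v'" j] dist_snd_le[of P P'] by (simp add: eq D_def dist_norm)
  have nY: "norm (Y $ j) \<le> CARD('n)" for j
  proof -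
    have "norm (Y $ j) \<le> (\<Sum>c\<in>UNIV. \<bar>Y $ j $ c\<bar>)" by (rule norm_le_l1_cart)
    also have "\<dots> \<le> (\<Sum>c\<in>(UNIV::'n set). 1)"
    proof (rule sum_mono)
      fix c
      have "\<bar>Y $ j $ c\<bar> \<le> 1/2" using P(1) by (auto simp: eq chart_dom_def)
      then show "\<bar>Y $ j $ c\<bar> \<le> 1" by simp
    qed
    finally show ?thesis by simp
  qed
  have v': "\<bar>v' $ j\<bar> \<le> 1" for j using P(2) by (auto simp: eq chart_dom_def)
  have D0: "0 \<le> D" by (simp add: D_def)
  have row: "norm (v $ j *\<^sub>R Y $ j - v' $ j *\<^sub>R Y' $ j) \<le> (CARD('n) + 1) * D" for j
  proof -
    have "v $ j *\<^sub>R Y $ j - v' $ j *\<^sub>R Y' $ j = (v $ j - v' $ j) *\<^sub>R Y $ j + v' $ j *\<^sub>R (Y $ j - Y' $ j)"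
      by (simp add: algebra_simps)
    then have "norm (v $ j *\<^sub>R Y $ j - v' $ j *\<^sub>R Y' $ j)
        \<le> \<bar>v $ j - v' $ j\<bar> * norm (Y $ j) + \<bar>v' $ j\<bar> * norm (Y $ j - Y' $ j)"
      by (metis norm_scaleR norm_triangle_ineq)
    also have "\<dots> \<le> D * CARD('n) + 1 * D"
      using Dv DY nY v' D0 by (intro add_mono mult_mono) auto
    finally show ?thesis by (simp add: algebra_simps)
  qed
  have "dist (chart i \<sigma> P) (chart i \<sigma> P') \<le> (\<Sum>r\<in>UNIV. norm ((chart i \<sigma> P - chart i \<sigma> P') $ r))"
    unfolding dist_norm by (rule norm_vec_le_sum)
  also have "\<dots> = norm ((chart i \<sigma> P - chart i \<sigma> P') $ i) + (\<Sum>j\<in>UNIV. norm ((chart i \<sigma> P - chart i \<sigma> P') $ \<sigma> j))"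
    by (rule sum_other_rows[OF \<sigma>])
  also have "(\<Sum>j\<in>UNIV. norm ((chart i \<sigma> P - chart i \<sigma> P') $ \<sigma> j)) \<le> (\<Sum>j\<in>(UNIV::'k set). D)"
    using DY by (intro sum_mono) (simp add: chart_row[OF \<sigma>] eq)
  also have "norm ((chart i \<sigma> P - chart i \<sigma> P') $ i) = norm (\<Sum>j\<in>UNIV. v $ j *\<^sub>R Y $ j - v' $ j *\<^sub>R Y' $ j)"
    by (simp add: chart_row[OF \<sigma>] eq sum_subtractf norm_minus_commute)
  also have "\<dots> \<le> (\<Sum>j\<in>(UNIV::'k set). (CARD('n) + 1) * D)"
    by (rule sum_norm_le) (rule row)
  finally show ?thesis by (simp add: D_def algebra_simps)
qed

lemma bounded_chart_dom: "bounded (chart_dom :: ((real ^ 'n ^ 'k) \<times> (real ^ 'k)) set)"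
  unfolding bounded_iff
proof (intro exI ballI)
  fix P :: "(real ^ 'n ^ 'k) \<times> (real ^ 'k)" assume P: "P \<in> chart_dom"
  obtain Y v where eq: "P = (Y, v)" by fastforce
  have "norm Y \<le> (\<Sum>j\<in>(UNIV::'k set). \<Sum>c\<in>(UNIV::'n set). 1/2)"
  proof (rule order_trans[OF norm_vec_le_sum sum_mono])
    fix j
    show "norm (Y $ j) \<le> (\<Sum>c\<in>(UNIV::'n set). 1/2)"
      using P by (intro order_trans[OF norm_le_l1_cart sum_mono]) (auto simp: chart_dom_def eq)
  qed
  moreover have "norm v \<le> (\<Sum>j\<in>(UNIV::'k set). 1)"
    using P by (intro order_trans[OF norm_le_l1_cart sum_mono]) (auto simp: chart_dom_def eq)
  ultimately show "norm P \<le> (\<Sum>j\<in>(UNIV::'k set). \<Sum>c\<in>(UNIV::'n set). 1/2) + (\<Sum>j\<in>(UNIV::'k set). 1)"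
    unfolding eq by (intro order_trans[OF norm_Pair_le] add_mono)
qed

lemma DIM_chart: "DIM((real ^ 'n ^ 'k) \<times> (real ^ 'k)) = CARD('k) * (CARD('n) + 1)"
  by (simp add: algebra_simps)

lemma hausdorff_measure_chart_image_negligible:
  fixes i :: "'m::finite" and S :: "((real ^ 'n ^ 'k) \<times> (real ^ 'k)) set"
  assumes "other_rows_enum i \<sigma>" "negligible S"
  shows "hausdorff_measure (CARD('k) * (CARD('n) + 1)) (chart i \<sigma> ` (chart_dom \<inter> S)) = 0"
  unfolding DIM_chart[symmetric]
proof (rule hausdorff_measure_lipschitz_image_negligible)
  show "negligible (chart_dom \<inter> S)" using assms(2) by (rule negligible_subset) auto
  show "bounded (chart_dom \<inter> S)" using bounded_chart_dom by (rule bounded_subset) auto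
  show "dist (chart i \<sigma> P) (chart i \<sigma> P') \<le> real (CARD('k) * (CARD('n) + 2)) * dist P P'"
    if "P \<in> chart_dom \<inter> S" "P' \<in> chart_dom \<inter> S" for P P'
    using dist_chart_le[OF assms(1), of P P'] that by simp
qed simp

lemma hausdorff_measure_\<Gamma>_finite:
  assumes "CARD('k::finite) + 1 = CARD('m::finite)"
  shows "hausdorff_measure (CARD('k) * (CARD('n) + 1)) (\<Gamma> :: (real ^ 'n ^ 'm) set) < top"
proof -
  obtain \<sigma> :: "'m \<Rightarrow> 'k \<Rightarrow> 'm" where \<sigma>: "\<And>i. other_rows_enum i (\<sigma> i)"
    using ex_other_rows_enum[OF assms] by metis
  have fin: "hausdorff_measure (CARD('k) * (CARD('n) + 1))
      (chart i (\<sigma> i) ` (chart_dom :: ((real ^ 'n ^ 'k) \<times> (real ^ 'k)) set)) < top" for i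
    unfolding DIM_chart[symmetric]
  proof (rule hausdorff_measure_lipschitz_image_finite[OF bounded_chart_dom])
    show "dist (chart i (\<sigma> i) P) (chart i (\<sigma> i) P') \<le> real (CARD('k) * (CARD('n) + 2)) * dist P P'"
      if "P \<in> chart_dom" "P' \<in> chart_dom" for P P' :: "(real ^ 'n ^ 'k) \<times> (real ^ 'k)"
      using dist_chart_le[OF \<sigma>, of P P'] that by simp
  qed simp
  have "hausdorff_measure (CARD('k) * (CARD('n) + 1)) (\<Gamma> :: (real ^ 'n ^ 'm) set)
      \<le> hausdorff_measure (CARD('k) * (CARD('n) + 1))
        (\<Union>i. chart i (\<sigma> i) ` (chart_dom :: ((real ^ 'n ^ 'k) \<times> (real ^ 'k)) set))"
    using \<Gamma>_covered_by_charts[OF \<sigma>] by (rule hausdorff_measure_mono)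
  also have "\<dots> \<le> (\<Sum>i\<in>UNIV. hausdorff_measure (CARD('k) * (CARD('n) + 1))
        (chart i (\<sigma> i) ` (chart_dom :: ((real ^ 'n ^ 'k) \<times> (real ^ 'k)) set)))"
    by (rule hausdorff_measure_UN_le) simp
  also have "\<dots> < top" using fin by (simp add: less_top)
  finally show ?thesis .
qed


text \<open>
  Near the point \<open>Y0\<close>, \<open>v = 0\<close> the chart shrinks distances by at most a constant factor, so its image has
  positive measure.  The rows of \<open>Y0\<close> are multiples of distinct unit vectors, hence row \<open>i\<close> of the
  image determines \<open>v\<close> stably.
\<close>

lemma hausdorff_measure_\<Gamma>_pos:
  assumes card: "CARD('k::finite) + 1 = CARD('m::finite)" and kn: "CARD('k) \<le> CARD('n)"
  shows "0 < hausdorff_measure (CARD('k) * (CARD('n) + 1)) (\<Gamma> :: (real ^ 'n ^ 'm) set)"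
proof -
  fix i :: 'm
  obtain \<sigma> :: "'k \<Rightarrow> 'm" where \<sigma>: "other_rows_enum i \<sigma>" using ex_other_rows_enum[OF card] by blast
  obtain \<tau> :: "'k \<Rightarrow> 'n" where \<tau>: "inj \<tau>"
    using kn inj_on_iff_card_le[of "UNIV :: 'k set" "UNIV :: 'n set"] by auto
  define k n where "k = real CARD('k)" and "n = real CARD('n)"
  have k1: "1 \<le> k" and n1: "1 \<le> n"
    using zero_less_card_finite[where 'a = 'k] zero_less_card_finite[where 'a = 'n] by (simp_all add: k_def n_def)
  \<comment> \<open>Small enough for \<open>k\<close> perturbations of size \<open>\<epsilon>\<close> to leave
    half of the entry \<open>1/4\<close> of \<open>Y0\<close>.\<close>
  define \<epsilon> where "\<epsilon> = 1 / (8 * (k + 1))"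
  have \<epsilon>: "0 < \<epsilon>" "k * \<epsilon> \<le> 1/8" "\<epsilon> \<le> 1/8" "(k + 1) * \<epsilon> = 1/8" using k1 by (simp_all add: \<epsilon>_def field_simps)
  define Y0 :: "real ^ 'n ^ 'k" where "Y0 = (\<chi> j c. if c = \<tau> j then 1/4 else 0)"
  define S where "S = cball (Y0, 0 :: real ^ 'k) \<epsilon>"
  have S: "\<bar>fst P $ j $ c - Y0 $ j $ c\<bar> \<le> \<epsilon>" "\<bar>snd P $ j\<bar> \<le> \<epsilon>" if P: "P \<in> S" for P j c
  proof -
    have d: "dist P (Y0, 0) \<le> \<epsilon>" using P by (simp add: S_def dist_commute)
    have "\<bar>fst P $ j $ c - Y0 $ j $ c\<bar> \<le> norm ((fst P - Y0) $ j)"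
      using component_le_norm_cart[of "(fst P - Y0) $ j" c] by simp
    also have "\<dots> \<le> norm (fst P - Y0)" by (rule Finite_Cartesian_Product.norm_nth_le)
    also have "\<dots> \<le> dist P (Y0, 0)" using dist_fst_le[of P "(Y0, 0)"] by (simp add: dist_norm)
    finally show "\<bar>fst P $ j $ c - Y0 $ j $ c\<bar> \<le> \<epsilon>" using d by simp
    have "\<bar>snd P $ j\<bar> \<le> norm (snd P)" by (rule component_le_norm_cart)
    also have "\<dots> \<le> dist P (Y0, 0)" using dist_snd_le[of P "(Y0, 0)"] by (simp add: dist_norm)
    finally show "\<bar>snd P $ j\<bar> \<le> \<epsilon>" using d by simp
  qed
  have entry: "\<bar>fst P $ j $ c\<bar> \<le> 1/2" if "P \<in> S" for P j c
    using S(1)[OF that, of j c] \<epsilon>(3) by (auto simp: Y0_def abs_le_iff split: if_splits)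
  have "chart i \<sigma> ` S \<subseteq> \<Gamma>"
  proof (rule image_subsetI)
    fix P assume P: "P \<in> S"
    obtain Y v where eq: "P = (Y, v)" by fastforce
    have "chart i \<sigma> P $ r $ c \<in> {-1/2..1/2}" for r c
    proof (cases "r = i")
      case True
      have "\<bar>\<Sum>j\<in>UNIV. v $ j * Y $ j $ c\<bar> \<le> (\<Sum>j\<in>(UNIV::'k set). \<epsilon> * (1/2))"
      proof (rule order_trans[OF sum_abs sum_mono])
        fix j
        show "\<bar>v $ j * Y $ j $ c\<bar> \<le> \<epsilon> * (1/2)"
          unfolding abs_mult using S(2)[OF P, of j] entry[OF P, of j c] \<epsilon>(1)
          by (intro mult_mono) (auto simp: eq)
      qed
      also have "\<dots> \<le> 1/2" using \<epsilon>(2) by (simp add: k_def)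
      finally have "-1/2 \<le> (\<Sum>j\<in>UNIV. v $ j * Y $ j $ c) \<and> (\<Sum>j\<in>UNIV. v $ j * Y $ j $ c) \<le> 1/2"
        by linarith
      then show ?thesis using True by (simp add: chart_row[OF \<sigma>] eq)
    next
      case False
      then obtain j where "r = \<sigma> j" using \<sigma> unfolding other_rows_enum_def by blast
      moreover have "-1/2 \<le> fst P $ j $ c \<and> fst P $ j $ c \<le> 1/2"
        using entry[OF P, of j c] by linarith
      ultimately show ?thesis by (simp add: chart_row[OF \<sigma>])
    qed
    moreover have "rank (chart i \<sigma> P) \<le> CARD('m) - 1"
    proof -
      define w :: "real ^ 'm" where "w = (\<chi> r. if r = i then 1 else v $ inv \<sigma> r)"
      have "w $ i = 1" "w $ \<sigma> j = v $ j" for j using \<sigma> by (auto simp: w_def other_rows_enum_def)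
      then have "w v* chart i \<sigma> P = 0"
        unfolding eq vector_mult_chart[OF \<sigma>] by (simp add: vec_eq_iff vector_matrix_mult_def)
      moreover have "w \<noteq> 0" using \<open>w $ i = 1\<close> by (metis zero_index zero_neq_one)
      ultimately show ?thesis unfolding rank_deficient_iff_left_kernel by blast
    qed
    ultimately show "chart i \<sigma> P \<in> \<Gamma>" by (simp add: \<Gamma>_def unit_cube_def)
  qed
  then have "hausdorff_measure (CARD('k) * (CARD('n) + 1)) (chart i \<sigma> ` S)
      \<le> hausdorff_measure (CARD('k) * (CARD('n) + 1)) (\<Gamma> :: (real ^ 'n ^ 'm) set)"
    by (rule hausdorff_measure_mono)
  moreover have "hausdorff_measure (CARD('k) * (CARD('n) + 1)) (chart i \<sigma> ` S) \<noteq> 0"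
  proof
    assume zero: "hausdorff_measure (CARD('k) * (CARD('n) + 1)) (chart i \<sigma> ` S) = 0"
    define L where "L = k * n + k * 16"
    have "0 < L" using k1 n1 unfolding L_def by (intro add_pos_pos mult_pos_pos) auto
    moreover have "dist P P' \<le> L * dist (chart i \<sigma> P) (chart i \<sigma> P')" if P: "P \<in> S" "P' \<in> S" for P P'
    proof -
      obtain Y v Y' v' where eq: "P = (Y, v)" "P' = (Y', v')" by fastforce
      define D where "D = dist (chart i \<sigma> P) (chart i \<sigma> P')"
      have comp: "\<bar>chart i \<sigma> P $ r $ c - chart i \<sigma> P' $ r $ c\<bar> \<le> D" for r c
      proof -
        have "\<bar>chart i \<sigma> P $ r $ c - chart i \<sigma> P' $ r $ c\<bar> \<le> norm ((chart i \<sigma> P - chart i \<sigma> P') $ r)"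
          using component_le_norm_cart[of "(chart i \<sigma> P - chart i \<sigma> P') $ r" c] by simp
        also have "\<dots> \<le> D" unfolding D_def dist_norm by (rule Finite_Cartesian_Product.norm_nth_le)
        finally show ?thesis .
      qed
      have DY: "\<bar>Y $ j $ c - Y' $ j $ c\<bar> \<le> D" for j c
        using comp[of "\<sigma> j" c] by (simp add: chart_row[OF \<sigma>] eq)
      have D0: "0 \<le> D" by (simp add: D_def)
      define u where "u = v - v'"
      have "Max (range (\<lambda>j. \<bar>u $ j\<bar>)) \<in> range (\<lambda>j. \<bar>u $ j\<bar>)" by (intro Max_in) auto
      then obtain j0 where "Max (range (\<lambda>j. \<bar>u $ j\<bar>)) = \<bar>u $ j0\<bar>" by blast
      then have max: "\<bar>u $ j\<bar> \<le> \<bar>u $ j0\<bar>" for j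
        using Max_ge[of "range (\<lambda>j. \<bar>u $ j\<bar>)" "\<bar>u $ j\<bar>"] by auto
      \<comment> \<open>In this column only row \<open>j0\<close> of \<open>Y\<close> has a large entry, so
        that the column reads off the largest coordinate of \<open>u\<close>.\<close>
      define c where "c = \<tau> j0"
      have Yc: "\<bar>Y $ j $ c - (if j = j0 then 1/4 else 0)\<bar> \<le> \<epsilon>" for j
        using S(1)[OF P(1), of j c] \<tau> by (auto simp: eq Y0_def c_def inj_eq)
      have "\<bar>\<Sum>j\<in>UNIV. u $ j * Y $ j $ c\<bar> \<le> 2 * D"
      proof -
        have "(\<Sum>j\<in>UNIV. u $ j * Y $ j $ c)
            = - (chart i \<sigma> P $ i $ c - chart i \<sigma> P' $ i $ c) - (\<Sum>j\<in>UNIV. v' $ j * (Y $ j $ c - Y' $ j $ c))"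
          by (simp add: chart_row[OF \<sigma>] eq u_def algebra_simps sum_subtractf sum.distrib)
        moreover have "\<bar>\<Sum>j\<in>UNIV. v' $ j * (Y $ j $ c - Y' $ j $ c)\<bar> \<le> (\<Sum>j\<in>(UNIV::'k set). \<epsilon> * D)"
        proof (rule order_trans[OF sum_abs sum_mono])
          fix j
          show "\<bar>v' $ j * (Y $ j $ c - Y' $ j $ c)\<bar> \<le> \<epsilon> * D"
            unfolding abs_mult using S(2)[OF P(2), of j] DY[of j c] \<epsilon>(1)
            by (intro mult_mono) (auto simp: eq)
        qed
        moreover have "(\<Sum>j\<in>(UNIV::'k set). \<epsilon> * D) \<le> D"
        proof -
          have "k * \<epsilon> * D \<le> 1 * D" using \<epsilon>(2) D0 by (intro mult_right_mono) auto
          then show ?thesis by (simp add: k_def)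
        qed
        ultimately show ?thesis using comp[of i c] by linarith
      qed
      moreover have "\<bar>u $ j0\<bar> / 8 \<le> \<bar>\<Sum>j\<in>UNIV. u $ j * Y $ j $ c\<bar>"
      proof -
        have "(\<Sum>j\<in>UNIV. u $ j * Y $ j $ c)
            = (\<Sum>j\<in>UNIV. u $ j * (if j = j0 then 1/4 else 0)) + (\<Sum>j\<in>UNIV. u $ j * (Y $ j $ c - (if j = j0 then 1/4 else 0)))"
          by (simp add: right_diff_distrib sum_subtractf)
        also have "(\<Sum>j\<in>UNIV. u $ j * (if j = j0 then 1/4 else 0)) = u $ j0 / 4"
          by (simp add: if_distrib sum.delta cong: if_cong)
        finally have split: "(\<Sum>j\<in>UNIV. u $ j * Y $ j $ c)
            = u $ j0 / 4 + (\<Sum>j\<in>UNIV. u $ j * (Y $ j $ c - (if j = j0 then 1/4 else 0)))" .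
        have "\<bar>\<Sum>j\<in>UNIV. u $ j * (Y $ j $ c - (if j = j0 then 1/4 else 0))\<bar> \<le> (\<Sum>j\<in>(UNIV::'k set). \<bar>u $ j0\<bar> * \<epsilon>)"
        proof (rule order_trans[OF sum_abs sum_mono])
          fix j
          show "\<bar>u $ j * (Y $ j $ c - (if j = j0 then 1/4 else 0))\<bar> \<le> \<bar>u $ j0\<bar> * \<epsilon>"
            unfolding abs_mult using max[of j] Yc[of j] by (intro mult_mono) auto
        qed
        also have "\<dots> \<le> \<bar>u $ j0\<bar> * (1/8)"
          using mult_left_mono[OF \<epsilon>(2), of "\<bar>u $ j0\<bar>"] by (simp add: k_def mult_ac)
        finally show ?thesis unfolding split by linarith
      qed
      ultimately have "\<bar>u $ j\<bar> \<le> 16 * D" for j using max[of j] by linarith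
      then have "norm u \<le> (\<Sum>j\<in>(UNIV::'k set). 16 * D)"
        by (intro order_trans[OF norm_le_l1_cart sum_mono])
      moreover have "norm (Y - Y') \<le> (\<Sum>j\<in>(UNIV::'k set). \<Sum>c\<in>(UNIV::'n set). D)"
      proof (rule order_trans[OF norm_vec_le_sum sum_mono])
        fix j
        show "norm ((Y - Y') $ j) \<le> (\<Sum>c\<in>(UNIV::'n set). D)"
          using DY by (intro order_trans[OF norm_le_l1_cart sum_mono]) simp
      qed
      moreover have "dist P P' \<le> norm (Y - Y') + norm u"
        unfolding eq dist_norm u_def using norm_Pair_le[of "Y - Y'" "v - v'"] by simp
      ultimately have "dist P P' \<le> k * n * D + k * 16 * D" by (simp add: k_def n_def)
      then show ?thesis by (simp add: L_def D_def algebra_simps)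
    qed
    ultimately have "emeasure lborel S \<le> ennreal ((2 * L) ^ DIM((real ^ 'n ^ 'k) \<times> (real ^ 'k)))
        * hausdorff_measure DIM((real ^ 'n ^ 'k) \<times> (real ^ 'k)) (chart i \<sigma> ` S)"
      by (intro emeasure_le_hausdorff_measure) (auto simp: S_def)
    then have "emeasure lborel S = 0" unfolding DIM_chart zero by simp
    then have "S \<in> null_sets lborel" by (intro null_setsI) (auto simp: S_def)
    then have "negligible S" unfolding negligible_iff_null_sets by (rule null_sets_completionI)
    then have "negligible (ball (Y0, 0 :: real ^ 'k) \<epsilon>)" by (rule negligible_subset) (auto simp: S_def)
    then show False using open_not_negligible[of "ball (Y0, 0 :: real ^ 'k) \<epsilon>"] \<epsilon>(1) by simp
  qed
  ultimately show ?thesis by (metis le_zero_eq not_gr_zero)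
qed

section \<open>The zero-one law on the rank-deficient matrices\<close>

lemma infnorm_le_cart:
  fixes x :: "real ^ 'n"
  assumes "\<And>i. \<bar>x $ i\<bar> \<le> b"
  shows "infnorm x \<le> b"
  unfolding infnorm_cart by (rule cSup_least) (use assms in auto)

lemma approximating_function_antimono:
  assumes "approximating_function \<psi>" "0 < x" "x \<le> y"
  shows "\<psi> y \<le> \<psi> x"
  using assms by (simp add: approximating_function_def monotone_on_def)

text \<open>
  Since the rows of \<open>Y\<close> are independent, \<open>u \<mapsto> u Y\<close> is bounded below, so a small \<open>q X\<close> forces small
  errors \<open>q (\<sigma> j) - q i * v j\<close>.  Infinitely many \<open>q\<close> give infinitely many denominators \<open>|q i|\<close>, because
  a bounded \<open>q i\<close> bounds the other coordinates as well.
\<close>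

lemma W0_chart_imp_approximable:
  fixes Y :: "real ^ 'n ^ 'k" and i :: "'m::finite" and \<psi> :: "real \<Rightarrow> real"
  assumes \<sigma>: "other_rows_enum i \<sigma>" and \<psi>: "approximating_function \<psi>"
    and W: "chart i \<sigma> (Y, v) \<in> W0 \<psi>" and v: "\<And>j. \<bar>v $ j\<bar> \<le> 1"
    and indep: "\<And>u. u v* Y = 0 \<Longrightarrow> u = 0"
  shows "\<exists>C::nat. infinite {r :: nat. \<exists>p :: int ^ 'k. \<forall>j. \<bar>real r * v $ j - p $ j\<bar> \<le> C * \<psi> (max 1 (real r))}"
proof -
  have \<psi>_mono: "\<psi> y \<le> \<psi> x" if "0 < x" "x \<le> y" for x y
    using approximating_function_antimono[OF \<psi> that] .
  have \<psi>_pos: "0 < \<psi> x" if "0 < x" for x using \<psi> that by (simp add: approximating_function_def)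
  have lin: "linear (\<lambda>u. u v* Y)"
    using matrix_vector_mul_linear[of "transpose Y"] by simp
  moreover have "inj (\<lambda>u. u v* Y)"
    using linear_injective_0[OF lin] indep by blast
  ultimately obtain B where B: "0 < B" "\<And>u. B * norm u \<le> norm (u v* Y)"
    by (rule linear_inj_bounded_below_pos) (rule that)
  obtain C :: nat where C: "sqrt DIM(real ^ 'n) / B \<le> C" using real_arch_simple by blast
  define Q where "Q = {q :: int ^ 'm. q \<noteq> 0 \<and> infnorm (real_vec q v* chart i \<sigma> (Y, v)) < \<psi> (infnorm (real_vec q))}"
  have infQ: "infinite Q" using W by (simp add: W0_def Q_def)
  have Q: "\<bar>q $ \<sigma> j - q $ i * v $ j\<bar> \<le> C * \<psi> (max 1 \<bar>real_of_int (q $ i)\<bar>)" if q: "q \<in> Q" for q j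
  proof -
    define u where "u = (\<chi> j. real_of_int (q $ \<sigma> j) - q $ i * v $ j)"
    obtain r where r: "q $ r \<noteq> 0" using q by (auto simp: Q_def vec_eq_iff)
    have "1 \<le> \<bar>real_vec q $ r\<bar>" using r by (simp add: real_vec_def)
    also have "\<dots> \<le> infnorm (real_vec q)" by (rule component_le_infnorm_cart)
    finally have big: "max 1 \<bar>real_of_int (q $ i)\<bar> \<le> infnorm (real_vec q)"
      using component_le_infnorm_cart[of "real_vec q" i] by (simp add: real_vec_def)
    have m0: "0 < max 1 \<bar>real_of_int (q $ i)\<bar>" by simp
    have "B * norm u \<le> norm (u v* Y)" by (rule B)
    also have "\<dots> \<le> sqrt DIM(real ^ 'n) * infnorm (u v* Y)" by (rule norm_le_infnorm)
    also have "u v* Y = real_vec q v* chart i \<sigma> (Y, v)"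
      by (simp add: vector_mult_chart[OF \<sigma>] u_def real_vec_def)
    also have "sqrt DIM(real ^ 'n) * infnorm (real_vec q v* chart i \<sigma> (Y, v))
        \<le> sqrt DIM(real ^ 'n) * \<psi> (max 1 \<bar>real_of_int (q $ i)\<bar>)"
      using q \<psi>_mono[OF m0 big] by (intro mult_left_mono) (auto simp: Q_def)
    finally have "norm u \<le> sqrt DIM(real ^ 'n) / B * \<psi> (max 1 \<bar>real_of_int (q $ i)\<bar>)"
      using B(1) by (simp add: field_simps)
    also have "\<dots> \<le> C * \<psi> (max 1 \<bar>real_of_int (q $ i)\<bar>)"
      using C \<psi>_pos[OF m0] by (intro mult_right_mono) auto
    finally show ?thesis using component_le_norm_cart[of u j] by (simp add: u_def)
  qed
  define F where "F = {r :: nat. \<exists>p :: int ^ 'k. \<forall>j. \<bar>real r * v $ j - p $ j\<bar> \<le> C * \<psi> (max 1 (real r))}"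
  have QF: "nat \<bar>q $ i\<bar> \<in> F" if q: "q \<in> Q" for q
  proof -
    \<comment> \<open>Replace \<open>q\<close> by \<open>-q\<close> if necessary to make the denominator
      nonnegative.\<close>
    define p :: "int ^ 'k" where "p = (\<chi> j. if 0 \<le> q $ i then q $ \<sigma> j else - q $ \<sigma> j)"
    have "\<bar>real (nat \<bar>q $ i\<bar>) * v $ j - p $ j\<bar> = \<bar>q $ \<sigma> j - q $ i * v $ j\<bar>" for j
      by (auto simp: p_def abs_minus_commute)
    then show ?thesis using Q[OF q] unfolding F_def by (auto intro!: exI[of _ p])
  qed
  have "infinite F"
  proof
    assume "finite F"
    then obtain M where M: "\<And>r. r \<in> F \<Longrightarrow> r \<le> M" unfolding finite_nat_set_iff_bounded_le by blast
    define R where "R = real M + C * \<psi> 1"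
    have R0: "0 \<le> R" using \<psi>_pos[of 1] by (simp add: R_def)
    have "Q \<subseteq> {q :: int ^ 'm. \<forall>r. - R \<le> q $ r \<and> q $ r \<le> - R + 2 * R}"
    proof
      fix q assume q: "q \<in> Q"
      have qi: "\<bar>real_of_int (q $ i)\<bar> \<le> M" using M[OF QF[OF q]] by linarith
      have "\<bar>real_of_int (q $ r)\<bar> \<le> R" for r
      proof (cases "r = i")
        case True
        then show ?thesis using qi \<psi>_pos[of 1] by (simp add: R_def add_increasing2)
      next
        case False
        then obtain j where j: "r = \<sigma> j" using \<sigma> unfolding other_rows_enum_def by blast
        have "\<bar>q $ \<sigma> j - q $ i * v $ j\<bar> \<le> C * \<psi> 1"
          using Q[OF q, of j] \<psi>_mono[of 1 "max 1 \<bar>real_of_int (q $ i)\<bar>"] 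
          by (meson max.cobounded1 mult_left_mono of_nat_0_le_iff order_trans zero_less_one)
        moreover have "\<bar>q $ i * v $ j\<bar> \<le> real M * 1"
          unfolding abs_mult using qi v[of j] by (intro mult_mono) auto
        ultimately show ?thesis unfolding j R_def by linarith
      qed
      note bound = this
      have "- R \<le> q $ r \<and> q $ r \<le> - R + 2 * R" for r using bound[of r] by linarith
      then show "q \<in> {q :: int ^ 'm. \<forall>r. - R \<le> q $ r \<and> q $ r \<le> - R + 2 * R}" by blast
    qed
    moreover have "finite {q :: int ^ 'm. \<forall>r. - R \<le> q $ r \<and> q $ r \<le> - R + 2 * R}"
      using R0 by (intro finite_card_int_vectors_in_box(1)) simp
    ultimately show False using infQ finite_subset by blast
  qed
  then show ?thesis unfolding F_def by blast
qed

text \<open>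
  The entries of \<open>Y\<close> are at most \<open>1/2\<close>, so errors below \<open>\<psi>(r) / k\<close> in each of the \<open>k\<close> coordinates
  make \<open>|q X|\<close> at most \<open>\<psi>(r) / 2\<close>.  Once \<open>\<psi>(r) < 1\<close>, the largest coordinate of \<open>q\<close> is \<open>q i = r\<close>, because
  \<open>|v j| \<le> 1\<close> and the coordinates are integers; hence \<open>\<psi>(|q|)\<close> is exactly \<open>\<psi>(r)\<close>.
\<close>

lemma approximable_imp_W0_chart:
  fixes Y :: "real ^ 'n ^ 'k" and i :: "'m::finite" and \<psi> :: "real \<Rightarrow> real"
  assumes \<sigma>: "other_rows_enum i \<sigma>" and \<psi>: "approximating_function \<psi>"
    and dom: "(Y, v) \<in> chart_dom" and cube: "chart i \<sigma> (Y, v) \<in> unit_cube"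
    and inf: "infinite {r :: nat. \<exists>p :: int ^ 'k. \<forall>j. \<bar>real r * v $ j - p $ j\<bar> < 1 / CARD('k) * \<psi> (max 1 (real r))}"
  shows "chart i \<sigma> (Y, v) \<in> W0 \<psi>"
proof -
  define F where "F = {r :: nat. \<exists>p :: int ^ 'k. \<forall>j. \<bar>real r * v $ j - p $ j\<bar> < 1 / CARD('k) * \<psi> (max 1 (real r))}"
  have \<psi>_pos: "0 < \<psi> x" if "0 < x" for x using \<psi> that by (simp add: approximating_function_def)
  have "eventually (\<lambda>x. \<psi> x < 1) at_top"
    using \<psi> by (intro order_tendstoD(2)[of \<psi> 0]) (simp_all add: approximating_function_def)
  then obtain R where R: "\<And>x. R \<le> x \<Longrightarrow> \<psi> x < 1" unfolding eventually_at_top_linorder by blast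
  obtain N :: nat where N: "R \<le> N" using real_arch_simple by blast
  define G where "G = F - {..N}"
  have infG: "infinite G" using inf unfolding G_def F_def by simp
  have "\<forall>r\<in>G. \<exists>p :: int ^ 'k. \<forall>j. \<bar>real r * v $ j - p $ j\<bar> < 1 / CARD('k) * \<psi> r"
    by (auto simp: G_def F_def max_def)
  then obtain p :: "nat \<Rightarrow> int ^ 'k" where
    p: "\<And>r j. r \<in> G \<Longrightarrow> \<bar>real r * v $ j - p r $ j\<bar> < 1 / CARD('k) * \<psi> r" by metis
  define q :: "nat \<Rightarrow> int ^ 'm" where "q = (\<lambda>r. \<chi> s. if s = i then int r else p r $ inv \<sigma> s)"
  have qi: "q r $ i = int r" and q\<sigma>: "q r $ \<sigma> j = p r $ j" for r j
    using \<sigma> by (auto simp: q_def other_rows_enum_def)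
  define Q where "Q = {q :: int ^ 'm. q \<noteq> 0 \<and> infnorm (real_vec q v* chart i \<sigma> (Y, v)) < \<psi> (infnorm (real_vec q))}"
  have "q r \<in> Q" if r: "r \<in> G" for r
  proof -
    have r0: "0 < r" and rR: "R \<le> real r" using r N by (auto simp: G_def)
    have v1: "\<bar>v $ j\<bar> \<le> 1" and Y1: "\<bar>Y $ j $ c\<bar> \<le> 1/2" for j c using dom by (auto simp: chart_dom_def)
    have pj: "\<bar>real_of_int (p r $ j)\<bar> \<le> r" for j
    proof -
      have "1 / CARD('k) * \<psi> r \<le> 1 * \<psi> r" using \<psi>_pos[of r] r0 by (intro mult_right_mono) auto
      then have "\<bar>real r * v $ j - p r $ j\<bar> < 1" using p[OF r, of j] R[OF rR] by linarith
      moreover have "\<bar>real r * v $ j\<bar> \<le> real r * 1"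
        unfolding abs_mult using v1[of j] by (intro mult_mono) auto
      ultimately have "\<bar>real_of_int (p r $ j)\<bar> < real r + 1" by linarith
      then have "real_of_int \<bar>p r $ j\<bar> < real_of_int (int r + 1)" by simp
      then have "\<bar>p r $ j\<bar> \<le> int r" unfolding of_int_less_iff by simp
      then show ?thesis by linarith
    qed
    have "infnorm (real_vec (q r)) \<le> r"
    proof (rule infnorm_le_cart)
      fix s
      show "\<bar>real_vec (q r) $ s\<bar> \<le> real r"
      proof (cases "s = i")
        case False
        then obtain j where "s = \<sigma> j" using \<sigma> unfolding other_rows_enum_def by blast
        then show ?thesis using pj[of j] by (simp add: real_vec_def q\<sigma>)
      qed (simp add: real_vec_def qi)
    qed
    moreover have "r \<le> infnorm (real_vec (q r))"
      using component_le_infnorm_cart[of "real_vec (q r)" i] by (simp add: real_vec_def qi)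
    ultimately have norm_q: "infnorm (real_vec (q r)) = r" by simp
    have "infnorm (real_vec (q r) v* chart i \<sigma> (Y, v)) \<le> \<psi> r / 2"
    proof (rule infnorm_le_cart)
      fix c
      have "(real_vec (q r) v* chart i \<sigma> (Y, v)) $ c = (\<Sum>j\<in>UNIV. (p r $ j - real r * v $ j) * Y $ j $ c)"
      proof -
        have "real_vec (q r) v* chart i \<sigma> (Y, v) = (\<chi> j. p r $ j - real r * v $ j) v* Y"
          unfolding vector_mult_chart[OF \<sigma>] by (simp add: real_vec_def qi q\<sigma>)
        then show ?thesis by (simp add: vector_matrix_mult_def mult.commute)
      qed
      also have "\<bar>\<dots>\<bar> \<le> (\<Sum>j\<in>(UNIV::'k set). (1 / CARD('k) * \<psi> r) * (1/2))"
      proof (rule order_trans[OF sum_abs sum_mono])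
        fix j
        show "\<bar>(p r $ j - real r * v $ j) * Y $ j $ c\<bar> \<le> (1 / CARD('k) * \<psi> r) * (1/2)"
          unfolding abs_mult using p[OF r, of j] Y1[of j c]
          by (intro mult_mono) (auto simp: abs_minus_commute)
      qed
      also have "\<dots> = \<psi> r / 2" by simp
      finally show "\<bar>(real_vec (q r) v* chart i \<sigma> (Y, v)) $ c\<bar> \<le> \<psi> r / 2" .
    qed
    also have "\<dots> < \<psi> r" using \<psi>_pos[of r] r0 by simp
    finally have "infnorm (real_vec (q r) v* chart i \<sigma> (Y, v)) < \<psi> (infnorm (real_vec (q r)))"
      by (simp add: norm_q)
    moreover have "q r \<noteq> 0" using qi[of r] r0 by (metis of_nat_0_eq_iff zero_index less_irrefl)
    ultimately show ?thesis by (simp add: Q_def)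
  qed
  then have "q ` G \<subseteq> Q" by blast
  moreover have "inj_on q G" using qi by (metis inj_onI of_nat_eq_iff)
  ultimately have "infinite Q" using infG by (meson finite_imageD infinite_super)
  then show ?thesis using cube by (simp add: W0_def Q_def)
qed

lemma summable_max_one_iff:
  fixes \<psi> :: "real \<Rightarrow> real"
  shows "summable (\<lambda>n. \<psi> (max 1 (real n)) ^ k) \<longleftrightarrow> summable (\<lambda>n. \<psi> (real (Suc n)) ^ k)"
proof -
  have "(\<lambda>n. \<psi> (max 1 (real (Suc n))) ^ k) = (\<lambda>n. \<psi> (real (Suc n)) ^ k)" by (simp add: max_def)
  then show ?thesis using summable_Suc_iff[of "\<lambda>n. \<psi> (max 1 (real n)) ^ k"] by simp
qed

lemma hausdorff_measure_W0_eq_0: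
  fixes \<psi> :: "real \<Rightarrow> real"
  assumes card: "CARD('k::finite) + 1 = CARD('m::finite)" and kn: "CARD('k) \<le> CARD('n)"
    and \<psi>: "approximating_function \<psi>" and sm: "summable (\<lambda>n. \<psi> (real (Suc n)) ^ CARD('k))"
  shows "hausdorff_measure (CARD('k) * (CARD('n) + 1)) (W0 \<psi> \<inter> \<Gamma> :: (real ^ 'n ^ 'm) set) = 0"
proof -
  obtain \<sigma> :: "'m \<Rightarrow> 'k \<Rightarrow> 'm" where \<sigma>: "\<And>i. other_rows_enum i (\<sigma> i)"
    using ex_other_rows_enum[OF card] by metis
  define D where "D = {Y :: real ^ 'n ^ 'k. \<exists>u. u \<noteq> 0 \<and> u v* Y = 0}"
  define V where "V = (\<lambda>C. {v :: real ^ 'k. (\<forall>i. \<bar>v $ i\<bar> \<le> 1) \<and>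
    infinite {q :: nat. \<exists>p :: int ^ 'k. \<forall>i. \<bar>real q * v $ i - p $ i\<bar> \<le> real C * \<psi> (max 1 (real q))}})"
  have "negligible (V C)" for C :: nat
    unfolding V_def
  proof (rule khintchine_convergence)
    show "0 \<le> real C * \<psi> (max 1 (real q))" for q
      using \<psi> by (simp add: approximating_function_def less_imp_le)
    show "real C * \<psi> (max 1 (real q)) \<le> real C * \<psi> 1" for q
      by (intro mult_left_mono approximating_function_antimono[OF \<psi>]) auto
    show "summable (\<lambda>n. (real C * \<psi> (max 1 (real n))) ^ CARD('k))"
      unfolding power_mult_distrib using sm by (intro summable_mult) (simp add: summable_max_one_iff)
  qed
  then have V: "negligible (\<Union>C. V C)" by (intro negligible_countable_Union) auto
  define N where "N = D \<times> UNIV \<union> UNIV \<times> (\<Union>C. V C)"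
  have N: "negligible N"
    unfolding N_def D_def using V negligible_dependent_rows[OF kn]
    by (intro negligible_Un negligible_cylinder)
  have "W0 \<psi> \<inter> \<Gamma> \<subseteq> (\<Union>i. chart i (\<sigma> i) ` (chart_dom \<inter> N))"
  proof
    fix X :: "real ^ 'n ^ 'm" assume X: "X \<in> W0 \<psi> \<inter> \<Gamma>"
    then have "X \<in> (\<Union>i. chart i (\<sigma> i) ` chart_dom)" using \<Gamma>_covered_by_charts[OF \<sigma>] by blast
    then obtain i P where iP: "P \<in> chart_dom" "X = chart i (\<sigma> i) P" by blast
    obtain Y v where P: "P = (Y, v)" by fastforce
    have v: "\<And>j. \<bar>v $ j\<bar> \<le> 1" using iP(1) by (simp add: P chart_dom_def)
    have "P \<in> N"
    proof (cases "Y \<in> D")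
      case False
      then have "\<And>u. u v* Y = 0 \<Longrightarrow> u = 0" by (auto simp: D_def)
      then obtain C :: nat where
        "infinite {r :: nat. \<exists>p :: int ^ 'k. \<forall>j. \<bar>real r * v $ j - p $ j\<bar> \<le> C * \<psi> (max 1 (real r))}"
        using W0_chart_imp_approximable[OF \<sigma> \<psi>, of i Y v] X iP(2) v P by blast
      then have "v \<in> V C" using v by (simp add: V_def)
      then show ?thesis by (auto simp: N_def P)
    qed (simp add: N_def P)
    then show "X \<in> (\<Union>i. chart i (\<sigma> i) ` (chart_dom \<inter> N))" using iP by blast
  qed
  then have "hausdorff_measure (CARD('k) * (CARD('n) + 1)) (W0 \<psi> \<inter> \<Gamma> :: (real ^ 'n ^ 'm) set)
      \<le> hausdorff_measure (CARD('k) * (CARD('n) + 1)) (\<Union>i. chart i (\<sigma> i) ` (chart_dom \<inter> N))"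
    by (rule hausdorff_measure_mono)
  also have "\<dots> \<le> (\<Sum>i\<in>UNIV. hausdorff_measure (CARD('k) * (CARD('n) + 1)) (chart i (\<sigma> i) ` (chart_dom \<inter> N)))"
    by (rule hausdorff_measure_UN_le) simp
  also have "\<dots> = 0" using hausdorff_measure_chart_image_negligible[OF \<sigma> N] by simp
  finally show ?thesis by simp
qed

lemma hausdorff_measure_\<Gamma>_minus_W0_eq_0:
  fixes \<psi> :: "real \<Rightarrow> real"
  assumes card: "CARD('k::finite) + 1 = CARD('m::finite)"
    and \<psi>: "approximating_function \<psi>" and div: "\<not> summable (\<lambda>n. \<psi> (real (Suc n)) ^ CARD('k))"
  shows "hausdorff_measure (CARD('k) * (CARD('n) + 1)) (\<Gamma> - W0 \<psi> :: (real ^ 'n ^ 'm) set) = 0"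
proof -
  obtain \<sigma> :: "'m \<Rightarrow> 'k \<Rightarrow> 'm" where \<sigma>: "\<And>i. other_rows_enum i (\<sigma> i)"
    using ex_other_rows_enum[OF card] by metis
  define V where "V = {v :: real ^ 'k.
    finite {q :: nat. \<exists>p :: int ^ 'k. \<forall>i. \<bar>real q * v $ i - p $ i\<bar> < 1 / CARD('k) * \<psi> (max 1 (real q))}}"
  have "negligible V"
    unfolding V_def
  proof (rule khintchine_divergence)
    show "0 < 1 / CARD('k) * \<psi> (max 1 (real q))" for q
      using \<psi> by (simp add: approximating_function_def)
    show "antimono (\<lambda>q. 1 / CARD('k) * \<psi> (max 1 (real q)))"
      by (intro antimonoI mult_left_mono approximating_function_antimono[OF \<psi>]) auto
    show "\<not> summable (\<lambda>n. (1 / CARD('k) * \<psi> (max 1 (real n))) ^ CARD('k))"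
      unfolding power_mult_distrib using div by (simp add: summable_cmult_iff summable_max_one_iff)
  qed
  then have N: "negligible ((UNIV :: (real ^ 'n ^ 'k) set) \<times> V)" by (rule negligible_cylinder)
  have "\<Gamma> - W0 \<psi> \<subseteq> (\<Union>i. chart i (\<sigma> i) ` (chart_dom \<inter> (UNIV :: (real ^ 'n ^ 'k) set) \<times> V))"
  proof
    fix X :: "real ^ 'n ^ 'm" assume X: "X \<in> \<Gamma> - W0 \<psi>"
    then have "X \<in> (\<Union>i. chart i (\<sigma> i) ` chart_dom)" using \<Gamma>_covered_by_charts[OF \<sigma>] by blast
    then obtain i P where iP: "P \<in> chart_dom" "X = chart i (\<sigma> i) P" by blast
    obtain Y v where P: "P = (Y, v)" by fastforce
    have "X \<in> unit_cube" using X by (simp add: \<Gamma>_def)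
    then have "v \<in> V"
      using approximable_imp_W0_chart[OF \<sigma> \<psi>, of Y v i] X iP P unfolding V_def by blast
    then show "X \<in> (\<Union>i. chart i (\<sigma> i) ` (chart_dom \<inter> (UNIV :: (real ^ 'n ^ 'k) set) \<times> V))"
      using iP P by blast
  qed
  then have "hausdorff_measure (CARD('k) * (CARD('n) + 1)) (\<Gamma> - W0 \<psi> :: (real ^ 'n ^ 'm) set)
      \<le> hausdorff_measure (CARD('k) * (CARD('n) + 1)) (\<Union>i. chart i (\<sigma> i) ` (chart_dom \<inter> (UNIV :: (real ^ 'n ^ 'k) set) \<times> V))"
    by (rule hausdorff_measure_mono)
  also have "\<dots> \<le> (\<Sum>i\<in>UNIV. hausdorff_measure (CARD('k) * (CARD('n) + 1)) (chart i (\<sigma> i) ` (chart_dom \<inter> (UNIV :: (real ^ 'n ^ 'k) set) \<times> V)))"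
    by (rule hausdorff_measure_UN_le) simp
  also have "\<dots> = 0" using hausdorff_measure_chart_image_negligible[OF \<sigma> N] by simp
  finally show ?thesis by simp
qed

lemma \<mu>_W0_dichotomy:
  assumes card: "CARD('k::finite) + 1 = CARD('m::finite)" and kn: "CARD('k) \<le> CARD('n)"
    and \<psi>: "approximating_function \<psi>"
  shows "\<mu> (W0 \<psi> :: (real ^ 'n ^ 'm) set) = (if summable (\<lambda>n. \<psi> (real (Suc n)) ^ CARD('k)) then 0 else 1)"
proof -
  define H :: "(real ^ 'n ^ 'm) set \<Rightarrow> ennreal" where "H = hausdorff_measure (CARD('k) * (CARD('n) + 1))"
  have k: "CARD('m) - 1 = CARD('k)" using card by simp
  have \<mu>: "\<mu> (W0 \<psi> :: (real ^ 'n ^ 'm) set) = H (W0 \<psi> \<inter> \<Gamma>) / H \<Gamma>"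
    by (simp only: \<mu>_def H_def Let_def k)
  have H\<Gamma>: "H \<Gamma> \<noteq> 0" "H \<Gamma> < top"
    using hausdorff_measure_\<Gamma>_pos[OF card kn] hausdorff_measure_\<Gamma>_finite[OF card, where 'n = 'n] by (simp_all add: H_def)
  show ?thesis
  proof (cases "summable (\<lambda>n. \<psi> (real (Suc n)) ^ CARD('k))")
    case True
    then show ?thesis
      using hausdorff_measure_W0_eq_0[OF card kn \<psi>] by (simp add: \<mu> H_def)
  next
    case False
    have "H \<Gamma> \<le> H (W0 \<psi> \<inter> \<Gamma> \<union> (\<Gamma> - W0 \<psi>))" unfolding H_def by (rule hausdorff_measure_mono) blast
    also have "\<dots> \<le> H (W0 \<psi> \<inter> \<Gamma>) + H (\<Gamma> - W0 \<psi>)" unfolding H_def by (rule hausdorff_measure_Un)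
    also have "H (\<Gamma> - W0 \<psi>) = 0"
      unfolding H_def by (rule hausdorff_measure_\<Gamma>_minus_W0_eq_0[OF card \<psi> False])
    finally have "H \<Gamma> \<le> H (W0 \<psi> \<inter> \<Gamma>)" by simp
    moreover have "H (W0 \<psi> \<inter> \<Gamma>) \<le> H \<Gamma>" unfolding H_def by (rule hausdorff_measure_mono) blast
    ultimately have "H (W0 \<psi> \<inter> \<Gamma>) = H \<Gamma>" by simp
    then show ?thesis using False H\<Gamma> by (simp add: \<mu>)
  qed
qed

text \<open>
  The parameters of a chart are indexed by the \<open>m - 1\<close> rows other than the distinguished one, so an index
  type with one element fewer than a given finite type is required.  The condition on the cardinality only
  keeps the type nonempty.
\<close>

typedef ('a :: finite) all_but_one = "{x :: 'a. 2 \<le> CARD('a) \<longrightarrow> x \<noteq> (SOME x. True)}"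
proof -
  have "\<exists>x :: 'a. x \<noteq> (SOME x. True)" if "2 \<le> CARD('a)"
  proof (rule ccontr)
    assume "\<not> ?thesis"
    then have "(UNIV :: 'a set) = {SOME x. True}" by auto
    then have "CARD('a) = 1" by (metis card_1_singleton_iff One_nat_def)
    then show False using that by simp
  qed
  then show ?thesis by blast
qed

instance all_but_one :: (finite) finite
proof
  show "finite (UNIV :: 'a all_but_one set)"
    by (metis type_definition.Abs_image[OF type_definition_all_but_one] finite_code finite_imageI)
qed

lemma card_all_but_one:
  assumes "2 \<le> CARD('a::finite)"
  shows "CARD('a all_but_one) + 1 = CARD('a)"
proof -
  have "CARD('a all_but_one) = card {x :: 'a. 2 \<le> CARD('a) \<longrightarrow> x \<noteq> (SOME x. True)}"
    by (rule type_definition.card[OF type_definition_all_but_one])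
  also have "{x :: 'a. 2 \<le> CARD('a) \<longrightarrow> x \<noteq> (SOME x. True)} = UNIV - {SOME x. True}"
    using assms by auto
  finally show ?thesis using assms by (simp add: card_Diff_singleton)
qed

theorem corollary4:
  fixes m n :: nat and \<psi> f g :: "real \<Rightarrow> real"
  assumes "m = CARD('m::finite)" and "n = CARD('n::finite)"
    and "2 \<le> m" and "m \<le> n"
    and "approximating_function \<psi>"
    and "\<And>r. r > 0 \<Longrightarrow> f r = r ^ ((m - 1) * (n + 1))"
    and "\<And>r. r > 0 \<Longrightarrow> g r = r powi (- int ((n - m + 1) * (m - 1))) * f r"
    and "dimension_function f" and "dimension_function g"
    and "monotonic_on {0<..} (\<lambda>r. r powi (- int ((m - 1) * (n + 1))) * f r)"
    and "mono_on {0<..} (\<lambda>r. r powi (- int ((m - 1) * n)) * f r)"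
  shows "\<mu> (W0 \<psi> :: (real ^ 'n ^ 'm) set) =
    (if summable (\<lambda>r. \<psi> (real (Suc r)) ^ (m - 1)) then 0 else 1)"
proof -
  have card: "CARD('m all_but_one) + 1 = CARD('m)"
    using assms(1,3) by (intro card_all_but_one) simp
  have k: "CARD('m all_but_one) = m - 1" and kn: "CARD('m all_but_one) \<le> CARD('n)"
    using card assms(1,2,4) by linarith+
  show ?thesis
    using \<mu>_W0_dichotomy[OF card kn assms(5)] unfolding k .
qed

end
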